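(* Let $M$ be a $C^{2,1}$ manifold endowed with a locally Lipschitz spray. ($\exp$) The set $\Omega$ is open in the topology of $TM$. The exponential map $\exp\colon\Omega\to M\times M$, $\Omega\subset TM$, is locally Lipschitz. Moreover, $\exp$ is strongly differentiable over the zero section, namely at every point of the image of $p\mapsto 0_p$. The map $\exp$ provides a Lipeomorphism between an open star-shaped neighborhood of the zero section and an open neighborhood of the diagonal of $M\times M$. ($\exp_p$) For every $p\in M$ the set $\Omega_p$ is open in the topology of $T_pM$. The pointed exponential map $\exp_p\colon\Omega_p\to M$, $\Omega_p\subset T_pM$, is locally Lipschitz and strongly differentiable at the origin. The map $\exp_p$ provides a Lipeomorphism between a star-shaped open subset of $\Omega_p$ and an open neighborhood of $p$.
   Context: $C^{k,1}$ means $C^{k,1}_{loc}$. $M$ is an $n$-dimensional paracompact connected $C^{2,1}$ manifold, $\pi\colon TM\to M$ its tangent bundle. Each chart $x^\mu$ on $U\subset M$ induces a chart $(x^\mu,v^\mu)$ on $\pi^{-1}(U)$; Lipschitz conditions and (strong) differentiability are understood in such charts. A locally Lipschitz spray on $M$ assigns to each chart locally Lipschitz functions $H^\mu(x,v)$ on $\pi^{-1}(U)$ with $H^\mu(x,sv)=s^2H^\mu(x,v)$ for every $s>0$, transforming under a change of chart $\tilde x(x)$ (with $\tilde v^\mu=\frac{\partial\tilde x^\mu}{\partial x^\nu}v^\nu$) as $\tilde H^\mu(\tilde x,\tilde v)=\frac{\partial^2\tilde x^\mu}{\partial x^\alpha\partial x^\beta}v^\alpha v^\beta+\frac{\partial\tilde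 x^\mu}{\partial x^\nu}H^\nu(x,v)$, so that the system $\dot x^\mu=v^\mu$, $\dot v^\mu=H^\mu(x,v)$ is chart independent. Non-stationary solutions are called geodesics. For $v\in TM$, $\gamma_v$ denotes the unique solution with $\gamma_v(0)=\pi(v)$, $\gamma_v'(0)=v$ (constant if $v=0$). $\Omega\subset TM$ is the set of those $v$ for which $\gamma_v(t)$ exists at least for $t\in[0,1]$, $\Omega_p=\Omega\cap\pi^{-1}(p)$, $\exp v:=(\pi(v),\gamma_v(1))$ on $\Omega$, and $\exp_p v:=\gamma_v(1)$ on $\Omega_p$. A Lipeomorphism is a homeomorphism $f$ such that both $f$ and $f^{-1}$ are locally Lipschitz. A subset $A$ of $TM$ (or $T_pM$) is star-shaped if $v\in A$ implies $sv\in A$ for every $s\in[0,1]$. A function $f\colon O\to F$, $O$ open in a Banach space $E$, is strongly differentiable at $p\in O$ with strong differential the bounded linear map $L\colon E\to F$ if for every $\epsilon>0$ there is $\delta>0$ such that $|q_1-p|\le\delta$, $|q_2-p|\le\delta$ imply $|f(q_1)-f(q_2)-L(q_1-q_2)|\le\epsilon|q_1-q_2|$. *)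

theory Defs
  imports "HOL-Analysis.Analysis"
begin

section \<open>Regularity in coordinates\<close>

definition locally_lipschitz_on :: "'e::metric_space set \<Rightarrow> ('e \<Rightarrow> 'f::metric_space) \<Rightarrow> bool" where
  "locally_lipschitz_on S f \<longleftrightarrow>
     (\<forall>x\<in>S. \<exists>r>0. \<exists>C. C-lipschitz_on (ball x r \<inter> S) f)"

text \<open>The set \<open>S\<close> is meant to be open. The first derivative is continuous since it is
  differentiable, the second one since it is locally Lipschitz.\<close>

definition C21_on :: "'e::real_normed_vector set \<Rightarrow> ('e \<Rightarrow> 'f::real_normed_vector) \<Rightarrow> bool" where
  "C21_on S f \<longleftrightarrow>
     (\<exists>(f' :: 'e \<Rightarrow> 'e \<Rightarrow>\<^sub>L 'f) (f'' :: 'e \<Rightarrow> 'e \<Rightarrow>\<^sub>L ('e \<Rightarrow>\<^sub>L 'f)).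
        (\<forall>x\<in>S. (f has_derivative blinfun_apply (f' x)) (at x)) \<and>
        (\<forall>x\<in>S. (f' has_derivative blinfun_apply (f'' x)) (at x)) \<and>
        locally_lipschitz_on S f'')"

definition has_strong_derivative ::
  "('e::real_normed_vector \<Rightarrow> 'f::real_normed_vector) \<Rightarrow> ('e \<Rightarrow> 'f) \<Rightarrow> 'e set \<Rightarrow> 'e \<Rightarrow> bool" where
  "has_strong_derivative f L S p \<longleftrightarrow>
     open S \<and> p \<in> S \<and> bounded_linear L \<and>
     (\<forall>\<epsilon>>0. \<exists>\<delta>>0. \<forall>q\<^sub>1\<in>S. \<forall>q\<^sub>2\<in>S.
        norm (q\<^sub>1 - p) \<le> \<delta> \<longrightarrow> norm (q\<^sub>2 - p) \<le> \<delta> \<longrightarrow>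
        norm (f q\<^sub>1 - f q\<^sub>2 - L (q\<^sub>1 - q\<^sub>2)) \<le> \<epsilon> * norm (q\<^sub>1 - q\<^sub>2))"


section \<open>Charts\<close>

text \<open>A chart is a pair of its domain and its coordinate map; the values of the coordinate map
  outside the domain are irrelevant.\<close>

type_synonym ('p, 'e) chart = "'p set \<times> ('p \<Rightarrow> 'e)"

abbreviation dom_chart :: "('p, 'e) chart \<Rightarrow> 'p set" where
  "dom_chart a \<equiv> fst a"

abbreviation coords :: "('p, 'e) chart \<Rightarrow> 'p \<Rightarrow> 'e" where
  "coords a \<equiv> snd a"

definition is_chart :: "'p topology \<Rightarrow> ('p, 'e::real_normed_vector) chart \<Rightarrow> bool" where
  "is_chart X a \<longleftrightarrow>
     openin X (dom_chart a) \<and> open (coords a ` dom_chart a) \<and>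
     homeomorphic_map (subtopology X (dom_chart a)) (top_of_set (coords a ` dom_chart a)) (coords a)"

definition coord_expr :: "('p, 'e) chart \<Rightarrow> ('q, 'f) chart \<Rightarrow> ('p \<Rightarrow> 'q) \<Rightarrow> 'e \<Rightarrow> 'f" where
  "coord_expr a b f = (\<lambda>x. coords b (f (inv_into (dom_chart a) (coords a) x)))"

abbreviation transition :: "('p, 'e) chart \<Rightarrow> ('p, 'e) chart \<Rightarrow> 'e \<Rightarrow> 'e" where
  "transition a b \<equiv> coord_expr a b (\<lambda>p. p)"

definition C21_compatible ::
  "('p, 'e::real_normed_vector) chart \<Rightarrow> ('p, 'e) chart \<Rightarrow> bool" where
  "C21_compatible a b \<longleftrightarrow>
     C21_on (coords a ` (dom_chart a \<inter> dom_chart b)) (transition a b) \<and>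
     C21_on (coords b ` (dom_chart a \<inter> dom_chart b)) (transition b a)"

definition prod_chart :: "('p, 'e) chart \<Rightarrow> ('q, 'f) chart \<Rightarrow> ('p \<times> 'q, 'e \<times> 'f) chart" where
  "prod_chart a b = (dom_chart a \<times> dom_chart b, map_prod (coords a) (coords b))"

definition prod_charts ::
  "('p, 'e) chart set \<Rightarrow> ('q, 'f) chart set \<Rightarrow> ('p \<times> 'q, 'e \<times> 'f) chart set" where
  "prod_charts A B = {prod_chart a b | a b. a \<in> A \<and> b \<in> B}"

text \<open>The topology having the coordinate preimages of open sets as a basis.\<close>

definition chart_topology :: "('p, 'e::topological_space) chart set \<Rightarrow> 'p topology" where
  "chart_topology A =
     topology_generated_by {{w \<in> dom_chart a. coords a w \<in> S} | a S. a \<in> A \<and> open S}"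

text \<open>In the next two definitions \<open>W\<close> is the domain of the map \<open>f\<close>, meant to be open. That an open
  set of coordinates around the given point is sent by \<open>f\<close> into the domain of the target chart
  includes continuity of \<open>f\<close>.\<close>

definition locally_lipschitz_map ::
  "('p, 'e::real_normed_vector) chart set \<Rightarrow> ('q, 'f::real_normed_vector) chart set
     \<Rightarrow> 'p set \<Rightarrow> ('p \<Rightarrow> 'q) \<Rightarrow> bool" where
  "locally_lipschitz_map A B W f \<longleftrightarrow>
     W \<subseteq> \<Union>(dom_chart ` A) \<and> f ` W \<subseteq> \<Union>(dom_chart ` B) \<and>
     (\<forall>w\<in>W. \<forall>a\<in>A. \<forall>b\<in>B. w \<in> dom_chart a \<longrightarrow> f w \<in> dom_chart b \<longrightarrow>
        (\<exists>S C. open S \<and> coords a w \<in> S \<and>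
           S \<subseteq> coords a ` {u \<in> dom_chart a \<inter> W. f u \<in> dom_chart b} \<and>
           C-lipschitz_on S (coord_expr a b f)))"

definition strongly_differentiable_map ::
  "('p, 'e::real_normed_vector) chart set \<Rightarrow> ('q, 'f::real_normed_vector) chart set
     \<Rightarrow> 'p set \<Rightarrow> ('p \<Rightarrow> 'q) \<Rightarrow> 'p \<Rightarrow> bool" where
  "strongly_differentiable_map A B W f w \<longleftrightarrow>
     w \<in> W \<and> w \<in> \<Union>(dom_chart ` A) \<and> f w \<in> \<Union>(dom_chart ` B) \<and>
     (\<forall>a\<in>A. \<forall>b\<in>B. w \<in> dom_chart a \<longrightarrow> f w \<in> dom_chart b \<longrightarrow>
        (\<exists>S L. S \<subseteq> coords a ` {u \<in> dom_chart a \<inter> W. f u \<in> dom_chart b} \<and>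
           has_strong_derivative (coord_expr a b f) L S (coords a w)))"

definition lipeomorphism ::
  "'p topology \<Rightarrow> 'q topology \<Rightarrow> ('p, 'e::real_normed_vector) chart set
     \<Rightarrow> ('q, 'f::real_normed_vector) chart set \<Rightarrow> 'p set \<Rightarrow> 'q set \<Rightarrow> ('p \<Rightarrow> 'q) \<Rightarrow> bool" where
  "lipeomorphism X Y A B N W f \<longleftrightarrow>
     homeomorphic_map (subtopology X N) (subtopology Y W) f \<and>
     locally_lipschitz_map A B N f \<and> locally_lipschitz_map B A W (inv_into N f)"


section \<open>Manifolds and their tangent bundle\<close>

definition paracompact_space :: "'p topology \<Rightarrow> bool" where
  "paracompact_space X \<longleftrightarrow>
     Hausdorff_space X \<and>
     (\<forall>\<U>. (\<forall>U\<in>\<U>. openin X U) \<and> \<Union>\<U> = topspace X \<longrightarrow>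
        (\<exists>\<V>. (\<forall>V\<in>\<V>. openin X V \<and> (\<exists>U\<in>\<U>. V \<subseteq> U)) \<and> \<Union>\<V> = topspace X \<and>
             locally_finite_in X \<V>))"

text \<open>The last conjunct says that the atlas \<open>A\<close> is maximal, so that \<open>A\<close> is the set of all charts of
  the manifold.\<close>

definition C21_manifold :: "'p topology \<Rightarrow> ('p, real^'n) chart set \<Rightarrow> bool" where
  "C21_manifold X A \<longleftrightarrow>
     paracompact_space X \<and> connected_space X \<and>
     (\<forall>a\<in>A. is_chart X a) \<and> \<Union>(dom_chart ` A) = topspace X \<and>
     (\<forall>a\<in>A. \<forall>b\<in>A. C21_compatible a b) \<and>
     (\<forall>c. is_chart X c \<and> (\<forall>a\<in>A. C21_compatible a c) \<longrightarrow> c \<in> A)"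

text \<open>A tangent vector consists of its base point and of its components in all the charts around
  that point, which are related by the Jacobian matrices of the transition maps. The components in
  the other charts carry no information and are set to zero.\<close>

type_synonym ('p, 'n) tvec = "'p \<times> (('p, real^'n) chart \<Rightarrow> real^'n)"

abbreviation base :: "('p, 'n) tvec \<Rightarrow> 'p" where
  "base v \<equiv> fst v"

abbreviation components :: "('p, 'n) tvec \<Rightarrow> ('p, real^'n) chart \<Rightarrow> real^'n" where
  "components v \<equiv> snd v"

definition tangent_bundle :: "('p, real^'n) chart set \<Rightarrow> ('p, 'n) tvec set" where
  "tangent_bundle A =
     {v. base v \<in> \<Union>(dom_chart ` A) \<and>
         (\<forall>a. a \<notin> A \<or> base v \<notin> dom_chart a \<longrightarrow> components v a = 0) \<and>
         (\<forall>a\<in>A. \<forall>b\<in>A. base v \<in> dom_chart a \<inter> dom_chart b \<longrightarrow>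
            components v b =
              frechet_derivative (transition a b) (at (coords a (base v))) (components v a))}"

definition tangent_space :: "('p, real^'n) chart set \<Rightarrow> 'p \<Rightarrow> ('p, 'n) tvec set" where
  "tangent_space A p = {v \<in> tangent_bundle A. base v = p}"

definition zero_tvec :: "'p \<Rightarrow> ('p, 'n::finite) tvec" where
  "zero_tvec p = (p, \<lambda>a. 0)"

definition scale_tvec :: "real \<Rightarrow> ('p, 'n::finite) tvec \<Rightarrow> ('p, 'n) tvec" where
  "scale_tvec s v = (base v, \<lambda>a. s *\<^sub>R components v a)"

definition star_shaped :: "('p, 'n::finite) tvec set \<Rightarrow> bool" where
  "star_shaped N \<longleftrightarrow> (\<forall>v\<in>N. \<forall>s\<in>{0..1}. scale_tvec s v \<in> N)"

definition tangent_charts ::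
  "('p, real^'n) chart set \<Rightarrow> (('p, 'n) tvec, (real^'n) \<times> (real^'n)) chart set" where
  "tangent_charts A =
     {({v \<in> tangent_bundle A. base v \<in> dom_chart a}, \<lambda>v. (coords a (base v), components v a))
      | a. a \<in> A}"

definition fibre_charts ::
  "('p, real^'n) chart set \<Rightarrow> 'p \<Rightarrow> (('p, 'n) tvec, real^'n) chart set" where
  "fibre_charts A p =
     {(tangent_space A p, \<lambda>v. components v a) | a. a \<in> A \<and> p \<in> dom_chart a}"

abbreviation tangent_topology :: "('p, real^'n) chart set \<Rightarrow> ('p, 'n) tvec topology" where
  "tangent_topology A \<equiv> chart_topology (tangent_charts A)"

abbreviation fibre_topology :: "('p, real^'n) chart set \<Rightarrow> 'p \<Rightarrow> ('p, 'n) tvec topology" where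
  "fibre_topology A p \<equiv> chart_topology (fibre_charts A p)"


section \<open>Sprays, geodesics and the exponential map\<close>

type_synonym ('p, 'n) spray = "('p, real^'n) chart \<Rightarrow> real^'n \<Rightarrow> real^'n \<Rightarrow> real^'n"

text \<open>With \<open>\<tau>\<close> the change of chart, the first summand in the transformation law is the second
  derivative of \<open>\<tau>\<close> at \<open>x\<close> applied twice to \<open>v\<close>.\<close>

definition locally_lipschitz_spray ::
  "('p, real^'n) chart set \<Rightarrow> ('p, 'n) spray \<Rightarrow> bool" where
  "locally_lipschitz_spray A H \<longleftrightarrow>
     (\<forall>a\<in>A. locally_lipschitz_on (coords a ` dom_chart a \<times> UNIV) (\<lambda>(x, v). H a x v)) \<and>
     (\<forall>a\<in>A. \<forall>x\<in>coords a ` dom_chart a. \<forall>v. \<forall>s>0. H a x (s *\<^sub>R v) = s\<^sup>2 *\<^sub>R H a x v) \<and>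
     (\<forall>a\<in>A. \<forall>b\<in>A. \<forall>x\<in>coords a ` (dom_chart a \<inter> dom_chart b). \<forall>v.
        (let \<tau> = transition a b in
         H b (\<tau> x) (frechet_derivative \<tau> (at x) v) =
           frechet_derivative (\<lambda>y. frechet_derivative \<tau> (at y) v) (at x) v +
           frechet_derivative \<tau> (at x) (H a x v)))"

text \<open>Solutions of the first-order system are curves \<open>c\<close> in the tangent bundle. By the first
  equation of the system, \<open>c\<close> is the velocity of its base curve.\<close>

definition spray_solution ::
  "'p topology \<Rightarrow> ('p, real^'n) chart set \<Rightarrow> ('p, 'n) spray \<Rightarrow> real set
     \<Rightarrow> (real \<Rightarrow> ('p, 'n) tvec) \<Rightarrow> bool" where
  "spray_solution X A H I c \<longleftrightarrow>
     is_interval I \<and> open I \<and>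
     c ` I \<subseteq> tangent_bundle A \<and> continuous_map (top_of_set I) X (\<lambda>t. base (c t)) \<and>
     (\<forall>t\<in>I. \<forall>a\<in>A. base (c t) \<in> dom_chart a \<longrightarrow>
        ((\<lambda>s. coords a (base (c s))) has_vector_derivative components (c t) a) (at t) \<and>
        ((\<lambda>s. components (c s) a) has_vector_derivative
           H a (coords a (base (c t))) (components (c t) a)) (at t))"

definition geodesic_interval ::
  "'p topology \<Rightarrow> ('p, real^'n) chart set \<Rightarrow> ('p, 'n) spray \<Rightarrow> ('p, 'n) tvec \<Rightarrow> real set" where
  "geodesic_interval X A H v = \<Union>{I. 0 \<in> I \<and> (\<exists>c. spray_solution X A H I c \<and> c 0 = v)}"

definition geodesic ::
  "'p topology \<Rightarrow> ('p, real^'n) chart set \<Rightarrow> ('p, 'n) spray \<Rightarrow> ('p, 'n) tvec \<Rightarrow> real \<Rightarrow> 'p" where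
  "geodesic X A H v t =
     (THE q. \<exists>I c. 0 \<in> I \<and> t \<in> I \<and> spray_solution X A H I c \<and> c 0 = v \<and> q = base (c t))"

definition exp_domain ::
  "'p topology \<Rightarrow> ('p, real^'n) chart set \<Rightarrow> ('p, 'n) spray \<Rightarrow> ('p, 'n) tvec set" where
  "exp_domain X A H = {v \<in> tangent_bundle A. {0..1} \<subseteq> geodesic_interval X A H v}"

definition exp_domain_at ::
  "'p topology \<Rightarrow> ('p, real^'n) chart set \<Rightarrow> ('p, 'n) spray \<Rightarrow> 'p \<Rightarrow> ('p, 'n) tvec set" where
  "exp_domain_at X A H p = exp_domain X A H \<inter> tangent_space A p"

definition exp_at ::
  "'p topology \<Rightarrow> ('p, real^'n) chart set \<Rightarrow> ('p, 'n) spray \<Rightarrow> ('p, 'n) tvec \<Rightarrow> 'p" where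
  "exp_at X A H v = geodesic X A H v 1"

definition exp_map ::
  "'p topology \<Rightarrow> ('p, real^'n) chart set \<Rightarrow> ('p, 'n) spray \<Rightarrow> ('p, 'n) tvec \<Rightarrow> 'p \<times> 'p" where
  "exp_map X A H v = (base v, geodesic X A H v 1)"

end

theory Submission
  imports Defs
begin

text \<open>
  The geodesic equation is an ordinary differential equation on the tangent bundle whose right-hand
  side \<open>(x, v) \<mapsto> (v, H(x, v))\<close> is locally Lipschitz in the induced charts. Picard--Lindelof and Gronwall
  give, near each tangent vector, solutions that live for a common short time and depend in a
  Lipschitz way on the initial vector (\<open>local_flow\<close>). A geodesic defined on the unit interval is
  covered by finitely many such pieces: composing the corresponding locally Lipschitz maps carries
  the property ``defined up to time \<open>t\<close> near \<open>v\<close>, with locally Lipschitz time-\<open>t\<close> map'' along the whole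
  interval (\<open>flow_lipschitz_near\<close>). This gives the openness of the domain and the local Lipschitz
  continuity of the exponential map.

  Over the zero section a Lipschitz spray behaves as if it were differentiable, because of
  homogeneity. If \<open>H\<close> is \<open>K\<close>-Lipschitz near \<open>(x, 0)\<close>, then by
  \<open>H(x, s v) = s\<^sup>2 H(x, v)\<close> it is \<open>s K\<close>-Lipschitz where the velocities are smaller by the factor \<open>s\<close>.
  Hence the acceleration is a Lipschitz perturbation of zero with an arbitrarily small constant, and
  in a chart the end point of the geodesic with initial data \<open>(x, v)\<close> differs from \<open>x + v\<close> by a function
  with a small Lipschitz constant (\<open>shear_nbhd_exists\<close>). So the strong differential of the exponential
  map at a zero vector is the shear \<open>(h, k) \<mapsto> (h, h + k)\<close>, and that of the pointed exponential map is
  the identity.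

  These differentials are invertible, so near each zero vector the exponential map is expansive in
  coordinates: distances shrink at most by a constant factor. It is then injective with Lipschitz
  inverse, and by invariance of domain it is open (\<open>lipeomorphismI\<close>). Passing from single zero vectors
  to the whole zero section is a question about fibres. Since \<open>exp v\<close> remembers the base point of
  \<open>v\<close>, two vectors with the same image lie in the same fibre, so \<open>exp\<close> is injective on every set each of whose fibres is contained in
  one of the small neighborhoods. Such a set is obtained from a locally finite cover of the manifold
  by imposing at each point the finitely many conditions that belong to the members of the cover
  whose closure contains the point (\<open>exp_lipeomorphism\<close>).
\<close>

section \<open>Lipschitz continuity near a point and strong derivatives\<close>

text \<open>A pointwise form of local Lipschitz continuity, stable under changes of the function away from the
  point. It separates the analytic condition on a coordinate expression from the question of where
  that expression is meaningful.\<close>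

definition lips_at :: "('e::metric_space \<Rightarrow> 'f::metric_space) \<Rightarrow> 'e \<Rightarrow> bool" where
  "lips_at f x \<longleftrightarrow> (\<exists>S C. open S \<and> x \<in> S \<and> C-lipschitz_on S f)"

lemma lips_atI: "open S \<Longrightarrow> x \<in> S \<Longrightarrow> C-lipschitz_on S f \<Longrightarrow> lips_at f x"
  unfolding lips_at_def by blast

lemma locally_lipschitz_on_imp_lips_at:
  assumes "locally_lipschitz_on S f" "open S" "x \<in> S"
  shows "lips_at f x"
proof -
  obtain r C where "r > 0" "C-lipschitz_on (ball x r \<inter> S) f"
    using assms(1,3) unfolding locally_lipschitz_on_def by blast
  then show ?thesis
    using assms(2,3) by (intro lips_atI[of "ball x r \<inter> S"]) auto
qed

lemma lips_at_cong:
  assumes "lips_at f x" "open T" "x \<in> T" "\<And>y. y \<in> T \<Longrightarrow> f y = g y"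
  shows "lips_at g x"
proof -
  obtain S C where S: "open S" "x \<in> S" "C-lipschitz_on S f"
    using assms(1) unfolding lips_at_def by blast
  have "C-lipschitz_on (S \<inter> T) g"
    using S(3) assms(4)[symmetric] unfolding lipschitz_on_def by simp
  then show ?thesis
    using S assms by (intro lips_atI[of "S \<inter> T"]) auto
qed

lemma lips_at_isCont:
  assumes "lips_at f x"
  shows "isCont f x"
proof -
  obtain S C where S: "open S" "x \<in> S" "C-lipschitz_on S f"
    using assms unfolding lips_at_def by blast
  then show ?thesis
    using lipschitz_on_continuous_on[OF S(3)] continuous_on_eq_continuous_at by blast
qed

lemma isCont_eventually_mem:
  assumes "isCont f x" "open T" "f x \<in> T"
  shows "\<forall>\<^sub>F y in nhds x. f y \<in> T"
  using assms topological_tendstoD[of f "f x" "nhds x" T]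
  by (simp add: isCont_def tendsto_at_iff_tendsto_nhds)

lemma lips_at_compose:
  assumes "lips_at f x" "lips_at g (f x)"
  shows "lips_at (\<lambda>y. g (f y)) x"
proof -
  obtain S C where S: "open S" "x \<in> S" "C-lipschitz_on S f"
    using assms(1) unfolding lips_at_def by blast
  obtain T D where T: "open T" "f x \<in> T" "D-lipschitz_on T g"
    using assms(2) unfolding lips_at_def by blast
  have cont: "continuous_on S f"
    using S(3) lipschitz_on_continuous_on by blast
  have op: "open (S \<inter> f -` T)"
    using continuous_open_preimage[OF cont S(1) T(1)] .
  have "(D * C)-lipschitz_on (S \<inter> f -` T) (\<lambda>y. g (f y))"
  proof (rule lipschitz_on_compose2[of C _ f D g])
    show "C-lipschitz_on (S \<inter> f -` T) f"
      using S(3) by (rule lipschitz_on_subset) auto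
    show "D-lipschitz_on (f ` (S \<inter> f -` T)) g"
      using T(3) by (rule lipschitz_on_subset) auto
  qed
  with op show ?thesis
    using S(2) T(2) by (intro lips_atI[of "S \<inter> f -` T"]) auto
qed

lemma lips_at_id: "lips_at (\<lambda>x. x) x"
  by (rule lips_atI[of UNIV _ 1]) (auto intro!: lipschitz_onI)

lemma lips_at_const: "lips_at (\<lambda>x. c) x"
  by (rule lips_atI[of UNIV _ 0]) (auto intro!: lipschitz_onI)

lemma lips_at_fst: "lips_at fst x"
  by (rule lips_atI[of UNIV _ 1]) (auto intro!: lipschitz_onI simp del: split_paired_All, metis dist_fst_le fst_conv)

lemma lips_at_snd: "lips_at snd x"
  by (rule lips_atI[of UNIV _ 1]) (auto intro!: lipschitz_onI simp del: split_paired_All, metis dist_snd_le snd_conv)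

lemma lips_at_Pair:
  assumes "lips_at f x" "lips_at g x"
  shows "lips_at (\<lambda>y. (f y, g y)) x"
proof -
  obtain S C where S: "open S" "x \<in> S" "C-lipschitz_on S f"
    using assms(1) unfolding lips_at_def by blast
  obtain T D where T: "open T" "x \<in> T" "D-lipschitz_on T g"
    using assms(2) unfolding lips_at_def by blast
  have "(sqrt (C\<^sup>2 + D\<^sup>2))-lipschitz_on (S \<inter> T) (\<lambda>y. (f y, g y))"
    by (intro lipschitz_on_Pair lipschitz_on_subset[OF S(3)] lipschitz_on_subset[OF T(3)]) auto
  then show ?thesis
    using S T by (intro lips_atI[of "S \<inter> T"]) auto
qed

lemma lips_at_bounded_linear:
  assumes "bounded_linear L"
  shows "lips_at L x"
proof -
  have "(onorm L)-lipschitz_on UNIV L"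
  proof (rule lipschitz_onI)
    show "dist (L y) (L z) \<le> onorm L * dist y z" for y z
      using onorm[OF assms, of "y - z"] by (simp add: dist_norm linear_diff[OF bounded_linear.linear[OF assms]])
  qed (rule onorm_pos_le[OF assms])
  then show ?thesis by (intro lips_atI[of UNIV]) auto
qed

lemma lips_at_bounded_near:
  assumes "lips_at f x"
  obtains S C where "open S" "x \<in> S" "C-lipschitz_on S f" "\<And>y. y \<in> S \<Longrightarrow> norm (f y) \<le> norm (f x) + 1"
proof -
  obtain S C where S: "open S" "x \<in> S" "C-lipschitz_on S f"
    using assms unfolding lips_at_def by blast
  let ?T = "S \<inter> f -` ball (f x) 1"
  have "open ?T"
    using continuous_open_preimage[of S f] S lipschitz_on_continuous_on by blast
  moreover have "norm (f y) \<le> norm (f x) + 1" if "y \<in> ?T" for y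
    using that norm_triangle_ineq2[of "f y" "f x"] by (auto simp: dist_norm norm_minus_commute)
  ultimately show thesis
    using S(2) lipschitz_on_subset[OF S(3), of ?T] by (intro that[of ?T C]) auto
qed

text \<open>This is what makes the transition maps \<open>(x, v) \<mapsto> (\<tau> x, D\<tau>(x) v)\<close> of the tangent bundle locally
  Lipschitz. The product of Lipschitz functions is Lipschitz where both are bounded.\<close>

lemma lips_at_blinfun_apply:
  fixes f :: "'a::metric_space \<Rightarrow> 'b::real_normed_vector \<Rightarrow>\<^sub>L 'c::real_normed_vector"
  assumes "lips_at f x" "lips_at g x"
  shows "lips_at (\<lambda>y. blinfun_apply (f y) (g y)) x"
proof -
  obtain S C where S: "open S" "x \<in> S" "C-lipschitz_on S f"
      "\<And>y. y \<in> S \<Longrightarrow> norm (f y) \<le> norm (f x) + 1"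
    using lips_at_bounded_near[OF assms(1)] by metis
  obtain T D where T: "open T" "x \<in> T" "D-lipschitz_on T g"
      "\<And>y. y \<in> T \<Longrightarrow> norm (g y) \<le> norm (g x) + 1"
    using lips_at_bounded_near[OF assms(2)] by metis
  have C0: "C \<ge> 0" and D0: "D \<ge> 0"
    using S(3) T(3) lipschitz_on_nonneg by blast+
  let ?K = "C * (norm (g x) + 1) + (norm (f x) + 1) * D"
  have "?K-lipschitz_on (S \<inter> T) (\<lambda>y. blinfun_apply (f y) (g y))"
  proof (rule lipschitz_onI)
    fix y z assume y: "y \<in> S \<inter> T" and z: "z \<in> S \<inter> T"
    have "blinfun_apply (f y) (g y) - blinfun_apply (f z) (g z)
        = blinfun_apply (f y - f z) (g y) + blinfun_apply (f z) (g y - g z)"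
      by (simp add: blinfun.diff_left blinfun.diff_right)
    then have "dist (blinfun_apply (f y) (g y)) (blinfun_apply (f z) (g z))
        \<le> norm (f y - f z) * norm (g y) + norm (f z) * norm (g y - g z)"
      unfolding dist_norm by (metis add_mono norm_blinfun norm_triangle_le)
    also have "\<dots> \<le> (C * dist y z) * (norm (g x) + 1) + (norm (f x) + 1) * (D * dist y z)"
      using S(4)[of z] T(4)[of y] y z lipschitz_onD[OF S(3), of y z] lipschitz_onD[OF T(3), of y z] C0 D0
      by (intro add_mono mult_mono) (auto simp: dist_norm)
    also have "\<dots> = ?K * dist y z" by (simp add: algebra_simps)
    finally show "dist (blinfun_apply (f y) (g y)) (blinfun_apply (f z) (g z)) \<le> ?K * dist y z" .
  qed (use C0 D0 in auto)
  then show ?thesis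
    using S T by (intro lips_atI[of "S \<inter> T"]) auto
qed

text \<open>Strong differentiability without reference to a domain: near \<open>x\<close> the function \<open>f - L\<close> is Lipschitz
  with arbitrarily small constant.\<close>

definition strong_at ::
  "('e::real_normed_vector \<Rightarrow> 'f::real_normed_vector) \<Rightarrow> ('e \<Rightarrow> 'f) \<Rightarrow> 'e \<Rightarrow> bool" where
  "strong_at f L x \<longleftrightarrow> bounded_linear L \<and>
     (\<forall>\<epsilon>>0. \<exists>\<delta>>0. \<forall>y\<in>ball x \<delta>. \<forall>z\<in>ball x \<delta>. norm (f y - f z - L (y - z)) \<le> \<epsilon> * norm (y - z))"

lemma strong_at_imp_has_strong_derivative:
  assumes "strong_at f L x" "x \<in> interior T"
  shows "\<exists>S L. S \<subseteq> T \<and> has_strong_derivative f L S x"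
proof (intro exI conjI)
  show "interior T \<subseteq> T" by (rule interior_subset)
  show "has_strong_derivative f L (interior T) x"
    unfolding has_strong_derivative_def
  proof (intro conjI allI impI)
    fix \<epsilon> :: real assume "\<epsilon> > 0"
    then obtain \<delta> where \<delta>: "\<delta> > 0"
      "\<forall>y\<in>ball x \<delta>. \<forall>z\<in>ball x \<delta>. norm (f y - f z - L (y - z)) \<le> \<epsilon> * norm (y - z)"
      using assms(1) unfolding strong_at_def by blast
    have "y \<in> ball x \<delta>" if "norm (y - x) \<le> \<delta> / 2" for y
      using that \<delta>(1) by (simp add: dist_norm norm_minus_commute)
    then show "\<exists>\<delta>>0. \<forall>y\<in>interior T. \<forall>z\<in>interior T. norm (y - x) \<le> \<delta> \<longrightarrow> norm (z - x) \<le> \<delta> \<longrightarrow>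
        norm (f y - f z - L (y - z)) \<le> \<epsilon> * norm (y - z)"
      using \<delta> by (intro exI[of _ "\<delta> / 2"]) simp
  qed (use assms in \<open>auto simp: strong_at_def\<close>)
qed

lemma strong_at_cong:
  assumes "strong_at f L x" "open T" "x \<in> T" "\<And>y. y \<in> T \<Longrightarrow> f y = g y"
  shows "strong_at g L x"
  unfolding strong_at_def
proof (intro conjI allI impI)
  fix \<epsilon> :: real assume "\<epsilon> > 0"
  then obtain \<delta> where \<delta>: "\<delta> > 0"
    "\<forall>y\<in>ball x \<delta>. \<forall>z\<in>ball x \<delta>. norm (f y - f z - L (y - z)) \<le> \<epsilon> * norm (y - z)"
    using assms(1) unfolding strong_at_def by blast
  obtain r where r: "r > 0" "ball x r \<subseteq> T"
    using assms(2,3) open_contains_ball by blast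
  show "\<exists>\<delta>>0. \<forall>y\<in>ball x \<delta>. \<forall>z\<in>ball x \<delta>. norm (g y - g z - L (y - z)) \<le> \<epsilon> * norm (y - z)"
  proof (intro exI[of _ "min \<delta> r"] conjI ballI)
    fix y z assume yz: "y \<in> ball x (min \<delta> r)" "z \<in> ball x (min \<delta> r)"
    then have "y \<in> T" "z \<in> T" using r(2) by auto
    then show "norm (g y - g z - L (y - z)) \<le> \<epsilon> * norm (y - z)"
      using \<delta>(2) yz assms(4)[symmetric] by simp
  qed (use \<delta> r in simp)
qed (use assms in \<open>auto simp: strong_at_def\<close>)

lemma strong_at_lips_at:
  assumes "strong_at f L x"
  shows "lips_at f x"
proof -
  have L: "bounded_linear L" using assms unfolding strong_at_def by blast
  obtain \<delta> where \<delta>: "\<delta> > 0"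
    "\<forall>y\<in>ball x \<delta>. \<forall>z\<in>ball x \<delta>. norm (f y - f z - L (y - z)) \<le> 1 * norm (y - z)"
    using assms zero_less_one unfolding strong_at_def by blast
  have "(onorm L + 1)-lipschitz_on (ball x \<delta>) f"
  proof (rule lipschitz_onI)
    fix y z assume "y \<in> ball x \<delta>" "z \<in> ball x \<delta>"
    then have "norm (f y - f z - L (y - z)) \<le> 1 * norm (y - z)" using \<delta>(2) by blast
    moreover have "norm (L (y - z)) \<le> onorm L * norm (y - z)" using L by (rule onorm)
    ultimately show "dist (f y) (f z) \<le> (onorm L + 1) * dist y z"
      using norm_triangle_ineq2[of "f y - f z" "L (y - z)"] by (simp add: dist_norm algebra_simps)
  qed (use onorm_pos_le[OF L] in auto)
  then show ?thesis using \<delta>(1) by (intro lips_atI[of "ball x \<delta>"]) auto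
qed

lemma strong_at_compose:
  assumes f: "strong_at f L x" and g: "strong_at g M (f x)"
  shows "strong_at (\<lambda>y. g (f y)) (\<lambda>h. M (L h)) x"
  unfolding strong_at_def
proof (intro conjI allI impI)
  have L: "bounded_linear L" and M: "bounded_linear M"
    using f g unfolding strong_at_def by blast+
  show "bounded_linear (\<lambda>h. M (L h))"
    using bounded_linear_compose[OF M L] .
  obtain S C where S: "open S" "x \<in> S" "C-lipschitz_on S f"
    using strong_at_lips_at[OF f] unfolding lips_at_def by blast
  have C0: "C \<ge> 0" using S(3) lipschitz_on_nonneg by blast
  define B where "B = onorm M"
  have B0: "B \<ge> 0" unfolding B_def using onorm_pos_le[OF M] .
  fix \<epsilon> :: real assume e: "\<epsilon> > 0"
  define \<epsilon>1 where "\<epsilon>1 = \<epsilon> / (C + B + 1)"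
  have e1: "\<epsilon>1 > 0" unfolding \<epsilon>1_def using e C0 B0 by simp
  obtain \<delta>1 where \<delta>1: "\<delta>1 > 0"
    "\<forall>y\<in>ball x \<delta>1. \<forall>z\<in>ball x \<delta>1. norm (f y - f z - L (y - z)) \<le> \<epsilon>1 * norm (y - z)"
    using f e1 unfolding strong_at_def by blast
  obtain \<delta>2 where \<delta>2: "\<delta>2 > 0"
    "\<forall>y\<in>ball (f x) \<delta>2. \<forall>z\<in>ball (f x) \<delta>2. norm (g y - g z - M (y - z)) \<le> \<epsilon>1 * norm (y - z)"
    using g e1 unfolding strong_at_def by blast
  have "\<forall>\<^sub>F y in nhds x. f y \<in> ball (f x) \<delta>2"
    using isCont_eventually_mem[OF lips_at_isCont[OF strong_at_lips_at[OF f]], of "ball (f x) \<delta>2"] \<delta>2(1)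
    by simp
  then obtain r where r: "r > 0" "\<forall>y. dist y x < r \<longrightarrow> f y \<in> ball (f x) \<delta>2"
    unfolding eventually_nhds_metric by blast
  obtain r' where r': "r' > 0" "ball x r' \<subseteq> S"
    using S open_contains_ball by blast
  define \<delta> where "\<delta> = min \<delta>1 (min r r')"
  show "\<exists>\<delta>>0. \<forall>y\<in>ball x \<delta>. \<forall>z\<in>ball x \<delta>.
     norm (g (f y) - g (f z) - M (L (y - z))) \<le> \<epsilon> * norm (y - z)"
  proof (intro exI conjI ballI)
    show "\<delta> > 0" unfolding \<delta>_def using \<delta>1(1) r(1) r'(1) by simp
    fix y z assume y: "y \<in> ball x \<delta>" and z: "z \<in> ball x \<delta>"
    have in2: "f y \<in> ball (f x) \<delta>2" "f z \<in> ball (f x) \<delta>2"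
      using y z r(2) unfolding \<delta>_def by (auto simp: dist_commute)
    have inS: "y \<in> S" "z \<in> S" using y z r'(2) unfolding \<delta>_def by auto
    have 1: "norm (g (f y) - g (f z) - M (f y - f z)) \<le> \<epsilon>1 * norm (f y - f z)"
      using \<delta>2(2) in2 by blast
    have 2: "norm (f y - f z) \<le> C * norm (y - z)"
      using lipschitz_onD[OF S(3) inS] by (simp add: dist_norm)
    have 3: "norm (f y - f z - L (y - z)) \<le> \<epsilon>1 * norm (y - z)"
      using \<delta>1(2) y z unfolding \<delta>_def by auto
    have 4: "norm (M (f y - f z - L (y - z))) \<le> B * norm (f y - f z - L (y - z))"
      unfolding B_def using onorm[OF M] .
    have eq: "g (f y) - g (f z) - M (L (y - z))
        = (g (f y) - g (f z) - M (f y - f z)) + M (f y - f z - L (y - z))"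
      by (simp add: linear_diff[OF bounded_linear.linear[OF M]])
    have "norm (g (f y) - g (f z) - M (L (y - z)))
        \<le> norm (g (f y) - g (f z) - M (f y - f z)) + norm (M (f y - f z - L (y - z)))"
      unfolding eq by (rule norm_triangle_ineq)
    also have "\<dots> \<le> \<epsilon>1 * (C * norm (y - z)) + B * (\<epsilon>1 * norm (y - z))"
      using 1 2 3 4 e1 B0 by (smt (verit) mult_left_mono)
    also have "\<dots> = \<epsilon>1 * (C + B) * norm (y - z)" by (simp add: algebra_simps)
    also have "\<dots> \<le> \<epsilon> * norm (y - z)"
    proof (rule mult_right_mono)
      have "\<epsilon>1 * (C + B) \<le> \<epsilon>1 * (C + B + 1)" using e1 by simp
      also have "\<dots> = \<epsilon>" unfolding \<epsilon>1_def using C0 B0 by simp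
      finally show "\<epsilon>1 * (C + B) \<le> \<epsilon>" .
    qed simp
    finally show "norm (g (f y) - g (f z) - M (L (y - z))) \<le> \<epsilon> * norm (y - z)" .
  qed
qed

lemma strong_at_bounded_linear:
  assumes "bounded_linear L"
  shows "strong_at L L x"
  using assms linear_diff[OF bounded_linear.linear[OF assms]]
  by (simp add: strong_at_def)

lemma strong_at_const: "strong_at (\<lambda>x. c) (\<lambda>h. 0) x"
  unfolding strong_at_def by (auto intro!: exI[of _ 1])

lemma strong_at_Pair:
  assumes f: "strong_at f L x" and g: "strong_at g M x"
  shows "strong_at (\<lambda>y. (f y, g y)) (\<lambda>h. (L h, M h)) x"
  unfolding strong_at_def
proof (intro conjI allI impI)
  show "bounded_linear (\<lambda>h. (L h, M h))"
    using f g unfolding strong_at_def by (simp add: bounded_linear_Pair)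
  fix \<epsilon> :: real assume "\<epsilon> > 0"
  then have e: "\<epsilon> / 2 > 0" by simp
  obtain \<delta>1 where \<delta>1: "\<delta>1 > 0"
    "\<forall>y\<in>ball x \<delta>1. \<forall>z\<in>ball x \<delta>1. norm (f y - f z - L (y - z)) \<le> \<epsilon> / 2 * norm (y - z)"
    using f e unfolding strong_at_def by blast
  obtain \<delta>2 where \<delta>2: "\<delta>2 > 0"
    "\<forall>y\<in>ball x \<delta>2. \<forall>z\<in>ball x \<delta>2. norm (g y - g z - M (y - z)) \<le> \<epsilon> / 2 * norm (y - z)"
    using g e unfolding strong_at_def by blast
  show "\<exists>\<delta>>0. \<forall>y\<in>ball x \<delta>. \<forall>z\<in>ball x \<delta>.
     norm ((f y, g y) - (f z, g z) - (L (y - z), M (y - z))) \<le> \<epsilon> * norm (y - z)"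
  proof (intro exI[of _ "min \<delta>1 \<delta>2"] conjI ballI)
    fix y z assume "y \<in> ball x (min \<delta>1 \<delta>2)" "z \<in> ball x (min \<delta>1 \<delta>2)"
    then have "norm (f y - f z - L (y - z)) \<le> \<epsilon> / 2 * norm (y - z)"
        "norm (g y - g z - M (y - z)) \<le> \<epsilon> / 2 * norm (y - z)"
      using \<delta>1(2) \<delta>2(2) by auto
    then show "norm ((f y, g y) - (f z, g z) - (L (y - z), M (y - z))) \<le> \<epsilon> * norm (y - z)"
      using norm_Pair_le[of "f y - f z - L (y - z)" "g y - g z - M (y - z)"] by simp
  qed (use \<delta>1 \<delta>2 in simp)
qed

text \<open>The injective half of the inverse function theorem for strongly differentiable functions: a
  perturbation with Lipschitz constant \<open>m / 2\<close> cannot destroy the lower bound \<open>m\<close>.\<close>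

lemma strong_at_expansive:
  assumes f: "strong_at f L x" and m: "m > 0" "\<And>h. m * norm h \<le> norm (L h)"
  obtains r where "r > 0"
    "\<And>y z. y \<in> ball x r \<Longrightarrow> z \<in> ball x r \<Longrightarrow> dist y z \<le> 2 / m * dist (f y) (f z)"
proof -
  obtain r where r: "r > 0"
    "\<forall>y\<in>ball x r. \<forall>z\<in>ball x r. norm (f y - f z - L (y - z)) \<le> m / 2 * norm (y - z)"
    using f m(1) half_gt_zero unfolding strong_at_def by blast
  have "dist y z \<le> 2 / m * dist (f y) (f z)" if "y \<in> ball x r" "z \<in> ball x r" for y z
  proof -
    have "norm (f y - f z - L (y - z)) \<le> m / 2 * norm (y - z)" using r(2) that by blast
    moreover have "norm (L (y - z)) \<le> norm (f y - f z) + norm (f y - f z - L (y - z))"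
      by (metis add.commute diff_add_cancel norm_minus_commute norm_triangle_sub)
    ultimately have "m / 2 * norm (y - z) \<le> norm (f y - f z)"
      using m(2)[of "y - z"] by (simp add: algebra_simps)
    then show ?thesis using m(1) by (simp add: dist_norm field_simps)
  qed
  with r(1) that show thesis by blast
qed

text \<open>The mean value inequality applied to \<open>g - g' x\<close>, whose derivative is small near \<open>x\<close> by continuity
  of \<open>g'\<close>.\<close>

lemma C1_imp_strong_at:
  fixes g' :: "'e::real_normed_vector \<Rightarrow> 'e \<Rightarrow>\<^sub>L 'f::real_normed_vector"
  assumes S: "open S" "x \<in> S"
    and der: "\<And>y. y \<in> S \<Longrightarrow> (g has_derivative blinfun_apply (g' y)) (at y)"
    and cont: "isCont g' x"
  shows "strong_at g (blinfun_apply (g' x)) x"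
  unfolding strong_at_def
proof (intro conjI allI impI)
  show "bounded_linear (blinfun_apply (g' x))" by (rule blinfun.bounded_linear_right)
  fix \<epsilon> :: real assume e: "\<epsilon> > 0"
  have "\<forall>\<^sub>F y in nhds x. g' y \<in> ball (g' x) \<epsilon>"
    using isCont_eventually_mem[OF cont, of "ball (g' x) \<epsilon>"] e by simp
  then obtain r where r: "r > 0" "\<forall>y. dist y x < r \<longrightarrow> g' y \<in> ball (g' x) \<epsilon>"
    unfolding eventually_nhds_metric by blast
  obtain r' where r': "r' > 0" "ball x r' \<subseteq> S"
    using S open_contains_ball by blast
  define \<delta> where "\<delta> = min r r'"
  show "\<exists>\<delta>>0. \<forall>y\<in>ball x \<delta>. \<forall>z\<in>ball x \<delta>.
     norm (g y - g z - blinfun_apply (g' x) (y - z)) \<le> \<epsilon> * norm (y - z)"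
  proof (intro exI conjI ballI)
    show "\<delta> > 0" unfolding \<delta>_def using r(1) r'(1) by simp
    fix y z assume yz: "y \<in> ball x \<delta>" "z \<in> ball x \<delta>"
    have "norm (g y - g z - blinfun_apply (g' x) (y - z)) \<le> norm (y - z) * \<epsilon>"
    proof (rule differentiable_bound_linearization[where S = "ball x \<delta>"])
      show "z + t *\<^sub>R (y - z) \<in> ball x \<delta>" if "t \<in> {0..1}" for t
      proof -
        have "(1 - t) *\<^sub>R z + t *\<^sub>R y \<in> ball x \<delta>"
          using convexD_alt[OF convex_ball yz(2,1), of t] that by (simp del: mem_ball)
        moreover have "(1 - t) *\<^sub>R z + t *\<^sub>R y = z + t *\<^sub>R (y - z)"
          by (simp add: algebra_simps)
        ultimately show ?thesis by simp
      qed
      show "(g has_derivative blinfun_apply (g' w)) (at w within ball x \<delta>)" if "w \<in> ball x \<delta>" for w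
      proof -
        have "w \<in> S" using that r'(2) unfolding \<delta>_def by auto
        then show ?thesis by (rule has_derivative_at_withinI[OF der])
      qed
      show "onorm (blinfun_apply (g' w) - blinfun_apply (g' x)) \<le> \<epsilon>" if "w \<in> ball x \<delta>" for w
      proof -
        have "g' w \<in> ball (g' x) \<epsilon>"
          using that r(2) unfolding \<delta>_def by (auto simp: dist_commute)
        then have "norm (g' w - g' x) \<le> \<epsilon>" by (simp add: dist_norm norm_minus_commute)
        then show ?thesis by (simp add: norm_blinfun.rep_eq minus_blinfun.rep_eq fun_diff_def)
      qed
    qed (use \<open>\<delta> > 0\<close> in simp)
    then show "norm (g y - g z - blinfun_apply (g' x) (y - z)) \<le> \<epsilon> * norm (y - z)"
      by (simp add: mult.commute)
  qed
qed

text \<open>Both \<open>f\<close> and its first derivative are of class \<open>C\<^sup>1\<close>, hence locally Lipschitz; for the first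
  derivative this uses that the second one is continuous, being locally Lipschitz.\<close>

lemma C21_onD:
  fixes f :: "'e::real_normed_vector \<Rightarrow> 'f::real_normed_vector"
  assumes C: "C21_on S f" and S: "open S"
  obtains f' :: "'e \<Rightarrow> 'e \<Rightarrow>\<^sub>L 'f" and f'' :: "'e \<Rightarrow> 'e \<Rightarrow>\<^sub>L ('e \<Rightarrow>\<^sub>L 'f)" where
    "\<And>x. x \<in> S \<Longrightarrow> (f has_derivative blinfun_apply (f' x)) (at x)"
    "\<And>x. x \<in> S \<Longrightarrow> frechet_derivative f (at x) = blinfun_apply (f' x)"
    "\<And>x. x \<in> S \<Longrightarrow> (f' has_derivative blinfun_apply (f'' x)) (at x)"
    "\<And>x. x \<in> S \<Longrightarrow> lips_at f' x"
    "\<And>x. x \<in> S \<Longrightarrow> strong_at f (blinfun_apply (f' x)) x"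
proof -
  obtain f' :: "'e \<Rightarrow> 'e \<Rightarrow>\<^sub>L 'f" and f'' :: "'e \<Rightarrow> 'e \<Rightarrow>\<^sub>L ('e \<Rightarrow>\<^sub>L 'f)" where
    f: "\<forall>x\<in>S. (f has_derivative blinfun_apply (f' x)) (at x)"
       "\<forall>x\<in>S. (f' has_derivative blinfun_apply (f'' x)) (at x)"
       "locally_lipschitz_on S f''"
    using C unfolding C21_on_def by blast
  show thesis
  proof (rule that[of f' f''])
    fix x assume x: "x \<in> S"
    show "frechet_derivative f (at x) = blinfun_apply (f' x)"
      using f(1) x frechet_derivative_at by metis
    have "isCont f'' x"
      using locally_lipschitz_on_imp_lips_at[OF f(3) S x] lips_at_isCont by blast
    then show "lips_at f' x"
      using C1_imp_strong_at[OF S x, of f' f''] f(2) strong_at_lips_at by blast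
    then show "strong_at f (blinfun_apply (f' x)) x"
      using C1_imp_strong_at[OF S x, of f f'] f(1) lips_at_isCont by blast
  qed (use f in auto)
qed

section \<open>Ordinary differential equations with Lipschitz right-hand side\<close>

lemma vector_mean_value_bound:
  fixes f :: "real \<Rightarrow> 'b::real_normed_vector"
  assumes "is_interval I" "s \<in> I" "t \<in> I"
    and der: "\<And>u. u \<in> I \<Longrightarrow> (f has_vector_derivative f' u) (at u within I)"
    and B: "\<And>u. u \<in> I \<Longrightarrow> norm (f' u) \<le> B"
  shows "norm (f t - f s) \<le> B * \<bar>t - s\<bar>"
proof -
  have "norm (f t - f s) \<le> B * norm (t - s)"
  proof (rule differentiable_bound)
    show "convex I" using assms(1) by (simp add: is_interval_convex_1)
    show "(f has_derivative (\<lambda>h. h *\<^sub>R f' u)) (at u within I)" if "u \<in> I" for u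
      using der[OF that] by (simp add: has_vector_derivative_def)
    show "onorm (\<lambda>h. h *\<^sub>R f' u) \<le> B" if "u \<in> I" for u
    proof (rule onorm_le)
      show "norm (x *\<^sub>R f' u) \<le> B * norm x" for x
        using mult_left_mono[OF B[OF that], of "norm x"] by (simp add: mult.commute)
    qed
  qed (use assms in auto)
  then show ?thesis by simp
qed

text \<open>In an inner product space the squared distance of the two curves is differentiable, and by
  Cauchy--Schwarz its derivative is at most \<open>2 K\<close> times itself. So it becomes nonincreasing after
  multiplication by \<open>exp (- 2 K u)\<close>.\<close>

lemma gronwall_forward:
  fixes z1 z2 :: "real \<Rightarrow> 'e::real_inner"
  assumes "s \<le> t"
    and d1: "\<And>u. u \<in> {s..t} \<Longrightarrow> (z1 has_vector_derivative z1' u) (at u)"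
    and d2: "\<And>u. u \<in> {s..t} \<Longrightarrow> (z2 has_vector_derivative z2' u) (at u)"
    and K: "\<And>u. u \<in> {s..t} \<Longrightarrow> norm (z1' u - z2' u) \<le> K * norm (z1 u - z2 u)"
  shows "norm (z1 t - z2 t) \<le> exp (K * (t - s)) * norm (z1 s - z2 s)"
proof -
  define w where "w u = z1 u - z2 u" for u
  define w' where "w' u = z1' u - z2' u" for u
  define \<phi> where "\<phi> u = (w u \<bullet> w u) * exp (- 2 * K * u)" for u
  have dw: "(w has_vector_derivative w' u) (at u)" if "u \<in> {s..t}" for u
    unfolding w_def w'_def using d1[OF that] d2[OF that] by (rule has_vector_derivative_diff)
  have "\<phi> t \<le> \<phi> s"
  proof (rule DERIV_nonpos_imp_nonincreasing[OF \<open>s \<le> t\<close>])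
    fix u assume "s \<le> u" "u \<le> t"
    then have u: "u \<in> {s..t}" by simp
    have "((\<lambda>u. w u \<bullet> w u) has_real_derivative 2 * (w u \<bullet> w' u)) (at u)"
      using has_derivative_inner[OF dw[OF u, unfolded has_vector_derivative_def]
          dw[OF u, unfolded has_vector_derivative_def]]
      unfolding has_field_derivative_def
      by (rule has_derivative_eq_rhs) (simp add: fun_eq_iff inner_commute)
    then have "(\<phi> has_real_derivative
        2 * (w u \<bullet> w' u) * exp (- 2 * K * u) + (w u \<bullet> w u) * (exp (- 2 * K * u) * (- 2 * K))) (at u)"
      unfolding \<phi>_def by (auto intro!: derivative_eq_intros)
    moreover have "w u \<bullet> w' u \<le> K * (w u \<bullet> w u)"
    proof -
      have "w u \<bullet> w' u \<le> norm (w u) * norm (w' u)" by (rule norm_cauchy_schwarz)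
      also have "\<dots> \<le> norm (w u) * (K * norm (w u))"
        using K[OF u] by (intro mult_left_mono) (auto simp: w_def w'_def)
      also have "\<dots> = K * (w u \<bullet> w u)" by (simp add: dot_square_norm power2_eq_square)
      finally show ?thesis .
    qed
    then have "2 * (w u \<bullet> w' u) * exp (- 2 * K * u) + (w u \<bullet> w u) * (exp (- 2 * K * u) * (- 2 * K)) \<le> 0"
    proof -
      have "(2 * (w u \<bullet> w' u) - 2 * (K * (w u \<bullet> w u))) * exp (- 2 * K * u) \<le> 0"
        using \<open>w u \<bullet> w' u \<le> K * (w u \<bullet> w u)\<close> by (intro mult_nonpos_nonneg) auto
      then show ?thesis by (simp add: algebra_simps)
    qed
    ultimately show "\<exists>y. DERIV \<phi> u :> y \<and> y \<le> 0" by blast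
  qed
  then have "(norm (w t))\<^sup>2 * exp (- 2 * K * t) \<le> (norm (w s))\<^sup>2 * exp (- 2 * K * s)"
    unfolding \<phi>_def by (simp add: dot_square_norm)
  then have "(norm (w t))\<^sup>2 * exp (- 2 * K * t) * exp (2 * K * t) \<le> (norm (w s))\<^sup>2 * exp (- 2 * K * s) * exp (2 * K * t)"
    by (rule mult_right_mono) simp
  moreover have "exp (- 2 * K * t) * exp (2 * K * t) = 1"
    unfolding exp_add[symmetric] by simp
  moreover have "exp (- 2 * K * s) * exp (2 * K * t) = exp (2 * (K * (t - s)))"
    unfolding exp_add[symmetric] by (rule arg_cong[of _ _ exp]) (simp add: algebra_simps)
  ultimately have "(norm (w t))\<^sup>2 \<le> (norm (w s))\<^sup>2 * exp (2 * (K * (t - s)))"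
    by (simp only: mult.assoc mult_1_right)
  also have "\<dots> = (exp (K * (t - s)) * norm (w s))\<^sup>2"
    by (simp add: power_mult_distrib exp_double)
  finally show ?thesis
    unfolding w_def by (rule power2_le_imp_le) simp
qed

text \<open>Two-sided in time, so that it also compares solutions at times before the reference time \<open>s\<close>.\<close>

lemma gronwall:
  fixes z1 z2 :: "real \<Rightarrow> 'e::real_inner"
  assumes I: "is_interval I" "s \<in> I" "t \<in> I"
    and d1: "\<And>u. u \<in> I \<Longrightarrow> (z1 has_vector_derivative z1' u) (at u)"
    and d2: "\<And>u. u \<in> I \<Longrightarrow> (z2 has_vector_derivative z2' u) (at u)"
    and K: "\<And>u. u \<in> I \<Longrightarrow> norm (z1' u - z2' u) \<le> K * norm (z1 u - z2 u)"
  shows "norm (z1 t - z2 t) \<le> exp (K * \<bar>t - s\<bar>) * norm (z1 s - z2 s)"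
proof (cases "s \<le> t")
  case True
  have sub: "u \<in> I" if "u \<in> {s..t}" for u
  proof -
    have "s \<le> u" "u \<le> t" using that by auto
    then show ?thesis using I unfolding is_interval_1 by blast
  qed
  have "norm (z1 t - z2 t) \<le> exp (K * (t - s)) * norm (z1 s - z2 s)"
    by (rule gronwall_forward[OF True d1[OF sub] d2[OF sub] K[OF sub]])
  then show ?thesis using True by simp
next
  case False
  have sub: "- u \<in> I" if "u \<in> {-s..-t}" for u
  proof -
    have "t \<le> - u" "- u \<le> s" using that by auto
    then show ?thesis using I unfolding is_interval_1 by blast
  qed
  have rev: "((\<lambda>u. z (- u)) has_vector_derivative - z' (- u)) (at u)"
    if "(z has_vector_derivative z' (- u)) (at (- u))" for z z' :: "real \<Rightarrow> 'e" and u
  proof -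
    have "(uminus has_vector_derivative (-1)) (at u)"
      using has_vector_derivative_minus[OF has_vector_derivative_id, of "at u"] by simp
    from vector_diff_chain_at[OF this that] show ?thesis by (simp add: o_def)
  qed
  have "norm (z1 (- (-t)) - z2 (- (-t))) \<le> exp (K * (- t - - s)) * norm (z1 (- (-s)) - z2 (- (-s)))"
  proof (rule gronwall_forward)
    show "((\<lambda>u. z1 (- u)) has_vector_derivative - z1' (- u)) (at u)" if "u \<in> {-s..-t}" for u
      using d1[OF sub[OF that]] by (rule rev)
    show "((\<lambda>u. z2 (- u)) has_vector_derivative - z2' (- u)) (at u)" if "u \<in> {-s..-t}" for u
      using d2[OF sub[OF that]] by (rule rev)
    show "norm (- z1' (- u) - - z2' (- u)) \<le> K * norm (z1 (- u) - z2 (- u))" if "u \<in> {-s..-t}" for u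
      using K[OF sub[OF that]] by (simp add: norm_minus_commute)
  qed (use False in auto)
  then show ?thesis using False by simp
qed

text \<open>The integral operator of the initial value problem is a contraction of the space of bounded
  continuous functions once \<open>K \<delta> \<le> 1 / 2\<close>.\<close>

lemma solution_globally_lipschitz:
  fixes G :: "'e::euclidean_space \<Rightarrow> 'e"
  assumes G: "K-lipschitz_on UNIV G" and \<delta>: "\<delta> > 0" "K * \<delta> \<le> 1 / 2"
  obtains \<phi> where "\<phi> 0 = z" "\<And>t. t \<in> {-\<delta>..\<delta>} \<Longrightarrow> (\<phi> has_vector_derivative G (\<phi> t)) (at t within {-\<delta>..\<delta>})"
proof -
  \<comment> \<open>Freezing a function outside the interval turns it into a bounded continuous function on the whole line.\<close>
  define clamp where "clamp t = max (-\<delta>) (min \<delta> t)" for t :: real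
  have clamp: "clamp t \<in> {-\<delta>..\<delta>}" "t \<in> {-\<delta>..\<delta>} \<Longrightarrow> clamp t = t" for t
    using \<delta>(1) unfolding clamp_def by auto
  have contG: "continuous_on T (\<lambda>t. G (apply_bcontfun \<phi> t))" for T and \<phi> :: "real \<Rightarrow>\<^sub>C 'e"
    using continuous_on_compose2[OF lipschitz_on_continuous_on[OF G] continuous_on_apply_bcontfun[of T \<phi>]]
    by simp
  \<comment> \<open>The difference of two integrals from the left end point is the oriented integral from 0 to t, also for negative t.\<close>
  define P where "P \<phi> t = z + integral {-\<delta>..t} (\<lambda>s. G (apply_bcontfun \<phi> s))
      - integral {-\<delta>..0} (\<lambda>s. G (apply_bcontfun \<phi> s))" for \<phi> :: "real \<Rightarrow>\<^sub>C 'e" and t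
  have P0: "P \<phi> 0 = z" for \<phi> unfolding P_def by simp
  have dP: "(P \<phi> has_vector_derivative G (apply_bcontfun \<phi> t)) (at t within {-\<delta>..\<delta>})"
    if "t \<in> {-\<delta>..\<delta>}" for \<phi> t
    using integral_has_vector_derivative[OF contG that, of \<phi>] unfolding P_def
    by (auto intro!: derivative_eq_intros)
  have contP: "continuous_on {-\<delta>..\<delta>} (P \<phi>)" for \<phi>
    using dP has_vector_derivative_continuous unfolding continuous_on_eq_continuous_within by blast
  define T where "T \<phi> = Bcontfun (\<lambda>t. P \<phi> (clamp t))" for \<phi>
  have T: "apply_bcontfun (T \<phi>) t = P \<phi> (clamp t)" for \<phi> t
  proof -
    have "continuous_on UNIV clamp" unfolding clamp_def by (intro continuous_intros)
    then have "continuous_on UNIV (\<lambda>t. P \<phi> (clamp t))"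
      by (rule continuous_on_compose2[OF contP]) (use clamp in auto)
    moreover have "range (\<lambda>t. P \<phi> (clamp t)) \<subseteq> P \<phi> ` {-\<delta>..\<delta>}"
      using clamp(1) by blast
    then have "bounded (range (\<lambda>t. P \<phi> (clamp t)))"
      using bounded_subset compact_imp_bounded compact_continuous_image[OF contP compact_Icc] by blast
    ultimately show ?thesis
      unfolding T_def by (simp add: Bcontfun_inverse bcontfun_def)
  qed
  have contraction: "dist (T \<phi>) (T \<psi>) \<le> 1 / 2 * dist \<phi> \<psi>" for \<phi> \<psi>
  proof (rule dist_bound)
    fix t
    have K0: "K \<ge> 0" using G lipschitz_on_nonneg by blast
    have "norm ((P \<phi> (clamp t) - P \<psi> (clamp t)) - (P \<phi> 0 - P \<psi> 0)) \<le> (K * dist \<phi> \<psi>) * \<bar>clamp t - 0\<bar>"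
    proof (rule vector_mean_value_bound[where I = "{-\<delta>..\<delta>}"])
      show "is_interval {-\<delta>..\<delta>}" by (rule is_interval_cc)
      show "((\<lambda>u. P \<phi> u - P \<psi> u) has_vector_derivative
          G (apply_bcontfun \<phi> u) - G (apply_bcontfun \<psi> u)) (at u within {-\<delta>..\<delta>})"
        if "u \<in> {-\<delta>..\<delta>}" for u
        using dP[OF that] dP[OF that] by (rule has_vector_derivative_diff)
      show "norm (G (apply_bcontfun \<phi> u) - G (apply_bcontfun \<psi> u)) \<le> K * dist \<phi> \<psi>" for u
      proof -
        have "dist (G (apply_bcontfun \<phi> u)) (G (apply_bcontfun \<psi> u))
            \<le> K * dist (apply_bcontfun \<phi> u) (apply_bcontfun \<psi> u)"
          using lipschitz_onD[OF G] by simp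
        also have "\<dots> \<le> K * dist \<phi> \<psi>"
          using dist_bounded[of \<phi> u \<psi>] K0 by (rule mult_left_mono)
        finally show ?thesis by (simp add: dist_norm)
      qed
    qed (use \<delta>(1) clamp in auto)
    also have "\<dots> \<le> (K * dist \<phi> \<psi>) * \<delta>"
      using clamp(1)[of t] K0 by (intro mult_left_mono) auto
    also have "\<dots> = (K * \<delta>) * dist \<phi> \<psi>" by simp
    also have "\<dots> \<le> 1 / 2 * dist \<phi> \<psi>"
      using \<delta>(2) by (rule mult_right_mono) simp
    finally show "dist (apply_bcontfun (T \<phi>) t) (apply_bcontfun (T \<psi>) t) \<le> 1 / 2 * dist \<phi> \<psi>"
      by (simp add: T P0 dist_norm)
  qed
  obtain \<phi> where fixpt: "T \<phi> = \<phi>"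
    using banach_fix_type[of "1 / 2" T] contraction by auto
  have eq: "apply_bcontfun \<phi> t = P \<phi> t" if "t \<in> {-\<delta>..\<delta>}" for t
    using T[of \<phi> t] clamp(2)[OF that] fixpt by simp
  show thesis
  proof (rule that[of "P \<phi>"])
    show "P \<phi> 0 = z" by (rule P0)
    show "(P \<phi> has_vector_derivative G (P \<phi> t)) (at t within {-\<delta>..\<delta>})" if "t \<in> {-\<delta>..\<delta>}" for t
      using dP[OF that, of \<phi>] eq[OF that] by simp
  qed
qed

text \<open>Composing the vector field with the nearest-point projection onto a ball, which does not increase
  distances, makes it globally Lipschitz. Its solutions exist for a time depending on \<open>K\<close> only, and for
  a short time they do not leave the ball, where the vector field was not changed. The radius \<open>r / 2\<close>
  leaves room for the solutions to move by \<open>r / 2\<close>.\<close>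

lemma picard_lindelof:
  fixes F :: "'e::euclidean_space \<Rightarrow> 'e"
  assumes F: "lips_at F z0" and D: "open D" "z0 \<in> D"
  obtains r \<delta> K \<phi> where "r > 0" "\<delta> > 0" "cball z0 r \<subseteq> D" "K-lipschitz_on (cball z0 r) F"
    "\<And>z. z \<in> ball z0 (r / 2) \<Longrightarrow> \<phi> z 0 = z"
    "\<And>z t. z \<in> ball z0 (r / 2) \<Longrightarrow> t \<in> {-\<delta><..<\<delta>} \<Longrightarrow> \<phi> z t \<in> cball z0 r"
    "\<And>z t. z \<in> ball z0 (r / 2) \<Longrightarrow> t \<in> {-\<delta><..<\<delta>} \<Longrightarrow> (\<phi> z has_vector_derivative F (\<phi> z t)) (at t)"
proof -
  obtain S K where S: "open S" "z0 \<in> S" "K-lipschitz_on S F"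
    using F unfolding lips_at_def by blast
  have "open (S \<inter> D)" "z0 \<in> S \<inter> D" using S D by auto
  then obtain r where r: "r > 0" "cball z0 r \<subseteq> S \<inter> D"
    using open_contains_cball by blast
  have lip: "K-lipschitz_on (cball z0 r) F"
    using S(3) r(2) lipschitz_on_subset by blast
  have K0: "K \<ge> 0" using lip lipschitz_on_nonneg by blast
  define B where "B = norm (F z0) + K * r"
  have B0: "B \<ge> 0" unfolding B_def using K0 r(1) by simp
  have B: "norm (F y) \<le> B" if "y \<in> cball z0 r" for y
  proof -
    have "dist (F y) (F z0) \<le> K * dist y z0"
      using lipschitz_onD[OF lip that] r(1) by simp
    also have "\<dots> \<le> K * r" using that K0 by (intro mult_left_mono) (auto simp: dist_commute)
    finally have "norm (F y - F z0) \<le> K * r" by (simp add: dist_norm)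
    then show ?thesis unfolding B_def using norm_triangle_sub[of "F y" "F z0"] by simp
  qed
  define G where "G y = F (closest_point (cball z0 r) y)" for y
  have cp: "closest_point (cball z0 r) y \<in> cball z0 r" for y
    using r(1) by (intro closest_point_in_set) auto
  have G: "K-lipschitz_on UNIV G"
  proof (rule lipschitz_onI)
    fix x y
    have "dist (G x) (G y) \<le> K * dist (closest_point (cball z0 r) x) (closest_point (cball z0 r) y)"
      unfolding G_def using lipschitz_onD[OF lip cp cp] .
    also have "\<dots> \<le> K * dist x y"
      using closest_point_lipschitz[of "cball z0 r" x y] r(1) K0 by (intro mult_left_mono) auto
    finally show "dist (G x) (G y) \<le> K * dist x y" .
  qed (rule K0)
  define \<delta> where "\<delta> = min (1 / (2 * (K + 1))) (r / (2 * (B + 1)))"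
  have \<delta>: "\<delta> > 0" unfolding \<delta>_def using K0 B0 r(1) by simp
  have "K * \<delta> \<le> K * (1 / (2 * (K + 1)))"
    unfolding \<delta>_def using K0 by (intro mult_left_mono) auto
  also have "\<dots> \<le> 1 / 2" using K0 by (simp add: field_simps)
  finally have K\<delta>: "K * \<delta> \<le> 1 / 2" .
  have "B * \<delta> \<le> B * (r / (2 * (B + 1)))"
    unfolding \<delta>_def using B0 by (intro mult_left_mono) auto
  also have "\<dots> \<le> r / 2" using B0 r(1) by (simp add: field_simps)
  finally have B\<delta>: "B * \<delta> \<le> r / 2" .
  have sol: "\<exists>\<phi>. \<phi> 0 = z \<and> (\<forall>t\<in>{-\<delta><..<\<delta>}. \<phi> t \<in> cball z0 r \<and>
        (\<phi> has_vector_derivative F (\<phi> t)) (at t))" if z: "z \<in> ball z0 (r / 2)" for z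
  proof -
    obtain \<phi> where \<phi>: "\<phi> 0 = z"
      "\<And>t. t \<in> {-\<delta>..\<delta>} \<Longrightarrow> (\<phi> has_vector_derivative G (\<phi> t)) (at t within {-\<delta>..\<delta>})"
      using solution_globally_lipschitz[OF G \<delta> K\<delta>] by metis
    have near: "\<phi> t \<in> cball z0 r" if t: "t \<in> {-\<delta><..<\<delta>}" for t
    proof -
      have "norm (\<phi> t - \<phi> 0) \<le> B * \<bar>t - 0\<bar>"
        by (rule vector_mean_value_bound[where I = "{-\<delta>..\<delta>}", OF is_interval_cc _ _ \<phi>(2)])
           (use t in \<open>auto simp: G_def intro!: B cp\<close>)
      also have "\<dots> \<le> B * \<delta>" using t B0 by (intro mult_left_mono) auto
      finally have "dist (\<phi> t) z \<le> r / 2" using B\<delta> \<phi>(1) by (simp add: dist_norm)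
      moreover have "dist z0 z < r / 2" using z by simp
      ultimately show ?thesis
        using dist_triangle[of z0 "\<phi> t" z] by (simp add: dist_commute)
    qed
    have "(\<phi> has_vector_derivative F (\<phi> t)) (at t)" if t: "t \<in> {-\<delta><..<\<delta>}" for t
    proof -
      have "(\<phi> has_vector_derivative G (\<phi> t)) (at t within {-\<delta><..<\<delta>})"
        using \<phi>(2)[of t] t by (auto intro: has_vector_derivative_within_subset)
      moreover have "G (\<phi> t) = F (\<phi> t)"
        unfolding G_def using near[OF t] by (simp add: closest_point_self)
      ultimately show ?thesis
        using t by (simp add: at_within_open[of t "{-\<delta><..<\<delta>}"])
    qed
    with near \<phi>(1) show ?thesis by blast
  qed
  then have "\<forall>z\<in>ball z0 (r / 2). \<exists>\<phi>. \<phi> 0 = z \<and> (\<forall>t\<in>{-\<delta><..<\<delta>}. \<phi> t \<in> cball z0 r \<and>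
        (\<phi> has_vector_derivative F (\<phi> t)) (at t))" by blast
  from bchoice[OF this] obtain \<phi> where "\<forall>z\<in>ball z0 (r / 2). \<phi> z 0 = z \<and> (\<forall>t\<in>{-\<delta><..<\<delta>}. \<phi> z t \<in> cball z0 r \<and>
        (\<phi> z has_vector_derivative F (\<phi> z t)) (at t))" by blast
  then show thesis
    using r by (intro that[OF r(1) \<delta> _ lip, of \<phi>]) blast+
qed

section \<open>Atlases with locally Lipschitz transition maps\<close>

abbreviation point_at :: "('p, 'e) chart \<Rightarrow> 'e \<Rightarrow> 'p" where
  "point_at a \<equiv> inv_into (dom_chart a) (coords a)"

text \<open>All atlases considered here have this property: those of the manifold, of its tangent bundle, of its
  tangent spaces and of its square. It is what is needed for local Lipschitz continuity of maps to be
  independent of the charts.\<close>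

definition lip_atlas :: "('p, 'e::real_normed_vector) chart set \<Rightarrow> bool" where
  "lip_atlas A \<longleftrightarrow>
     (\<forall>a\<in>A. inj_on (coords a) (dom_chart a)) \<and>
     (\<forall>a\<in>A. \<forall>b\<in>A. open (coords a ` (dom_chart a \<inter> dom_chart b))) \<and>
     (\<forall>a\<in>A. \<forall>b\<in>A. \<forall>x\<in>coords a ` (dom_chart a \<inter> dom_chart b). lips_at (transition a b) x)"

text \<open>The requirement of \<open>locally_lipschitz_map\<close> at one point and in one pair of charts. Membership of the
  interior expresses that \<open>f\<close> maps a neighborhood of \<open>w\<close> within \<open>W\<close> into the target chart.\<close>

definition lip_in :: "('p, 'e::real_normed_vector) chart \<Rightarrow> ('q, 'f::real_normed_vector) chart
    \<Rightarrow> 'p set \<Rightarrow> ('p \<Rightarrow> 'q) \<Rightarrow> 'p \<Rightarrow> bool" where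
  "lip_in a b W f w \<longleftrightarrow>
     w \<in> dom_chart a \<and> f w \<in> dom_chart b \<and>
     coords a w \<in> interior (coords a ` {u \<in> dom_chart a \<inter> W. f u \<in> dom_chart b}) \<and>
     lips_at (coord_expr a b f) (coords a w)"

lemma lip_atlas_inj: "lip_atlas A \<Longrightarrow> a \<in> A \<Longrightarrow> inj_on (coords a) (dom_chart a)"
  unfolding lip_atlas_def by blast

lemma lip_atlas_open:
  "lip_atlas A \<Longrightarrow> a \<in> A \<Longrightarrow> b \<in> A \<Longrightarrow> open (coords a ` (dom_chart a \<inter> dom_chart b))"
  unfolding lip_atlas_def by blast

lemma lip_atlas_open_coords: "lip_atlas A \<Longrightarrow> a \<in> A \<Longrightarrow> open (coords a ` dom_chart a)"
  using lip_atlas_open[of A a a] by simp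

lemma point_at_coords: "inj_on (coords a) (dom_chart a) \<Longrightarrow> w \<in> dom_chart a \<Longrightarrow> point_at a (coords a w) = w"
  by (rule inv_into_f_f)

lemma coord_expr_coords:
  "inj_on (coords a) (dom_chart a) \<Longrightarrow> w \<in> dom_chart a \<Longrightarrow> coord_expr a b f (coords a w) = coords b (f w)"
  unfolding coord_expr_def by simp

lemma interior_iff_open: "x \<in> interior T \<longleftrightarrow> (\<exists>S. open S \<and> x \<in> S \<and> S \<subseteq> T)"
  unfolding interior_def by blast

lemma interior_imageE:
  assumes "y \<in> interior (h ` V)"
  obtains u where "u \<in> V" "y = h u"
  using assms interior_subset[of "h ` V"] by blast

lemma lips_at_interior_iff:
  "(\<exists>S C. open S \<and> x \<in> S \<and> S \<subseteq> T \<and> C-lipschitz_on S f) \<longleftrightarrow> x \<in> interior T \<and> lips_at f x"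
proof
  assume "\<exists>S C. open S \<and> x \<in> S \<and> S \<subseteq> T \<and> C-lipschitz_on S f"
  then show "x \<in> interior T \<and> lips_at f x"
    unfolding lips_at_def interior_iff_open by blast
next
  assume *: "x \<in> interior T \<and> lips_at f x"
  then obtain S C where S: "open S" "x \<in> S" "C-lipschitz_on S f"
    unfolding lips_at_def by blast
  show "\<exists>S C. open S \<and> x \<in> S \<and> S \<subseteq> T \<and> C-lipschitz_on S f"
  proof (intro exI conjI)
    show "C-lipschitz_on (S \<inter> interior T) f"
      by (rule lipschitz_on_subset[OF S(3)]) simp
    show "S \<inter> interior T \<subseteq> T" using interior_subset by blast
  qed (use S * in auto)
qed

lemma locally_lipschitz_map_iff:
  "locally_lipschitz_map A B W f \<longleftrightarrow>
     W \<subseteq> \<Union>(dom_chart ` A) \<and> f ` W \<subseteq> \<Union>(dom_chart ` B) \<and>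
     (\<forall>w\<in>W. \<forall>a\<in>A. \<forall>b\<in>B. w \<in> dom_chart a \<longrightarrow> f w \<in> dom_chart b \<longrightarrow> lip_in a b W f w)"
  unfolding locally_lipschitz_map_def lips_at_interior_iff lip_in_def by blast

lemma locally_lipschitz_map_range: "locally_lipschitz_map A B W f \<Longrightarrow> f ` W \<subseteq> \<Union>(dom_chart ` B)"
  unfolding locally_lipschitz_map_def by (elim conjE)

lemma lip_in_cong:
  assumes f: "lip_in a b W f w" and a: "inj_on (coords a) (dom_chart a)"
    and W: "W \<subseteq> W'" "\<And>u. u \<in> W \<Longrightarrow> f u = g u" and w: "w \<in> W"
  shows "lip_in a b W' g w"
proof -
  let ?S = "interior (coords a ` {u \<in> dom_chart a \<inter> W. f u \<in> dom_chart b})"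
  have sub: "coords a ` {u \<in> dom_chart a \<inter> W. f u \<in> dom_chart b}
      \<subseteq> coords a ` {u \<in> dom_chart a \<inter> W'. g u \<in> dom_chart b}"
    using W by (intro image_mono) auto
  have eq: "coord_expr a b f y = coord_expr a b g y" if y: "y \<in> ?S" for y
  proof -
    obtain u where "u \<in> dom_chart a" "u \<in> W" "y = coords a u"
      using y by (blast elim: interior_imageE)
    then show ?thesis using W(2) by (simp add: coord_expr_coords[OF a])
  qed
  have x: "coords a w \<in> ?S" and L: "lips_at (coord_expr a b f) (coords a w)"
    using f unfolding lip_in_def by blast+
  have "lips_at (coord_expr a b g) (coords a w)"
    by (rule lips_at_cong[OF L open_interior x eq])
  then show ?thesis
    using f interior_mono[OF sub] W(2)[OF w] unfolding lip_in_def by auto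
qed

text \<open>Continuity of the coordinate expression of \<open>f\<close> shrinks the neighborhood of \<open>w\<close> so that its image
  stays where \<open>g\<close> is controlled.\<close>

lemma lip_in_compose:
  assumes a: "inj_on (coords a) (dom_chart a)" and b: "inj_on (coords b) (dom_chart b)"
    and f: "lip_in a b W f w" and g: "lip_in b c V g (f w)"
  shows "lip_in a c {u \<in> W. f u \<in> V} (\<lambda>u. g (f u)) w"
proof -
  let ?F = "coord_expr a b f" and ?G = "coord_expr b c g"
  let ?S = "interior (coords a ` {u \<in> dom_chart a \<inter> W. f u \<in> dom_chart b})"
  let ?T = "interior (coords b ` {u \<in> dom_chart b \<inter> V. g u \<in> dom_chart c})"
  have w: "w \<in> dom_chart a" "f w \<in> dom_chart b" "g (f w) \<in> dom_chart c"
      "coords a w \<in> ?S" "coords b (f w) \<in> ?T"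
    and L: "lips_at ?F (coords a w)" "lips_at ?G (coords b (f w))"
    using f g unfolding lip_in_def by blast+
  have Fw: "?F (coords a w) = coords b (f w)" by (rule coord_expr_coords[OF a w(1)])
  have "\<forall>\<^sub>F y in nhds (coords a w). ?F y \<in> ?T"
    by (rule isCont_eventually_mem[OF lips_at_isCont[OF L(1)] open_interior]) (unfold Fw, rule w(5))
  then obtain R where R: "open R" "coords a w \<in> R" "\<And>y. y \<in> R \<Longrightarrow> ?F y \<in> ?T"
    unfolding eventually_nhds by blast
  have *: "\<exists>u. y = coords a u \<and> u \<in> dom_chart a \<and> u \<in> W \<and> f u \<in> dom_chart b \<and> f u \<in> V \<and>
      g (f u) \<in> dom_chart c" if y: "y \<in> ?S \<inter> R" for y
  proof -
    obtain u where u: "u \<in> dom_chart a" "u \<in> W" "f u \<in> dom_chart b" "y = coords a u"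
      using y by (blast elim: interior_imageE)
    have "?F y = coords b (f u)" unfolding u(4) by (rule coord_expr_coords[OF a u(1)])
    then have "coords b (f u) \<in> ?T" using R(3)[of y] y by (metis IntD2)
    then obtain q where "q \<in> dom_chart b" "q \<in> V" "g q \<in> dom_chart c" "coords b (f u) = coords b q"
      by (blast elim: interior_imageE)
    then have "f u \<in> V" "g (f u) \<in> dom_chart c"
      using u(3) inj_onD[OF b] by metis+
    then show ?thesis using u by blast
  qed
  have SR: "open (?S \<inter> R)" "coords a w \<in> ?S \<inter> R"
    by (rule open_Int[OF open_interior R(1)], rule IntI[OF w(4) R(2)])
  have "?S \<inter> R \<subseteq> coords a ` {u \<in> dom_chart a \<inter> {u \<in> W. f u \<in> V}. g (f u) \<in> dom_chart c}"
  proof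
    fix y assume "y \<in> ?S \<inter> R"
    from *[OF this] show "y \<in> coords a ` {u \<in> dom_chart a \<inter> {u \<in> W. f u \<in> V}. g (f u) \<in> dom_chart c}"
      by blast
  qed
  then have int: "coords a w \<in> interior (coords a ` {u \<in> dom_chart a \<inter> {u \<in> W. f u \<in> V}. g (f u) \<in> dom_chart c})"
    by (rule interiorI[OF SR])
  have "lips_at (\<lambda>y. ?G (?F y)) (coords a w)"
    by (rule lips_at_compose[of ?F _ ?G, OF L(1)]) (unfold Fw, rule L(2))
  then have "lips_at (coord_expr a c (\<lambda>u. g (f u))) (coords a w)"
  proof (rule lips_at_cong[OF _ SR])
    show "?G (?F y) = coord_expr a c (\<lambda>u. g (f u)) y" if y: "y \<in> ?S \<inter> R" for y
    proof -
      obtain u where "y = coords a u" "u \<in> dom_chart a" "f u \<in> dom_chart b" using *[OF y] by blast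
      then show ?thesis by (simp add: coord_expr_coords[OF a] coord_expr_coords[OF b])
    qed
  qed
  then show ?thesis unfolding lip_in_def using w int by blast
qed

lemma lip_in_transition:
  assumes A: "lip_atlas A" and a: "a \<in> A" "b \<in> A" "w \<in> dom_chart a" "w \<in> dom_chart b"
  shows "lip_in a b UNIV (\<lambda>u. u) w"
proof -
  have "{u \<in> dom_chart a \<inter> UNIV. u \<in> dom_chart b} = dom_chart a \<inter> dom_chart b" by auto
  then show ?thesis
    unfolding lip_in_def using assms lip_atlas_open[OF A a(1,2)]
    by (auto simp: lip_atlas_def interior_open)
qed

text \<open>A change of charts is a composition with the identity map, seen in different charts, on both sides.\<close>

lemma lip_in_change_charts:
  assumes A: "lip_atlas A" and B: "lip_atlas B"
    and ab: "a \<in> A" "a' \<in> A" "b \<in> B" "b' \<in> B"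
    and f: "lip_in a b W f w" and w: "w \<in> dom_chart a'" "f w \<in> dom_chart b'"
  shows "lip_in a' b' W f w"
proof -
  have wab: "w \<in> dom_chart a" "f w \<in> dom_chart b" using f unfolding lip_in_def by blast+
  have "lip_in a' b {u \<in> UNIV. u \<in> W} (\<lambda>u. f u) w"
    by (rule lip_in_compose[OF lip_atlas_inj[OF A ab(2)] lip_atlas_inj[OF A ab(1)]
          lip_in_transition[OF A ab(2,1) w(1) wab(1)] f])
  then have f': "lip_in a' b W f w" by simp
  from lip_in_compose[OF lip_atlas_inj[OF A ab(2)] lip_atlas_inj[OF B ab(3)] f'
      lip_in_transition[OF B ab(3,4) wab(2) w(2)]]
  show ?thesis by simp
qed

text \<open>One pair of charts at each point is enough.\<close>

lemma locally_lipschitz_mapI: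
  assumes A: "lip_atlas A" and B: "lip_atlas B"
    and "\<And>w. w \<in> W \<Longrightarrow> \<exists>a\<in>A. \<exists>b\<in>B. lip_in a b W f w"
  shows "locally_lipschitz_map A B W f"
  unfolding locally_lipschitz_map_iff
proof (intro conjI ballI impI)
  show "W \<subseteq> \<Union>(dom_chart ` A)" "f ` W \<subseteq> \<Union>(dom_chart ` B)"
    using assms(3) unfolding lip_in_def by blast+
  fix w a b assume "w \<in> W" "a \<in> A" "b \<in> B" "w \<in> dom_chart a" "f w \<in> dom_chart b"
  then show "lip_in a b W f w"
    using assms(3)[of w] lip_in_change_charts[OF A B] by blast
qed

lemma locally_lipschitz_mapD:
  assumes "locally_lipschitz_map A B W f" "w \<in> W"
  obtains a b where "a \<in> A" "b \<in> B" "lip_in a b W f w"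
proof -
  obtain a b where "a \<in> A" "b \<in> B" "w \<in> dom_chart a" "f w \<in> dom_chart b"
    using assms unfolding locally_lipschitz_map_iff by blast
  then show thesis using that assms unfolding locally_lipschitz_map_iff by blast
qed

lemma locally_lipschitz_map_cong:
  assumes A: "lip_atlas A" and B: "lip_atlas B" and f: "locally_lipschitz_map A B W f"
    and eq: "\<And>u. u \<in> W \<Longrightarrow> f u = g u"
  shows "locally_lipschitz_map A B W g"
proof (rule locally_lipschitz_mapI[OF A B])
  fix w assume w: "w \<in> W"
  obtain a b where ab: "a \<in> A" "b \<in> B" "lip_in a b W f w"
    using locally_lipschitz_mapD[OF f w] by blast
  have "lip_in a b W g w"
    by (rule lip_in_cong[OF ab(3) lip_atlas_inj[OF A ab(1)] _ eq w]) auto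
  with ab show "\<exists>a\<in>A. \<exists>b\<in>B. lip_in a b W g w" by blast
qed

lemma locally_lipschitz_map_compose:
  assumes A: "lip_atlas A" and B: "lip_atlas B" and C: "lip_atlas C"
    and f: "locally_lipschitz_map A B W f" and g: "locally_lipschitz_map B C V g"
  shows "locally_lipschitz_map A C {u \<in> W. f u \<in> V} (\<lambda>u. g (f u))"
proof (rule locally_lipschitz_mapI[OF A C])
  fix w assume "w \<in> {u \<in> W. f u \<in> V}"
  then have w: "w \<in> W" "f w \<in> V" by auto
  obtain b c where bc: "b \<in> B" "c \<in> C" "lip_in b c V g (f w)"
    using locally_lipschitz_mapD[OF g w(2)] by blast
  obtain a where a: "a \<in> A" "w \<in> dom_chart a"
    using f w(1) unfolding locally_lipschitz_map_iff by blast
  have "lip_in a b W f w"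
    using f w(1) a bc unfolding locally_lipschitz_map_iff lip_in_def by blast
  from lip_in_compose[OF lip_atlas_inj[OF A a(1)] lip_atlas_inj[OF B bc(1)] this bc(3)]
  show "\<exists>a\<in>A. \<exists>c\<in>C. lip_in a c {u \<in> W. f u \<in> V} (\<lambda>u. g (f u)) w"
    using a(1) bc(2) by blast
qed

text \<open>Continuity of the transition maps makes the generating sets, which come from one chart, open in every
  other chart; injectivity of the coordinate maps lets this property pass to finite intersections.\<close>

lemma openin_chart_topology:
  assumes A: "lip_atlas A"
  shows "openin (chart_topology A) U \<longleftrightarrow>
    U \<subseteq> \<Union>(dom_chart ` A) \<and> (\<forall>a\<in>A. open (coords a ` (U \<inter> dom_chart a)))" (is "_ \<longleftrightarrow> ?R U")
proof
  let ?B = "{{w \<in> dom_chart a. coords a w \<in> S} | a S. a \<in> A \<and> open S}"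
  have image: "coords a ` (V \<inter> W \<inter> dom_chart a) = coords a ` (V \<inter> dom_chart a) \<inter> coords a ` (W \<inter> dom_chart a)"
    if "a \<in> A" for a V W
    using inj_on_image_Int[OF lip_atlas_inj[OF A that], of "V \<inter> dom_chart a" "W \<inter> dom_chart a"]
    by (simp add: Int_ac)
  assume "openin (chart_topology A) U"
  then have "generate_topology_on ?B U"
    unfolding chart_topology_def openin_topology_generated_by_iff .
  then show "?R U"
  proof induction
    case Empty
    then show ?case by simp
  next
    case (Int V W)
    then show ?case by (auto simp: image)
  next
    case (UN K)
    have img: "coords a ` (\<Union>K \<inter> dom_chart a) = (\<Union>V\<in>K. coords a ` (V \<inter> dom_chart a))" for a
      by blast
    show ?case
    proof (intro conjI ballI)
      show "\<Union>K \<subseteq> \<Union>(dom_chart ` A)" using UN(2) by blast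
      fix a assume "a \<in> A"
      then show "open (coords a ` (\<Union>K \<inter> dom_chart a))"
        unfolding img using UN(2) by (intro open_UN) blast
    qed
  next
    case (Basis s)
    then obtain b S where b: "b \<in> A" "open S" "s = {w \<in> dom_chart b. coords b w \<in> S}" by blast
    have "open (coords a ` (s \<inter> dom_chart a))" if a: "a \<in> A" for a
    proof (subst open_subopen, intro ballI)
      fix x assume "x \<in> coords a ` (s \<inter> dom_chart a)"
      then obtain w where w: "w \<in> dom_chart a" "w \<in> dom_chart b" "coords b w \<in> S" "x = coords a w"
        using b(3) by blast
      let ?V = "coords a ` (dom_chart a \<inter> dom_chart b)"
      have tx: "transition a b (coords a u) = coords b u" if "u \<in> dom_chart a" for u
        by (rule coord_expr_coords[OF lip_atlas_inj[OF A a] that])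
      have "isCont (transition a b) x"
        using A a b(1) w unfolding lip_atlas_def by (blast intro: lips_at_isCont)
      then have "\<forall>\<^sub>F y in nhds x. transition a b y \<in> S"
        by (rule isCont_eventually_mem) (use b(2) w tx in auto)
      then obtain R where R: "open R" "x \<in> R" "\<And>y. y \<in> R \<Longrightarrow> transition a b y \<in> S"
        unfolding eventually_nhds by blast
      have "R \<inter> ?V \<subseteq> coords a ` (s \<inter> dom_chart a)"
      proof
        fix y assume y: "y \<in> R \<inter> ?V"
        then obtain u where u: "u \<in> dom_chart a" "u \<in> dom_chart b" "y = coords a u" by blast
        with R(3)[of y] y tx[of u] have "coords b u \<in> S" by auto
        with u b(3) show "y \<in> coords a ` (s \<inter> dom_chart a)" by blast
      qed
      then show "\<exists>T. open T \<and> x \<in> T \<and> T \<subseteq> coords a ` (s \<inter> dom_chart a)"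
        using R w lip_atlas_open[OF A a b(1)] by (intro exI[of _ "R \<inter> ?V"]) auto
    qed
    with b show ?case by auto
  qed
next
  let ?B = "{{w \<in> dom_chart a. coords a w \<in> S} | a S. a \<in> A \<and> open S}"
  assume R: "?R U"
  define K where "K = (\<lambda>a. {w \<in> dom_chart a. coords a w \<in> coords a ` (U \<inter> dom_chart a)}) ` A"
  have "K \<subseteq> ?B" using R unfolding K_def by blast
  then have "generate_topology_on ?B (\<Union>K)"
    by (meson generate_topology_on.Basis generate_topology_on.UN subsetD)
  moreover have "{w \<in> dom_chart a. coords a w \<in> coords a ` (U \<inter> dom_chart a)} = U \<inter> dom_chart a"
    if "a \<in> A" for a
    using inj_on_image_mem_iff[OF lip_atlas_inj[OF A that], of _ "U \<inter> dom_chart a"] by blast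
  then have "\<Union>K = U" using R unfolding K_def by auto
  ultimately show "openin (chart_topology A) U"
    unfolding chart_topology_def openin_topology_generated_by_iff by simp
qed

lemma topspace_chart_topology: "lip_atlas A \<Longrightarrow> topspace (chart_topology A) = \<Union>(dom_chart ` A)"
proof -
  assume A: "lip_atlas A"
  have "openin (chart_topology A) (\<Union>(dom_chart ` A))"
    unfolding openin_chart_topology[OF A]
  proof (intro conjI ballI)
    fix a assume a: "a \<in> A"
    then have "\<Union>(dom_chart ` A) \<inter> dom_chart a = dom_chart a" by blast
    then show "open (coords a ` (\<Union>(dom_chart ` A) \<inter> dom_chart a))"
      using lip_atlas_open_coords[OF A a] by (simp only:)
  qed (rule subset_refl)
  then have "\<Union>(dom_chart ` A) \<subseteq> topspace (chart_topology A)" by (rule openin_subset)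
  moreover have "topspace (chart_topology A) \<subseteq> \<Union>(dom_chart ` A)"
    using openin_topspace[of "chart_topology A"] unfolding openin_chart_topology[OF A] by (rule conjunct1)
  ultimately show ?thesis by (rule equalityI[rotated])
qed

lemma openin_chart_preimage:
  assumes A: "lip_atlas A" and a: "a \<in> A" and S: "open S"
  shows "openin (chart_topology A) {w \<in> dom_chart a. coords a w \<in> S}"
  unfolding chart_topology_def openin_topology_generated_by_iff
  using a S by (intro generate_topology_on.Basis) blast

lemma openin_chart_topology_local:
  assumes A: "lip_atlas A"
    and "\<And>w. w \<in> U \<Longrightarrow> \<exists>a\<in>A. w \<in> dom_chart a \<and> coords a w \<in> interior (coords a ` (U \<inter> dom_chart a))"
  shows "openin (chart_topology A) U"
proof (subst openin_subopen, intro ballI)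
  fix w assume "w \<in> U"
  then obtain a where a: "a \<in> A" "w \<in> dom_chart a" "coords a w \<in> interior (coords a ` (U \<inter> dom_chart a))"
    using assms(2) by blast
  let ?T = "{u \<in> dom_chart a. coords a u \<in> interior (coords a ` (U \<inter> dom_chart a))}"
  have "?T \<subseteq> U"
  proof
    fix u assume u: "u \<in> ?T"
    then have "coords a u \<in> coords a ` (U \<inter> dom_chart a)" using interior_subset by blast
    then show "u \<in> U" using u inj_onD[OF lip_atlas_inj[OF A a(1)]] by auto
  qed
  then show "\<exists>T. openin (chart_topology A) T \<and> w \<in> T \<and> T \<subseteq> U"
    using openin_chart_preimage[OF A a(1) open_interior] a by (intro exI[of _ ?T]) auto
qed

lemma locally_lipschitz_map_preimage_openin:
  assumes A: "lip_atlas A" and B: "lip_atlas B" and f: "locally_lipschitz_map A B W f"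
    and V: "openin (chart_topology B) V"
  shows "openin (chart_topology A) {u \<in> W. f u \<in> V}"
proof (rule openin_chart_topology_local[OF A])
  fix w assume "w \<in> {u \<in> W. f u \<in> V}"
  then have w: "w \<in> W" "f w \<in> V" by auto
  obtain a b where ab: "a \<in> A" "b \<in> B" "lip_in a b W f w"
    using locally_lipschitz_mapD[OF f w(1)] by blast
  note inj = lip_atlas_inj[OF A ab(1)] lip_atlas_inj[OF B ab(2)]
  let ?S = "interior (coords a ` {u \<in> dom_chart a \<inter> W. f u \<in> dom_chart b})"
  let ?T = "coords b ` (V \<inter> dom_chart b)"
  have wd: "w \<in> dom_chart a" "f w \<in> dom_chart b" "coords a w \<in> ?S" "lips_at (coord_expr a b f) (coords a w)"
    using ab(3) unfolding lip_in_def by blast+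
  have "open ?T" using V ab(2) unfolding openin_chart_topology[OF B] by blast
  then have "\<forall>\<^sub>F y in nhds (coords a w). coord_expr a b f y \<in> ?T"
    by (rule isCont_eventually_mem[OF lips_at_isCont[OF wd(4)]])
       (use w wd in \<open>auto simp: coord_expr_coords[OF inj(1)]\<close>)
  then obtain R where R: "open R" "coords a w \<in> R" "\<And>y. y \<in> R \<Longrightarrow> coord_expr a b f y \<in> ?T"
    unfolding eventually_nhds by blast
  have SR: "open (?S \<inter> R)" "coords a w \<in> ?S \<inter> R"
    by (rule open_Int[OF open_interior R(1)], rule IntI[OF wd(3) R(2)])
  have "?S \<inter> R \<subseteq> coords a ` ({u \<in> W. f u \<in> V} \<inter> dom_chart a)"
  proof
    fix y assume y: "y \<in> ?S \<inter> R"
    then obtain u where u: "u \<in> dom_chart a" "u \<in> W" "f u \<in> dom_chart b" "y = coords a u"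
      using y by (blast elim: interior_imageE)
    have "coord_expr a b f y = coords b (f u)" unfolding u(4) by (rule coord_expr_coords[OF inj(1) u(1)])
    then have "coords b (f u) \<in> ?T" using R(3)[of y] y by (metis IntD2)
    then have "f u \<in> V" using inj_onD[OF inj(2)] u(3) by auto
    with u show "y \<in> coords a ` ({u \<in> W. f u \<in> V} \<inter> dom_chart a)" by blast
  qed
  then have "coords a w \<in> interior (coords a ` ({u \<in> W. f u \<in> V} \<inter> dom_chart a))"
    by (rule interiorI[OF SR])
  with ab wd show "\<exists>a\<in>A. w \<in> dom_chart a \<and>
      coords a w \<in> interior (coords a ` ({u \<in> W. f u \<in> V} \<inter> dom_chart a))" by blast
qed

lemma locally_lipschitz_map_openin:
  assumes A: "lip_atlas A" and B: "lip_atlas B" and f: "locally_lipschitz_map A B W f"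
  shows "openin (chart_topology A) W"
proof -
  have "openin (chart_topology A) {u \<in> W. f u \<in> topspace (chart_topology B)}"
    by (rule locally_lipschitz_map_preimage_openin[OF A B f openin_topspace])
  moreover have "{u \<in> W. f u \<in> topspace (chart_topology B)} = W"
    using locally_lipschitz_map_range[OF f] unfolding topspace_chart_topology[OF B] by blast
  ultimately show ?thesis by (simp only:)
qed

lemma locally_lipschitz_map_continuous:
  assumes A: "lip_atlas A" and B: "lip_atlas B" and f: "locally_lipschitz_map A B W f"
  shows "continuous_map (subtopology (chart_topology A) W) (chart_topology B) f"
proof -
  have W: "openin (chart_topology A) W" by (rule locally_lipschitz_map_openin[OF A B f])
  then have top: "topspace (subtopology (chart_topology A) W) = W"
    by (intro topspace_subtopology_subset openin_subset)
  show ?thesis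
    unfolding continuous_map_def top
  proof (intro conjI allI impI)
    show "f \<in> W \<rightarrow> topspace (chart_topology B)"
      using locally_lipschitz_map_range[OF f] unfolding topspace_chart_topology[OF B] by blast
    fix V assume "openin (chart_topology B) V"
    then have "openin (chart_topology A) {u \<in> W. f u \<in> V}"
      by (rule locally_lipschitz_map_preimage_openin[OF A B f])
    then show "openin (subtopology (chart_topology A) W) {x \<in> W. f x \<in> V}"
      unfolding openin_open_subtopology[OF W] by blast
  qed
qed

text \<open>An injective map that is locally Lipschitz and expansive in charts is open by invariance of domain,
  which applies since source and target are modelled on the same Euclidean space. Expansiveness is
  the Lipschitz condition for the inverse.\<close>

lemma lipeomorphismI:
  fixes A :: "('p, 'e::euclidean_space) chart set" and B :: "('q, 'e) chart set"
  assumes A: "lip_atlas A" and B: "lip_atlas B"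
    and inj: "inj_on f N"
    and local: "\<And>w. w \<in> N \<Longrightarrow> \<exists>a\<in>A. \<exists>b\<in>B. lip_in a b N f w \<and>
      (\<exists>S m. open S \<and> coords a w \<in> S \<and>
        (\<forall>y\<in>S. \<forall>z\<in>S. dist y z \<le> m * dist (coord_expr a b f y) (coord_expr a b f z)))"
  shows "openin (chart_topology B) (f ` N)"
    and "lipeomorphism (chart_topology A) (chart_topology B) A B N (f ` N) f"
proof -
  let ?g = "inv_into N f"
  have f: "locally_lipschitz_map A B N f"
    by (rule locally_lipschitz_mapI[OF A B]) (use local in blast)
  have g: "locally_lipschitz_map B A (f ` N) ?g"
  proof (rule locally_lipschitz_mapI[OF B A])
    fix q assume "q \<in> f ` N"
    then obtain w where w: "w \<in> N" "q = f w" by blast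
    obtain a b S m where ab: "a \<in> A" "b \<in> B" "lip_in a b N f w" and
      S: "open S" "coords a w \<in> S"
        "\<And>y z. y \<in> S \<Longrightarrow> z \<in> S \<Longrightarrow> dist y z \<le> m * dist (coord_expr a b f y) (coord_expr a b f z)"
      using local[OF w(1)] by blast
    let ?F = "coord_expr a b f"
    note inja = lip_atlas_inj[OF A ab(1)] and injb = lip_atlas_inj[OF B ab(2)]
    let ?R = "interior (coords a ` {u \<in> dom_chart a \<inter> N. f u \<in> dom_chart b})"
    have wd: "w \<in> dom_chart a" "f w \<in> dom_chart b" "coords a w \<in> ?R" "lips_at ?F (coords a w)"
      using ab(3) unfolding lip_in_def by blast+
    obtain T C where T: "open T" "coords a w \<in> T" "C-lipschitz_on T ?F"
      using wd(4) unfolding lips_at_def by blast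
    define V where "V = S \<inter> T \<inter> ?R"
    have V: "open V" "coords a w \<in> V" unfolding V_def using S T wd by auto
    have cont: "continuous_on V ?F"
      using lipschitz_on_continuous_on[OF T(3)] by (rule continuous_on_subset) (auto simp: V_def)
    have "inj_on ?F V"
    proof (rule inj_onI)
      fix y z assume "y \<in> V" "z \<in> V" "?F y = ?F z"
      then show "y = z" using S(3)[of y z] unfolding V_def by simp
    qed
    then have op: "open (?F ` V)" by (rule invariance_of_domain[OF cont V(1)])
    have Vu: "\<exists>u. u \<in> dom_chart a \<and> u \<in> N \<and> f u \<in> dom_chart b \<and> y = coords a u \<and>
        ?F y = coords b (f u) \<and> coord_expr b a ?g (?F y) = y \<and> ?g (f u) = u" if y: "y \<in> V" for y
    proof -
      obtain u where u: "u \<in> dom_chart a" "u \<in> N" "f u \<in> dom_chart b" "y = coords a u"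
        using y unfolding V_def by (blast elim: interior_imageE)
      then show ?thesis
        using inv_into_f_f[OF inj u(2)]
        by (intro exI[of _ u]) (simp add: coord_expr_coords[OF inja] coord_expr_coords[OF injb])
    qed
    have sub: "?F ` V \<subseteq> coords b ` {u \<in> dom_chart b \<inter> f ` N. ?g u \<in> dom_chart a}"
    proof
      fix x assume "x \<in> ?F ` V"
      then obtain y where "y \<in> V" "x = ?F y" by blast
      with Vu[of y] obtain u where "u \<in> dom_chart a" "u \<in> N" "f u \<in> dom_chart b"
        "x = coords b (f u)" "?g (f u) = u" by blast
      then show "x \<in> coords b ` {u \<in> dom_chart b \<inter> f ` N. ?g u \<in> dom_chart a}" by force
    qed
    have "\<bar>m\<bar>-lipschitz_on (?F ` V) (coord_expr b a ?g)"
    proof (rule lipschitz_onI)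
      fix x x' assume "x \<in> ?F ` V" "x' \<in> ?F ` V"
      then obtain y z where yz: "y \<in> V" "x = ?F y" "z \<in> V" "x' = ?F z" by blast
      then have "coord_expr b a ?g x = y" "coord_expr b a ?g x' = z" using Vu by blast+
      moreover have "dist y z \<le> m * dist x x'" using S(3)[of y z] yz unfolding V_def by simp
      moreover have "m * dist x x' \<le> \<bar>m\<bar> * dist x x'" by (intro mult_right_mono) auto
      ultimately show "dist (coord_expr b a ?g x) (coord_expr b a ?g x') \<le> \<bar>m\<bar> * dist x x'" by simp
    qed simp
    moreover have "coords b q \<in> ?F ` V"
      using V(2) w(2) coord_expr_coords[OF inja wd(1), of b f] by (metis imageI)
    ultimately have "coords b q \<in> interior (coords b ` {u \<in> dom_chart b \<inter> f ` N. ?g u \<in> dom_chart a}) \<and>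
        lips_at (coord_expr b a ?g) (coords b q)"
      using op sub lips_at_interior_iff by blast
    moreover have "?g q = w" using w inv_into_f_f[OF inj] by simp
    ultimately have "lip_in b a (f ` N) ?g q"
      unfolding lip_in_def using w wd by simp
    then show "\<exists>b\<in>B. \<exists>a\<in>A. lip_in b a (f ` N) ?g q" using ab by blast
  qed
  show op: "openin (chart_topology B) (f ` N)"
    by (rule locally_lipschitz_map_openin[OF B A g])
  have opN: "openin (chart_topology A) N"
    by (rule locally_lipschitz_map_openin[OF A B f])
  have top: "topspace (subtopology (chart_topology A) N) = N"
      "topspace (subtopology (chart_topology B) (f ` N)) = f ` N"
    by (intro topspace_subtopology_subset openin_subset opN, intro topspace_subtopology_subset openin_subset op)
  have "homeomorphic_maps (subtopology (chart_topology A) N) (subtopology (chart_topology B) (f ` N)) f ?g"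
    unfolding homeomorphic_maps_def top
  proof (intro conjI ballI)
    show "continuous_map (subtopology (chart_topology A) N) (subtopology (chart_topology B) (f ` N)) f"
      using locally_lipschitz_map_continuous[OF A B f]
      by (rule continuous_map_into_subtopology) (use top in auto)
    show "continuous_map (subtopology (chart_topology B) (f ` N)) (subtopology (chart_topology A) N) ?g"
      using locally_lipschitz_map_continuous[OF B A g]
      by (rule continuous_map_into_subtopology) (use top inj in \<open>auto simp: inv_into_into\<close>)
    show "?g (f x) = x" if "x \<in> N" for x using inv_into_f_f[OF inj that] .
    show "f (?g y) = y" if "y \<in> f ` N" for y using f_inv_into_f[OF that] .
  qed
  then have "homeomorphic_map (subtopology (chart_topology A) N) (subtopology (chart_topology B) (f ` N)) f"
    using homeomorphic_map_maps by blast
  then show "lipeomorphism (chart_topology A) (chart_topology B) A B N (f ` N) f"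
    unfolding lipeomorphism_def using f g by blast
qed

section \<open>The atlases of a manifold, of its tangent bundle and of its square\<close>

lemma transition_coords:
  "inj_on (coords a) (dom_chart a) \<Longrightarrow> w \<in> dom_chart a \<Longrightarrow> transition a b (coords a w) = coords b w"
  by (rule coord_expr_coords)

lemma lip_atlas_imageI:
  assumes "\<And>a. a \<in> B \<Longrightarrow> inj_on (coords (h a)) (dom_chart (h a))"
    and "\<And>a b. a \<in> B \<Longrightarrow> b \<in> B \<Longrightarrow> open (coords (h a) ` (dom_chart (h a) \<inter> dom_chart (h b)))"
    and "\<And>a b x. a \<in> B \<Longrightarrow> b \<in> B \<Longrightarrow> x \<in> coords (h a) ` (dom_chart (h a) \<inter> dom_chart (h b)) \<Longrightarrow>
      lips_at (transition (h a) (h b)) x"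
  shows "lip_atlas (h ` B)"
  using assms unfolding lip_atlas_def by (intro conjI ballI; elim imageE; simp)

lemma lip_atlas_prod:
  assumes A: "lip_atlas A" and B: "lip_atlas B"
  shows "lip_atlas (prod_charts A B)"
  unfolding lip_atlas_def
proof (intro conjI ballI)
  fix c assume "c \<in> prod_charts A B"
  then obtain a b where c: "c = prod_chart a b" "a \<in> A" "b \<in> B" unfolding prod_charts_def by blast
  have injc: "inj_on (coords c) (dom_chart c)"
    unfolding c(1) prod_chart_def using lip_atlas_inj[OF A c(2)] lip_atlas_inj[OF B c(3)]
    by (simp add: map_prod_inj_on)
  show "inj_on (coords c) (dom_chart c)" by (rule injc)
  fix c' assume "c' \<in> prod_charts A B"
  then obtain a' b' where c': "c' = prod_chart a' b'" "a' \<in> A" "b' \<in> B" unfolding prod_charts_def by blast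
  have dom: "dom_chart c \<inter> dom_chart c' = (dom_chart a \<inter> dom_chart a') \<times> (dom_chart b \<inter> dom_chart b')"
    unfolding c(1) c'(1) prod_chart_def by auto
  have im: "coords c ` (dom_chart c \<inter> dom_chart c')
      = coords a ` (dom_chart a \<inter> dom_chart a') \<times> coords b ` (dom_chart b \<inter> dom_chart b')"
    unfolding dom unfolding c(1) prod_chart_def by (simp add: map_prod_surj_on)
  show op: "open (coords c ` (dom_chart c \<inter> dom_chart c'))"
    unfolding im by (intro open_Times lip_atlas_open[OF A c(2) c'(2)] lip_atlas_open[OF B c(3) c'(3)])
  fix z assume z: "z \<in> coords c ` (dom_chart c \<inter> dom_chart c')"
  then have z': "fst z \<in> coords a ` (dom_chart a \<inter> dom_chart a')" "snd z \<in> coords b ` (dom_chart b \<inter> dom_chart b')"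
    unfolding im by auto
  have "lips_at (transition a a') (fst z)" "lips_at (transition b b') (snd z)"
    using A B c c' z' unfolding lip_atlas_def by blast+
  then have "lips_at (\<lambda>z. (transition a a' (fst z), transition b b' (snd z))) z"
    by (intro lips_at_Pair lips_at_compose[OF lips_at_fst] lips_at_compose[OF lips_at_snd])
  then show "lips_at (transition c c') z"
  proof (rule lips_at_cong[OF _ op z])
    fix y assume "y \<in> coords c ` (dom_chart c \<inter> dom_chart c')"
    then obtain w where w: "w \<in> dom_chart c" "w \<in> dom_chart c'" "y = coords c w" by blast
    have "transition c c' y = coords c' w"
      unfolding w(3) by (rule coord_expr_coords[OF injc w(1)])
    moreover have "transition a a' (fst y) = coords a' (fst w)" "transition b b' (snd y) = coords b' (snd w)"
      using w transition_coords[OF lip_atlas_inj[OF A c(2)]] transition_coords[OF lip_atlas_inj[OF B c(3)]]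
      unfolding c(1) prod_chart_def by (auto simp: mem_Times_iff)
    ultimately show "(transition a a' (fst y), transition b b' (snd y)) = transition c c' y"
      unfolding c'(1) prod_chart_def by (simp add: map_prod_def case_prod_beta)
  qed
qed

text \<open>This identifies the topology used for Lipschitz maps into \<open>M \<times> M\<close> with the product topology in which
  the neighborhood of the diagonal has to be open.\<close>

lemma chart_topology_prod_charts:
  assumes A: "lip_atlas A" and B: "lip_atlas B"
  shows "chart_topology (prod_charts A B) = prod_topology (chart_topology A) (chart_topology B)"
  unfolding topology_eq
proof (intro allI iffI)
  note P = lip_atlas_prod[OF A B]
  fix S
  {
    assume S: "openin (chart_topology (prod_charts A B)) S"
    show "openin (prod_topology (chart_topology A) (chart_topology B)) S"
      unfolding openin_prod_topology_alt
    proof (intro allI impI)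
      fix p q assume pq: "(p, q) \<in> S"
      obtain c where c: "c \<in> prod_charts A B" "(p, q) \<in> dom_chart c"
        using S pq unfolding openin_chart_topology[OF P] by blast
      then obtain a b where ab': "a \<in> A" "b \<in> B" "c = prod_chart a b"
        unfolding prod_charts_def by blast
      then have ab: "a \<in> A" "b \<in> B" "prod_chart a b \<in> prod_charts A B" "p \<in> dom_chart a" "q \<in> dom_chart b"
        using c by (auto simp: prod_chart_def)
      let ?c = "prod_chart a b"
      have op: "open (coords ?c ` (S \<inter> dom_chart ?c))"
        using S ab(3) unfolding openin_chart_topology[OF P] by blast
      have "(coords a p, coords b q) \<in> coords ?c ` (S \<inter> dom_chart ?c)"
        using pq ab unfolding prod_chart_def by (intro image_eqI[of _ _ "(p, q)"]) auto
      then obtain U V where UV: "open U" "open V" "coords a p \<in> U" "coords b q \<in> V"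
          "U \<times> V \<subseteq> coords ?c ` (S \<inter> dom_chart ?c)"
        using open_prod_elim[OF op] by (metis mem_Sigma_iff)
      let ?U = "{w \<in> dom_chart a. coords a w \<in> U}" and ?V = "{w \<in> dom_chart b. coords b w \<in> V}"
      have "?U \<times> ?V \<subseteq> S"
      proof
        fix w assume w: "w \<in> ?U \<times> ?V"
        then have wUV: "coords ?c w \<in> U \<times> V" and wd: "w \<in> dom_chart ?c"
          unfolding prod_chart_def by auto
        have "w \<in> S \<inter> dom_chart ?c"
          using iffD1[OF inj_on_image_mem_iff[OF lip_atlas_inj[OF P ab(3)] wd Int_lower2]
              subsetD[OF UV(5) wUV]] .
        then show "w \<in> S" by (rule IntD1)
      qed
      moreover have "openin (chart_topology A) ?U" "openin (chart_topology B) ?V"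
        using openin_chart_preimage[OF A ab(1) UV(1)] openin_chart_preimage[OF B ab(2) UV(2)] .
      ultimately show "\<exists>U V. openin (chart_topology A) U \<and> openin (chart_topology B) V \<and> p \<in> U \<and> q \<in> V \<and> U \<times> V \<subseteq> S"
        using ab UV by (intro exI[of _ ?U] exI[of _ ?V]) simp
    qed
  next
    assume S: "openin (prod_topology (chart_topology A) (chart_topology B)) S"
    show "openin (chart_topology (prod_charts A B)) S"
    proof (rule openin_chart_topology_local[OF P])
      fix w assume w: "w \<in> S"
      obtain U V where UV: "openin (chart_topology A) U" "openin (chart_topology B) V" "fst w \<in> U" "snd w \<in> V" "U \<times> V \<subseteq> S"
        using S w unfolding openin_prod_topology_alt by (metis prod.collapse)
      obtain a b where ab: "a \<in> A" "b \<in> B" "fst w \<in> dom_chart a" "snd w \<in> dom_chart b"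
        using UV unfolding openin_chart_topology[OF A] openin_chart_topology[OF B] by blast
      let ?c = "prod_chart a b"
      have c: "?c \<in> prod_charts A B" using ab unfolding prod_charts_def by blast
      have "open (coords a ` (U \<inter> dom_chart a) \<times> coords b ` (V \<inter> dom_chart b))"
        using UV ab unfolding openin_chart_topology[OF A] openin_chart_topology[OF B] by (intro open_Times) auto
      moreover have "coords ?c w \<in> coords a ` (U \<inter> dom_chart a) \<times> coords b ` (V \<inter> dom_chart b)"
        using UV ab unfolding prod_chart_def by (simp add: map_prod_def case_prod_beta)
      moreover have "coords a ` (U \<inter> dom_chart a) \<times> coords b ` (V \<inter> dom_chart b) \<subseteq> coords ?c ` (S \<inter> dom_chart ?c)"
      proof
        fix y assume "y \<in> coords a ` (U \<inter> dom_chart a) \<times> coords b ` (V \<inter> dom_chart b)"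
        then obtain p q where pq: "p \<in> U" "p \<in> dom_chart a" "q \<in> V" "q \<in> dom_chart b" "y = (coords a p, coords b q)" by blast
        then show "y \<in> coords ?c ` (S \<inter> dom_chart ?c)"
          using UV(5) unfolding prod_chart_def by (intro image_eqI[of _ _ "(p, q)"]) auto
      qed
      ultimately have "coords ?c w \<in> interior (coords ?c ` (S \<inter> dom_chart ?c))"
        by (intro interiorI)
      with c ab show "\<exists>c\<in>prod_charts A B. w \<in> dom_chart c \<and> coords c w \<in> interior (coords c ` (S \<inter> dom_chart c))"
        by (intro bexI[of _ ?c]) (auto simp: prod_chart_def mem_Times_iff)
    qed
  }
qed

text \<open>The charts of the tangent bundle and of a tangent space indexed by the chart of the manifold that
  induces them.\<close>

definition tchart :: "('p, real^'n) chart set \<Rightarrow> ('p, real^'n) chart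
    \<Rightarrow> (('p, 'n) tvec, (real^'n) \<times> (real^'n)) chart" where
  "tchart A a = ({v \<in> tangent_bundle A. base v \<in> dom_chart a}, \<lambda>v. (coords a (base v), components v a))"

definition fchart :: "('p, real^'n) chart set \<Rightarrow> 'p \<Rightarrow> ('p, real^'n) chart
    \<Rightarrow> (('p, 'n) tvec, real^'n) chart" where
  "fchart A p a = (tangent_space A p, \<lambda>v. components v a)"

lemma tangent_charts_eq: "tangent_charts A = tchart A ` A"
  unfolding tangent_charts_def tchart_def by blast

lemma fibre_charts_eq: "fibre_charts A p = fchart A p ` {a \<in> A. p \<in> dom_chart a}"
  unfolding fibre_charts_def fchart_def by blast

lemma dom_tchart: "v \<in> dom_chart (tchart A a) \<longleftrightarrow> v \<in> tangent_bundle A \<and> base v \<in> dom_chart a"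
  unfolding tchart_def by simp

lemma coords_tchart: "coords (tchart A a) v = (coords a (base v), components v a)"
  unfolding tchart_def by simp

locale manifold_C21 =
  fixes X :: "'p topology" and A :: "('p, real^'n) chart set"
  assumes manifold: "C21_manifold X A"
begin

lemma chart:
  assumes "a \<in> A"
  shows "openin X (dom_chart a)" "open (coords a ` dom_chart a)"
    "homeomorphic_map (subtopology X (dom_chart a)) (top_of_set (coords a ` dom_chart a)) (coords a)"
  using manifold assms unfolding C21_manifold_def is_chart_def by blast+

lemma topspace_eq: "topspace X = \<Union>(dom_chart ` A)"
  using manifold unfolding C21_manifold_def by blast

lemma topspace_chart: "a \<in> A \<Longrightarrow> topspace (subtopology X (dom_chart a)) = dom_chart a"
  by (intro topspace_subtopology_subset openin_subset chart)

lemma inj_coords: "a \<in> A \<Longrightarrow> inj_on (coords a) (dom_chart a)"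
  using homeomorphic_imp_injective_map[OF chart(3)] topspace_chart by metis

lemma open_coords_image:
  assumes a: "a \<in> A" and V: "openin X V"
  shows "open (coords a ` (V \<inter> dom_chart a))"
proof -
  have "openin (subtopology X (dom_chart a)) (V \<inter> dom_chart a)"
    using V unfolding openin_subtopology by blast
  then have "openin (top_of_set (coords a ` dom_chart a)) (coords a ` (V \<inter> dom_chart a))"
    using homeomorphic_imp_open_map[OF chart(3)[OF a]] unfolding open_map_def by blast
  then show ?thesis
    using chart(2)[OF a] openin_open_trans by blast
qed

lemma open_overlap: "a \<in> A \<Longrightarrow> b \<in> A \<Longrightarrow> open (coords a ` (dom_chart a \<inter> dom_chart b))"
  using open_coords_image[of a "dom_chart b"] chart(1)[of b] by (simp add: Int_commute)

lemma transition_C21: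
  assumes a: "a \<in> A" and b: "b \<in> A"
  obtains f' f'' where
    "\<And>x. x \<in> coords a ` (dom_chart a \<inter> dom_chart b) \<Longrightarrow> (transition a b has_derivative blinfun_apply (f' x)) (at x)"
    "\<And>x. x \<in> coords a ` (dom_chart a \<inter> dom_chart b) \<Longrightarrow> frechet_derivative (transition a b) (at x) = blinfun_apply (f' x)"
    "\<And>x. x \<in> coords a ` (dom_chart a \<inter> dom_chart b) \<Longrightarrow> (f' has_derivative blinfun_apply (f'' x)) (at x)"
    "\<And>x. x \<in> coords a ` (dom_chart a \<inter> dom_chart b) \<Longrightarrow> lips_at f' x"
    "\<And>x. x \<in> coords a ` (dom_chart a \<inter> dom_chart b) \<Longrightarrow> strong_at (transition a b) (blinfun_apply (f' x)) x"
proof -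
  have C: "C21_on (coords a ` (dom_chart a \<inter> dom_chart b)) (transition a b)"
    using manifold a b unfolding C21_manifold_def C21_compatible_def by blast
  show thesis by (rule C21_onD[OF C open_overlap[OF a b]]) (rule that)
qed

lemma transition_strong_at:
  assumes "a \<in> A" "b \<in> A" "x \<in> coords a ` (dom_chart a \<inter> dom_chart b)"
  shows "strong_at (transition a b) (frechet_derivative (transition a b) (at x)) x"
  by (rule transition_C21[OF assms(1,2)]) (use assms(3) in simp)

lemma transition_has_derivative:
  assumes "a \<in> A" "b \<in> A" "x \<in> coords a ` (dom_chart a \<inter> dom_chart b)"
  shows "(transition a b has_derivative frechet_derivative (transition a b) (at x)) (at x)"
  by (rule transition_C21[OF assms(1,2)]) (use assms(3) in simp)

lemma atlas: "lip_atlas A"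
  unfolding lip_atlas_def
proof (intro conjI ballI)
  fix a b x assume ab: "a \<in> A" "b \<in> A" "x \<in> coords a ` (dom_chart a \<inter> dom_chart b)"
  show "lips_at (transition a b) x" by (rule strong_at_lips_at[OF transition_strong_at[OF ab]])
qed (rule inj_coords open_overlap; assumption)+

lemma chart_topology_eq: "chart_topology A = X"
  unfolding topology_eq
proof (intro allI iffI)
  fix U assume U: "openin (chart_topology A) U"
  have "openin X (U \<inter> dom_chart a)" if a: "a \<in> A" for a
  proof -
    have op: "open (coords a ` (U \<inter> dom_chart a))"
      using U a unfolding openin_chart_topology[OF atlas] by blast
    have cont: "continuous_map (subtopology X (dom_chart a)) euclidean (coords a)"
      using homeomorphic_imp_continuous_map[OF chart(3)[OF a]] unfolding continuous_map_in_subtopology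
      by (rule conjunct1)
    note openin_continuous_map_preimage[OF cont iffD1[OF open_openin op]]
    then have "openin (subtopology X (dom_chart a)) {w \<in> dom_chart a. coords a w \<in> coords a ` (U \<inter> dom_chart a)}"
      by (simp only: topspace_chart[OF a])
    moreover have "{w \<in> dom_chart a. coords a w \<in> coords a ` (U \<inter> dom_chart a)} = U \<inter> dom_chart a"
      using inj_on_image_mem_iff[OF inj_coords[OF a] _ Int_lower2[of U]] by auto
    ultimately show ?thesis using openin_trans_full[OF _ chart(1)[OF a]] by simp
  qed
  then have "openin X (\<Union>a\<in>A. U \<inter> dom_chart a)" by (intro openin_Union) auto
  moreover have "U \<subseteq> \<Union>(dom_chart ` A)"
    using U unfolding openin_chart_topology[OF atlas] by (rule conjunct1)
  then have "(\<Union>a\<in>A. U \<inter> dom_chart a) = U" by auto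
  ultimately show "openin X U" by simp
next
  fix U assume U: "openin X U"
  show "openin (chart_topology A) U"
    unfolding openin_chart_topology[OF atlas]
  proof (intro conjI ballI)
    show "U \<subseteq> \<Union>(dom_chart ` A)" using openin_subset[OF U] unfolding topspace_eq .
  qed (rule open_coords_image[OF _ U])
qed

text \<open>The cocycle condition, by the chain rule. It makes the components of a tangent vector in different
  charts consistent.\<close>

lemma transition_chain:
  assumes abc: "a \<in> A" "b \<in> A" "c \<in> A" and p: "p \<in> dom_chart a" "p \<in> dom_chart b" "p \<in> dom_chart c"
  shows "frechet_derivative (transition b c) (at (coords b p)) (frechet_derivative (transition a b) (at (coords a p)) w)
    = frechet_derivative (transition a c) (at (coords a p)) w"
proof -
  let ?V = "coords a ` ((dom_chart b \<inter> dom_chart c) \<inter> dom_chart a)"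
  have tr: "transition a b (coords a q) = coords b q" if "q \<in> dom_chart a" for q
    by (rule coord_expr_coords[OF inj_coords[OF abc(1)] that])
  have d1: "(transition a b has_derivative frechet_derivative (transition a b) (at (coords a p))) (at (coords a p))"
    by (rule transition_has_derivative[OF abc(1,2)]) (use p in blast)
  have d2: "(transition b c has_derivative frechet_derivative (transition b c) (at (coords b p))) (at (transition a b (coords a p)))"
    unfolding tr[OF p(1)] by (rule transition_has_derivative[OF abc(2,3)]) (use p in blast)
  have "((\<lambda>x. transition b c (transition a b x)) has_derivative
      (\<lambda>w. frechet_derivative (transition b c) (at (coords b p)) (frechet_derivative (transition a b) (at (coords a p)) w)))
      (at (coords a p))"
    using diff_chain_at[OF d1 d2] by (simp add: o_def)
  then have "(transition a c has_derivative
      (\<lambda>w. frechet_derivative (transition b c) (at (coords b p)) (frechet_derivative (transition a b) (at (coords a p)) w)))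
      (at (coords a p))"
  proof (rule has_derivative_transform_within_open)
    show "open ?V" by (intro open_coords_image abc openin_Int chart(1))
    show "coords a p \<in> ?V" using p by blast
    fix x assume "x \<in> ?V"
    then obtain q where q: "q \<in> dom_chart a" "q \<in> dom_chart b" "q \<in> dom_chart c" "x = coords a q" by blast
    then show "transition b c (transition a b x) = transition a c x"
      by (simp add: coord_expr_coords[OF inj_coords] abc)
  qed
  from frechet_derivative_at[OF this] show ?thesis by metis
qed

lemma transition_self:
  assumes "a \<in> A" "p \<in> dom_chart a"
  shows "frechet_derivative (transition a a) (at (coords a p)) w = w"
proof -
  have "(transition a a has_derivative (\<lambda>w. w)) (at (coords a p))"
  proof (rule has_derivative_transform_within_open)
    show "((\<lambda>x. x) has_derivative (\<lambda>w. w)) (at (coords a p))" by (rule has_derivative_ident)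
    show "open (coords a ` dom_chart a)" using chart(2) assms by blast
    show "coords a p \<in> coords a ` dom_chart a" using assms by blast
    fix x assume "x \<in> coords a ` dom_chart a"
    then show "x = transition a a x" by (auto simp: coord_expr_coords[OF inj_coords[OF assms(1)]])
  qed
  from frechet_derivative_at[OF this] show ?thesis by metis
qed

lemma tangent_bundle_base: "v \<in> tangent_bundle A \<Longrightarrow> base v \<in> topspace X"
  unfolding tangent_bundle_def topspace_eq by blast

lemma tangent_bundle_chart:
  assumes "v \<in> tangent_bundle A"
  obtains a where "a \<in> A" "base v \<in> dom_chart a" "v \<in> dom_chart (tchart A a)"
  using tangent_bundle_base[OF assms] assms unfolding topspace_eq dom_tchart by blast

lemma tangent_components:
  "v \<in> tangent_bundle A \<Longrightarrow> a \<in> A \<Longrightarrow> b \<in> A \<Longrightarrow> base v \<in> dom_chart a \<Longrightarrow> base v \<in> dom_chart b \<Longrightarrow>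
    components v b = frechet_derivative (transition a b) (at (coords a (base v))) (components v a)"
  unfolding tangent_bundle_def by blast

lemma tangent_components_zero:
  "v \<in> tangent_bundle A \<Longrightarrow> a \<notin> A \<or> base v \<notin> dom_chart a \<Longrightarrow> components v a = 0"
  unfolding tangent_bundle_def by blast

text \<open>A tangent vector is determined by its components in a single chart.\<close>

lemma tangent_eqI:
  assumes v: "v \<in> tangent_bundle A" and w: "w \<in> tangent_bundle A" and a: "a \<in> A" "base v \<in> dom_chart a"
    and eq: "base v = base w" "components v a = components w a"
  shows "v = w"
proof (rule prod_eqI)
  show "components v = components w"
  proof
    fix b
    show "components v b = components w b"
    proof (cases "b \<in> A \<and> base v \<in> dom_chart b")
      case True
      then show ?thesis
        using tangent_components[OF v a(1), of b] tangent_components[OF w a(1), of b] a eq by simp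
    next
      case False
      then have "components v b = 0" "components w b = 0"
        using tangent_components_zero[OF v, of b] tangent_components_zero[OF w, of b] eq(1) by simp_all
      then show ?thesis by simp
    qed
  qed
qed (rule eq)

text \<open>Components may be prescribed in one chart; those in the other charts are then dictated by the
  Jacobian matrices, and \<open>transition_chain\<close> ensures that they are compatible with each other.\<close>

lemma tangent_exists:
  assumes a: "a \<in> A" and p: "p \<in> dom_chart a"
  shows "\<exists>v\<in>tangent_bundle A. base v = p \<and> components v a = w"
proof -
  define v :: "('p, 'n) tvec" where "v = (p, \<lambda>b. if b \<in> A \<and> p \<in> dom_chart b
      then frechet_derivative (transition a b) (at (coords a p)) w else 0)"
  have "v \<in> tangent_bundle A"
    unfolding tangent_bundle_def
  proof (intro CollectI conjI allI impI ballI)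
    fix b c assume "b \<in> A" "c \<in> A" "base v \<in> dom_chart b \<inter> dom_chart c"
    then show "components v c = frechet_derivative (transition b c) (at (coords b (base v))) (components v b)"
      using transition_chain[OF a _ _ p, of b c w] unfolding v_def by simp
  qed (use a p in \<open>auto simp: v_def\<close>)
  moreover have "base v = p" "components v a = w"
    unfolding v_def using a p transition_self by simp_all
  ultimately show ?thesis by blast
qed

lemma inj_tchart: "a \<in> A \<Longrightarrow> inj_on (coords (tchart A a)) (dom_chart (tchart A a))"
proof (rule inj_onI)
  fix v w assume a: "a \<in> A" and v: "v \<in> dom_chart (tchart A a)" and w: "w \<in> dom_chart (tchart A a)"
    and eq: "coords (tchart A a) v = coords (tchart A a) w"
  have "base v = base w"
    using inj_onD[OF inj_coords[OF a]] v w eq unfolding dom_tchart coords_tchart by blast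
  then show "v = w"
    using tangent_eqI[OF _ _ a] v w eq unfolding dom_tchart coords_tchart by blast
qed

lemma tchart_image:
  assumes a: "a \<in> A" and V: "V \<subseteq> dom_chart a"
  shows "coords (tchart A a) ` {v \<in> tangent_bundle A. base v \<in> V} = coords a ` V \<times> UNIV"
proof (rule equalityI; rule subsetI)
  fix z :: "(real^'n) \<times> (real^'n)" assume "z \<in> coords a ` V \<times> UNIV"
  then obtain p where p: "p \<in> V" "fst z = coords a p" by (cases z) auto
  then obtain v where "v \<in> tangent_bundle A" "base v = p" "components v a = snd z"
    using tangent_exists[OF a, of p "snd z"] V by blast
  then show "z \<in> coords (tchart A a) ` {v \<in> tangent_bundle A. base v \<in> V}"
    using p by (intro image_eqI[of _ _ v]) (auto simp: coords_tchart prod_eq_iff)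
qed (auto simp: coords_tchart)

lemma tchart_dom_image: "a \<in> A \<Longrightarrow> coords (tchart A a) ` dom_chart (tchart A a) = coords a ` dom_chart a \<times> UNIV"
  using tchart_image[of a "dom_chart a"] by (simp add: tchart_def)

lemma open_tchart_image: "a \<in> A \<Longrightarrow> open (coords (tchart A a) ` dom_chart (tchart A a))"
  unfolding tchart_dom_image by (intro open_Times chart(2)) auto

lemma tangent_atlas: "lip_atlas (tangent_charts A)"
  unfolding tangent_charts_eq
proof (rule lip_atlas_imageI)
  fix a b assume a: "a \<in> A" and b: "b \<in> A"
  let ?V = "coords a ` (dom_chart a \<inter> dom_chart b)"
  have "dom_chart (tchart A a) \<inter> dom_chart (tchart A b) = {v \<in> tangent_bundle A. base v \<in> dom_chart a \<inter> dom_chart b}"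
    by (auto simp: dom_tchart)
  then have im: "coords (tchart A a) ` (dom_chart (tchart A a) \<inter> dom_chart (tchart A b)) = ?V \<times> UNIV"
    using tchart_image[OF a, of "dom_chart a \<inter> dom_chart b"] by simp
  show op: "open (coords (tchart A a) ` (dom_chart (tchart A a) \<inter> dom_chart (tchart A b)))"
    unfolding im by (intro open_Times open_overlap a b) auto
  fix z assume z: "z \<in> coords (tchart A a) ` (dom_chart (tchart A a) \<inter> dom_chart (tchart A b))"
  then have fz: "fst z \<in> ?V" unfolding im by auto
  obtain f' f'' where f':
    "\<And>x. x \<in> ?V \<Longrightarrow> frechet_derivative (transition a b) (at x) = blinfun_apply (f' x)"
    "\<And>x. x \<in> ?V \<Longrightarrow> lips_at f' x"
    "\<And>x. x \<in> ?V \<Longrightarrow> strong_at (transition a b) (blinfun_apply (f' x)) x"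
    using transition_C21[OF a b] by metis
  have "lips_at (\<lambda>z. (transition a b (fst z), blinfun_apply (f' (fst z)) (snd z))) z"
    by (intro lips_at_Pair lips_at_blinfun_apply lips_at_snd
        lips_at_compose[OF lips_at_fst strong_at_lips_at[OF f'(3)[OF fz]]] lips_at_compose[OF lips_at_fst f'(2)[OF fz]])
  then show "lips_at (transition (tchart A a) (tchart A b)) z"
  proof (rule lips_at_cong[OF _ op z])
    fix y assume "y \<in> coords (tchart A a) ` (dom_chart (tchart A a) \<inter> dom_chart (tchart A b))"
    then obtain v where v: "v \<in> dom_chart (tchart A a)" "v \<in> dom_chart (tchart A b)" "y = coords (tchart A a) v"
      by blast
    have "transition (tchart A a) (tchart A b) y = coords (tchart A b) v"
      unfolding v(3) by (rule coord_expr_coords[OF inj_tchart[OF a] v(1)])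
    moreover have "coords b (base v) = transition a b (coords a (base v))"
      using transition_coords[OF inj_coords[OF a]] v by (simp add: dom_tchart)
    moreover have "components v b = blinfun_apply (f' (coords a (base v))) (components v a)"
      using tangent_components[of v a b] v a b f'(1)[of "coords a (base v)"] by (simp add: dom_tchart)
    ultimately show "(transition a b (fst y), blinfun_apply (f' (fst y)) (snd y)) = transition (tchart A a) (tchart A b) y"
      unfolding v(3) coords_tchart by simp
  qed
qed (use inj_tchart in blast)

lemma fchart_image:
  assumes a: "a \<in> A" and p: "p \<in> dom_chart a"
  shows "coords (fchart A p a) ` dom_chart (fchart A p a) = UNIV"
proof -
  have "w \<in> (\<lambda>v. components v a) ` tangent_space A p" for w
    using tangent_exists[OF a p, of w] unfolding tangent_space_def by blast
  then show ?thesis unfolding fchart_def by auto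
qed

lemma inj_fchart:
  assumes a: "a \<in> A" and p: "p \<in> dom_chart a"
  shows "inj_on (coords (fchart A p a)) (dom_chart (fchart A p a))"
  unfolding fchart_def using tangent_eqI[OF _ _ a] p
  by (auto intro!: inj_onI simp: tangent_space_def)

lemma fibre_atlas: "lip_atlas (fibre_charts A p)"
  unfolding fibre_charts_eq
proof (rule lip_atlas_imageI)
  fix a assume "a \<in> {a \<in> A. p \<in> dom_chart a}"
  then have a: "a \<in> A" "p \<in> dom_chart a" by auto
  show inj: "inj_on (coords (fchart A p a)) (dom_chart (fchart A p a))" by (rule inj_fchart[OF a])
  fix b assume "b \<in> {a \<in> A. p \<in> dom_chart a}"
  then have b: "b \<in> A" "p \<in> dom_chart b" by auto
  have "dom_chart (fchart A p a) \<inter> dom_chart (fchart A p b) = dom_chart (fchart A p a)"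
    unfolding fchart_def by simp
  then show "open (coords (fchart A p a) ` (dom_chart (fchart A p a) \<inter> dom_chart (fchart A p b)))"
    using fchart_image[OF a] by simp
  fix w
  have tr: "frechet_derivative (transition a b) (at (coords a p)) w = transition (fchart A p a) (fchart A p b) w" for w
  proof -
    have "w \<in> coords (fchart A p a) ` dom_chart (fchart A p a)" using fchart_image[OF a] by simp
    then obtain v where v: "v \<in> dom_chart (fchart A p a)" "w = coords (fchart A p a) v" by blast
    have "transition (fchart A p a) (fchart A p b) w = coords (fchart A p b) v"
      unfolding v(2) by (rule coord_expr_coords[OF inj v(1)])
    then show ?thesis
      using tangent_components[of v a b] v a b unfolding fchart_def tangent_space_def by simp
  qed
  have "bounded_linear (frechet_derivative (transition a b) (at (coords a p)))"
    using transition_strong_at[OF a(1) b(1)] a b unfolding strong_at_def by blast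
  then have "lips_at (frechet_derivative (transition a b) (at (coords a p))) w"
    by (rule lips_at_bounded_linear)
  then show "lips_at (transition (fchart A p a) (fchart A p b)) w"
    by (rule lips_at_cong[OF _ open_UNIV UNIV_I]) (rule tr)
qed

lemma zero_tvec_mem: "p \<in> topspace X \<Longrightarrow> zero_tvec p \<in> tangent_bundle A"
proof -
  assume p: "p \<in> topspace X"
  have "frechet_derivative (transition a b) (at (coords a p)) 0 = 0"
    if "a \<in> A" "b \<in> A" "p \<in> dom_chart a \<inter> dom_chart b" for a b
    using transition_has_derivative[OF that(1,2), of "coords a p"] that has_derivative_linear linear_0 by blast
  then show ?thesis
    using p unfolding tangent_bundle_def zero_tvec_def topspace_eq by auto
qed

lemma scale_tvec_mem:
  assumes "v \<in> tangent_bundle A"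
  shows "scale_tvec s v \<in> tangent_bundle A"
proof -
  have "s *\<^sub>R components v b = frechet_derivative (transition a b) (at (coords a (base v))) (s *\<^sub>R components v a)"
    if "a \<in> A" "b \<in> A" "base v \<in> dom_chart a \<inter> dom_chart b" for a b
  proof -
    have "linear (frechet_derivative (transition a b) (at (coords a (base v))))"
      using transition_has_derivative[OF that(1,2), of "coords a (base v)"] that has_derivative_linear by blast
    then show ?thesis
      using tangent_components[OF assms that(1,2)] that(3) by (simp add: linear_scale)
  qed
  moreover have "s *\<^sub>R components v a = 0" if "a \<notin> A \<or> base v \<notin> dom_chart a" for a
    using tangent_components_zero[OF assms that] by simp
  moreover have "base v \<in> \<Union>(dom_chart ` A)"
    using assms unfolding tangent_bundle_def by blast
  ultimately show ?thesis
    unfolding tangent_bundle_def scale_tvec_def mem_Collect_eq fst_conv snd_conv by blast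
qed

end

section \<open>Solutions of the geodesic equation\<close>

lemma has_vector_derivative_Pair_iff:
  "((\<lambda>s. (f s, g s)) has_vector_derivative (f', g')) (at t) \<longleftrightarrow>
    (f has_vector_derivative f') (at t) \<and> (g has_vector_derivative g') (at t)"
proof
  assume *: "((\<lambda>s. (f s, g s)) has_vector_derivative (f', g')) (at t)"
  show "(f has_vector_derivative f') (at t) \<and> (g has_vector_derivative g') (at t)"
    using bounded_linear.has_vector_derivative[OF bounded_linear_fst *]
      bounded_linear.has_vector_derivative[OF bounded_linear_snd *] by simp
next
  assume *: "(f has_vector_derivative f') (at t) \<and> (g has_vector_derivative g') (at t)"
  show "((\<lambda>s. (f s, g s)) has_vector_derivative (f', g')) (at t)"
    using has_derivative_Pair[OF conjunct1[OF *, unfolded has_vector_derivative_def]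
        conjunct2[OF *, unfolded has_vector_derivative_def]]
    unfolding has_vector_derivative_def by simp
qed

lemma continuous_map_open_interval_iff:
  fixes I :: "real set"
  assumes "open I"
  shows "continuous_map (top_of_set I) X g \<longleftrightarrow>
    g ` I \<subseteq> topspace X \<and> (\<forall>V. openin X V \<longrightarrow> open {t \<in> I. g t \<in> V})"
proof -
  have "openin (top_of_set I) {t \<in> I. g t \<in> V} \<longleftrightarrow> open {t \<in> I. g t \<in> V}" for V
    using openin_open_eq[OF assms, of "{t \<in> I. g t \<in> V}"] by auto
  then show ?thesis unfolding continuous_map_def by auto
qed

locale spray_manifold = manifold_C21 X A for X :: "'p topology" and A :: "('p, real^'n) chart set" +
  fixes H :: "('p, 'n) spray"
  assumes spray: "locally_lipschitz_spray A H"
begin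

text \<open>The right-hand side of the first-order system in the tangent chart induced by \<open>a\<close>.\<close>

definition rhs :: "('p, real^'n) chart \<Rightarrow> (real^'n) \<times> (real^'n) \<Rightarrow> (real^'n) \<times> (real^'n)" where
  "rhs a z = (snd z, H a (fst z) (snd z))"

abbreviation solution :: "real set \<Rightarrow> (real \<Rightarrow> ('p, 'n) tvec) \<Rightarrow> bool" where
  "solution \<equiv> spray_solution X A H"

lemma lips_at_spray:
  assumes "a \<in> A" "z \<in> coords a ` dom_chart a \<times> UNIV"
  shows "lips_at (\<lambda>z. H a (fst z) (snd z)) z"
proof -
  have "locally_lipschitz_on (coords a ` dom_chart a \<times> UNIV) (\<lambda>(x, v). H a x v)"
    using spray assms(1) unfolding locally_lipschitz_spray_def by blast
  moreover have "open (coords a ` dom_chart a \<times> (UNIV :: (real^'n) set))"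
    by (intro open_Times chart(2) assms) simp
  ultimately have "lips_at (\<lambda>(x, v). H a x v) z"
    using assms(2) by (rule locally_lipschitz_on_imp_lips_at)
  then show ?thesis by (simp add: case_prod_beta')
qed

lemma lips_at_rhs:
  assumes "a \<in> A" "z \<in> coords a ` dom_chart a \<times> UNIV"
  shows "lips_at (rhs a) z"
  unfolding rhs_def[abs_def] by (intro lips_at_Pair lips_at_snd lips_at_spray assms)

lemma spray_homogeneous:
  assumes "a \<in> A" "x \<in> coords a ` dom_chart a" "s > 0"
  shows "H a x (s *\<^sub>R v) = s\<^sup>2 *\<^sub>R H a x v"
  using spray assms unfolding locally_lipschitz_spray_def by blast

lemma spray_transformation:
  assumes "a \<in> A" "b \<in> A" "x \<in> coords a ` (dom_chart a \<inter> dom_chart b)"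
  shows "H b (transition a b x) (frechet_derivative (transition a b) (at x) v) =
    frechet_derivative (\<lambda>y. frechet_derivative (transition a b) (at y) v) (at x) v +
    frechet_derivative (transition a b) (at x) (H a x v)"
  using spray assms unfolding locally_lipschitz_spray_def Let_def by blast

lemma solution_iff:
  "solution I c \<longleftrightarrow> is_interval I \<and> open I \<and> c ` I \<subseteq> tangent_bundle A \<and>
     (\<forall>V. openin X V \<longrightarrow> open {t \<in> I. base (c t) \<in> V}) \<and>
     (\<forall>t\<in>I. \<forall>a\<in>A. base (c t) \<in> dom_chart a \<longrightarrow>
       ((\<lambda>s. coords (tchart A a) (c s)) has_vector_derivative rhs a (coords (tchart A a) (c t))) (at t))"
proof (cases "open I \<and> c ` I \<subseteq> tangent_bundle A")
  case True
  then have "(\<lambda>t. base (c t)) ` I \<subseteq> topspace X" using tangent_bundle_base by blast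
  then show ?thesis
    using True
    unfolding spray_solution_def coords_tchart rhs_def fst_conv snd_conv has_vector_derivative_Pair_iff
      continuous_map_open_interval_iff[OF conjunct1[OF True]] by blast
next
  case False
  then show ?thesis unfolding spray_solution_def by blast
qed

lemma solutionD:
  assumes "solution I c"
  shows "is_interval I" "open I" "\<And>t. t \<in> I \<Longrightarrow> c t \<in> tangent_bundle A"
    "\<And>V. openin X V \<Longrightarrow> open {t \<in> I. base (c t) \<in> V}"
    "\<And>t a. t \<in> I \<Longrightarrow> a \<in> A \<Longrightarrow> base (c t) \<in> dom_chart a \<Longrightarrow>
       ((\<lambda>s. coords (tchart A a) (c s)) has_vector_derivative rhs a (coords (tchart A a) (c t))) (at t)"
  using assms unfolding solution_iff by blast+

lemma point_at_tchart:
  assumes "a \<in> A" "z \<in> coords a ` dom_chart a \<times> UNIV"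
  shows "point_at (tchart A a) z \<in> dom_chart (tchart A a)" "coords (tchart A a) (point_at (tchart A a) z) = z"
proof -
  have z: "z \<in> coords (tchart A a) ` dom_chart (tchart A a)"
    using assms(2) unfolding tchart_dom_image[OF assms(1)] .
  show "point_at (tchart A a) z \<in> dom_chart (tchart A a)" by (rule inv_into_into[OF z])
  show "coords (tchart A a) (point_at (tchart A a) z) = z" by (rule f_inv_into_f[OF z])
qed

text \<open>A solution of the system in one chart satisfies it in every other chart \<open>b\<close>: differentiating
  \<open>(\<tau> x, D\<tau>(x) v)\<close> along the curve gives \<open>(D\<tau>(x) v, D\<^sup>2\<tau>(x)(v, v) + D\<tau>(x) H\<^sub>a(x, v))\<close>, and the second
  component is \<open>H\<^sub>b\<close> by the transformation law of the spray.\<close>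

lemma solution_from_chart:
  assumes a: "a \<in> A" and I: "is_interval I" "open I"
    and z: "\<And>t. t \<in> I \<Longrightarrow> z t \<in> coords a ` dom_chart a \<times> UNIV"
    and dz: "\<And>t. t \<in> I \<Longrightarrow> (z has_vector_derivative rhs a (z t)) (at t)"
  shows "solution I (\<lambda>t. point_at (tchart A a) (z t))"
proof -
  define c where "c t = point_at (tchart A a) (z t)" for t
  have c: "c t \<in> tangent_bundle A" "base (c t) \<in> dom_chart a" "coords (tchart A a) (c t) = z t" if "t \<in> I" for t
    using point_at_tchart[OF a z[OF that]] unfolding c_def dom_tchart by blast+
  have fz: "coords a (base (c t)) = fst (z t)" "components (c t) a = snd (z t)" if "t \<in> I" for t
    using c(3)[OF that] unfolding coords_tchart by (metis fst_conv, metis snd_conv)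
  have cont: "continuous_on I (\<lambda>t. fst (z t))"
    using has_vector_derivative_continuous[OF dz]
    by (intro continuous_on_fst continuous_at_imp_continuous_on ballI)
  have pre: "open {t \<in> I. base (c t) \<in> V}" if V: "openin X V" for V
  proof -
    have "open (I \<inter> (\<lambda>t. fst (z t)) -` (coords a ` (V \<inter> dom_chart a)))"
      by (rule continuous_open_preimage[OF cont I(2) open_coords_image[OF a V]])
    moreover have "base (c t) \<in> V \<longleftrightarrow> fst (z t) \<in> coords a ` (V \<inter> dom_chart a)" if "t \<in> I" for t
      unfolding fz(1)[OF that, symmetric]
      using inj_on_image_mem_iff[OF inj_coords[OF a] c(2)[OF that] Int_lower2[of V]] c(2)[OF that] by simp
    then have "{t \<in> I. base (c t) \<in> V} = I \<inter> (\<lambda>t. fst (z t)) -` (coords a ` (V \<inter> dom_chart a))" by auto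
    ultimately show ?thesis by simp
  qed
  have der: "((\<lambda>s. coords (tchart A b) (c s)) has_vector_derivative rhs b (coords (tchart A b) (c t))) (at t)"
    if t: "t \<in> I" and b: "b \<in> A" "base (c t) \<in> dom_chart b" for t b
  proof -
    let ?\<tau> = "transition a b" and ?V = "coords a ` (dom_chart a \<inter> dom_chart b)"
    obtain f' f'' where f':
      "\<And>x. x \<in> ?V \<Longrightarrow> (?\<tau> has_derivative blinfun_apply (f' x)) (at x)"
      "\<And>x. x \<in> ?V \<Longrightarrow> frechet_derivative ?\<tau> (at x) = blinfun_apply (f' x)"
      "\<And>x. x \<in> ?V \<Longrightarrow> (f' has_derivative blinfun_apply (f'' x)) (at x)"
      by (rule transition_C21[OF a b(1)]) (rule that)
    define x where "x = fst (z t)"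
    define v where "v = snd (z t)"
    have xV: "x \<in> ?V" unfolding x_def fz(1)[OF t, symmetric] using c(2)[OF t] b(2) by blast
    have dx: "((\<lambda>s. fst (z s)) has_vector_derivative v) (at t)"
      using bounded_linear.has_vector_derivative[OF bounded_linear_fst dz[OF t]]
      unfolding rhs_def v_def by simp
    have dv: "((\<lambda>s. snd (z s)) has_vector_derivative H a x v) (at t)"
      using bounded_linear.has_vector_derivative[OF bounded_linear_snd dz[OF t]]
      unfolding rhs_def v_def x_def by simp
    let ?O = "{s \<in> I. base (c s) \<in> dom_chart b}"
    have O: "open ?O" by (rule pre[OF chart(1)[OF b(1)]])
    have eq: "coords b (base (c s)) = ?\<tau> (fst (z s))"
        "components (c s) b = blinfun_apply (f' (fst (z s))) (snd (z s))" if s: "s \<in> ?O" for s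
    proof -
      have sI: "s \<in> I" and sb: "base (c s) \<in> dom_chart b" using s by auto
      show "coords b (base (c s)) = ?\<tau> (fst (z s))"
        unfolding fz(1)[OF sI, symmetric] by (rule transition_coords[OF inj_coords[OF a] c(2)[OF sI], symmetric])
      have "fst (z s) \<in> ?V" unfolding fz(1)[OF sI, symmetric] using c(2)[OF sI] sb by blast
      then show "components (c s) b = blinfun_apply (f' (fst (z s))) (snd (z s))"
        using tangent_components[OF c(1)[OF sI] a b(1) c(2)[OF sI] sb] f'(2) unfolding fz[OF sI] by simp
    qed
    have "((?\<tau> \<circ> (\<lambda>s. fst (z s))) has_vector_derivative blinfun_apply (f' x) v) (at t)"
      using vector_derivative_diff_chain_within[of _ _ t UNIV, OF dx] f'(1)[OF xV] has_derivative_at_withinI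
      unfolding x_def by blast
    moreover have "((\<lambda>s. blinfun_apply (f' (fst (z s))) (snd (z s))) has_vector_derivative
        H b (?\<tau> x) (blinfun_apply (f' x) v)) (at t)"
    proof -
      have "((f' \<circ> (\<lambda>s. fst (z s))) has_vector_derivative blinfun_apply (f'' x) v) (at t)"
        using vector_derivative_diff_chain_within[of _ _ t UNIV, OF dx] f'(3)[OF xV] has_derivative_at_withinI
        unfolding x_def by blast
      from bounded_bilinear.has_vector_derivative[OF bounded_bilinear_blinfun_apply this dv]
      have "((\<lambda>s. blinfun_apply (f' (fst (z s))) (snd (z s))) has_vector_derivative
          blinfun_apply (f' x) (H a x v) + blinfun_apply (blinfun_apply (f'' x) v) v) (at t)"
        unfolding o_def x_def v_def .
      moreover have "((\<lambda>y. frechet_derivative ?\<tau> (at y) v) has_derivative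
          (\<lambda>h. blinfun_apply (blinfun_apply (f'' x) h) v)) (at x)"
      proof (rule has_derivative_transform_within_open)
        show "((\<lambda>y. blinfun_apply (f' y) v) has_derivative (\<lambda>h. blinfun_apply (blinfun_apply (f'' x) h) v)) (at x)"
          by (rule bounded_linear.has_derivative[OF blinfun.bounded_linear_left f'(3)[OF xV]])
        show "blinfun_apply (f' y) v = frechet_derivative ?\<tau> (at y) v" if "y \<in> ?V" for y
          using f'(2)[OF that] by simp
      qed (use xV open_overlap[OF a b(1)] in auto)
      from frechet_derivative_at[OF this, symmetric]
      have "frechet_derivative (\<lambda>y. frechet_derivative ?\<tau> (at y) v) (at x) v = blinfun_apply (blinfun_apply (f'' x) v) v"
        by simp
      then have "H b (?\<tau> x) (blinfun_apply (f' x) v)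
          = blinfun_apply (blinfun_apply (f'' x) v) v + blinfun_apply (f' x) (H a x v)"
        using spray_transformation[OF a b(1) xV, of v] unfolding f'(2)[OF xV] by simp
      ultimately show ?thesis by (simp add: add.commute)
    qed
    ultimately have "((\<lambda>s. (?\<tau> (fst (z s)), blinfun_apply (f' (fst (z s))) (snd (z s)))) has_vector_derivative
        (blinfun_apply (f' x) v, H b (?\<tau> x) (blinfun_apply (f' x) v))) (at t)"
      unfolding has_vector_derivative_Pair_iff o_def by blast
    moreover have "rhs b (coords (tchart A b) (c t)) = (blinfun_apply (f' x) v, H b (?\<tau> x) (blinfun_apply (f' x) v))"
      unfolding rhs_def coords_tchart x_def v_def using eq[of t] t b(2) by simp
    ultimately have "((\<lambda>s. (?\<tau> (fst (z s)), blinfun_apply (f' (fst (z s))) (snd (z s)))) has_vector_derivative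
        rhs b (coords (tchart A b) (c t))) (at t)" by simp
    then show ?thesis
    proof (rule has_vector_derivative_transform_within_open[OF _ O])
      show "t \<in> ?O" using t b(2) by simp
      show "(?\<tau> (fst (z s)), blinfun_apply (f' (fst (z s))) (snd (z s))) = coords (tchart A b) (c s)"
        if "s \<in> ?O" for s
        unfolding coords_tchart using eq[OF that] by simp
    qed
  qed
  have "c ` I \<subseteq> tangent_bundle A" using c(1) by blast
  then have "solution I c" unfolding solution_iff using I pre der by blast
  then show ?thesis unfolding c_def[abs_def] .
qed

lemma solution_chart_continuous:
  assumes "solution I c" "t \<in> I" "a \<in> A" "base (c t) \<in> dom_chart a"
  shows "isCont (\<lambda>s. coords (tchart A a) (c s)) t"
  using solutionD(5)[OF assms] has_vector_derivative_continuous by blast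

text \<open>The set of times at which two solutions agree is open and closed. Where the base points differ they
  are separated by the Hausdorff property, where only the components differ by continuity in a chart,
  and near a time of agreement Gronwall's inequality propagates agreement.\<close>

lemma solution_unique:
  assumes c: "solution I c" and d: "solution I d" and t: "t0 \<in> I" "t \<in> I" and eq: "c t0 = d t0"
  shows "c t = d t"
proof -
  have I: "is_interval I" "open I" using solutionD(1,2)[OF c] .
  have "connected I" using I(1) is_interval_connected by blast
  then show ?thesis
  proof (rule connected_induction_simple[where P = "\<lambda>t. c t = d t", OF _ t eq])
    fix s assume s: "s \<in> I"
    have goal: "\<exists>T. openin (top_of_set I) T \<and> s \<in> T \<and> (\<forall>x\<in>T. \<forall>y\<in>T. c x = d x \<longrightarrow> c y = d y)"
      if "open T" "s \<in> T" "T \<subseteq> I" "\<And>x y. x \<in> T \<Longrightarrow> y \<in> T \<Longrightarrow> c x = d x \<Longrightarrow> c y = d y" for T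
    proof (intro exI conjI ballI impI)
      show "openin (top_of_set I) T" using that(1,3) openin_open_eq[OF I(2)] by blast
      show "s \<in> T" by (rule that(2))
      show "c y = d y" if "x \<in> T" "y \<in> T" "c x = d x" for x y
        by (rule \<open>\<And>x y. x \<in> T \<Longrightarrow> y \<in> T \<Longrightarrow> c x = d x \<Longrightarrow> c y = d y\<close>[OF that])
    qed
    show "\<exists>T. openin (top_of_set I) T \<and> s \<in> T \<and> (\<forall>x\<in>T. \<forall>y\<in>T. c x = d x \<longrightarrow> c y = d y)"
    proof (cases "base (c s) = base (d s)")
      case False
      have "Hausdorff_space X"
        using manifold unfolding C21_manifold_def paracompact_space_def by blast
      then obtain U V where UV: "openin X U" "openin X V" "base (c s) \<in> U" "base (d s) \<in> V" "disjnt U V"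
        unfolding Hausdorff_space_def
        using False tangent_bundle_base solutionD(3)[OF c s] solutionD(3)[OF d s] by metis
      show ?thesis
      proof (rule goal)
        show "open ({t \<in> I. base (c t) \<in> U} \<inter> {t \<in> I. base (d t) \<in> V})"
          by (intro open_Int solutionD(4)[OF c] solutionD(4)[OF d] UV)
        show "c y = d y" if "x \<in> {t \<in> I. base (c t) \<in> U} \<inter> {t \<in> I. base (d t) \<in> V}" "c x = d x" for x y
          using that UV(5) unfolding disjnt_iff by auto
      qed (use UV s in auto)
    next
      case True
      obtain a where a: "a \<in> A" "base (c s) \<in> dom_chart a"
        using tangent_bundle_chart[OF solutionD(3)[OF c s]] by blast
      have a': "base (d s) \<in> dom_chart a" using a True by simp
      define z1 where "z1 t = coords (tchart A a) (c t)" for t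
      define z2 where "z2 t = coords (tchart A a) (d t)" for t
      define Q where "Q = {t \<in> I. base (c t) \<in> dom_chart a} \<inter> {t \<in> I. base (d t) \<in> dom_chart a}"
      have Q: "open Q" "s \<in> Q" "Q \<subseteq> I"
        unfolding Q_def using a a' s solutionD(4)[OF c chart(1)[OF a(1)]] solutionD(4)[OF d chart(1)[OF a(1)]] by auto
      have z_eq: "c t = d t \<longleftrightarrow> z1 t = z2 t" if "t \<in> Q" for t
      proof -
        have "c t \<in> dom_chart (tchart A a)" "d t \<in> dom_chart (tchart A a)"
          using that solutionD(3)[OF c] solutionD(3)[OF d] unfolding Q_def dom_tchart by auto
        then show ?thesis unfolding z1_def z2_def using inj_on_eq_iff[OF inj_tchart[OF a(1)]] by blast
      qed
      have der: "(z1 has_vector_derivative rhs a (z1 t)) (at t)" "(z2 has_vector_derivative rhs a (z2 t)) (at t)"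
        if "t \<in> Q" for t
        using that solutionD(5)[OF c _ a(1)] solutionD(5)[OF d _ a(1)]
        unfolding Q_def z1_def[abs_def] z2_def[abs_def] by auto
      have cont: "isCont z1 s" "isCont z2 s"
        using der[OF Q(2)] has_vector_derivative_continuous by blast+
      show ?thesis
      proof (cases "c s = d s")
        case False
        then have ne: "z1 s - z2 s \<in> - {0}" using z_eq[OF Q(2)] by simp
        have "\<forall>\<^sub>F t in nhds s. z1 t - z2 t \<in> - {0}"
          by (rule isCont_eventually_mem[where f = "\<lambda>t. z1 t - z2 t", OF continuous_diff[OF cont] _ ne]) auto
        then obtain R where R: "open R" "s \<in> R" "\<And>t. t \<in> R \<Longrightarrow> z1 t - z2 t \<in> - {0}"
          unfolding eventually_nhds by blast
        show ?thesis
        proof (rule goal)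
          show "open (R \<inter> Q)" using R(1) Q(1) by blast
          show "c y = d y" if "x \<in> R \<inter> Q" "c x = d x" for x y
            using that R(3)[of x] z_eq[of x] by simp
        qed (use R Q in auto)
      next
        case True
        then have zs: "z1 s = z2 s" using z_eq[OF Q(2)] by simp
        have "z1 s \<in> coords a ` dom_chart a \<times> UNIV" unfolding z1_def coords_tchart using a(2) by blast
        from lips_at_rhs[OF a(1) this]
        obtain S K where S: "open S" "z1 s \<in> S" "K-lipschitz_on S (rhs a)" unfolding lips_at_def by blast
        have "\<forall>\<^sub>F t in nhds s. z1 t \<in> S \<and> z2 t \<in> S \<and> t \<in> Q"
          using isCont_eventually_mem[OF cont(1) S(1,2)] isCont_eventually_mem[OF cont(2) S(1)] S(2) zs
            eventually_nhds_in_open[OF Q(1,2)] by (simp add: eventually_conj)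
        then obtain e where e: "e > 0" "\<And>t. dist t s < e \<Longrightarrow> z1 t \<in> S \<and> z2 t \<in> S \<and> t \<in> Q"
          unfolding eventually_nhds_metric by blast
        have T: "z1 t \<in> S" "z2 t \<in> S" "t \<in> Q" if "t \<in> ball s e" for t
          using e(2)[of t] that by (auto simp: dist_commute)
        show ?thesis
        proof (rule goal)
          fix x y assume xy: "x \<in> ball s e" "y \<in> ball s e" "c x = d x"
          have "norm (z1 y - z2 y) \<le> exp (K * \<bar>y - x\<bar>) * norm (z1 x - z2 x)"
          proof (rule gronwall[of "ball s e"])
            show "is_interval (ball s e)" by (simp add: is_interval_convex_1)
            show "norm (rhs a (z1 u) - rhs a (z2 u)) \<le> K * norm (z1 u - z2 u)" if "u \<in> ball s e" for u
              using lipschitz_onD[OF S(3) T(1,2)[OF that]] by (simp add: dist_norm)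
          qed (use xy der T in blast)+
          moreover have "z1 x = z2 x" using z_eq[OF T(3)[OF xy(1)]] xy(3) by simp
          ultimately have "z1 y = z2 y" by simp
          then show "c y = d y" using z_eq[OF T(3)[OF xy(2)]] by simp
        qed (use e(1) T(3) Q(3) in auto)
      qed
    qed
  qed
qed

lemma solution_subset:
  assumes "solution I c" "is_interval J" "open J" "J \<subseteq> I"
  shows "solution J c"
  unfolding solution_iff
proof (intro conjI allI impI ballI)
  fix V assume "openin X V"
  then have "open (J \<inter> {t \<in> I. base (c t) \<in> V})" using assms(3) solutionD(4)[OF assms(1)] by blast
  moreover have "J \<inter> {t \<in> I. base (c t) \<in> V} = {t \<in> J. base (c t) \<in> V}" using assms(4) by blast
  ultimately show "open {t \<in> J. base (c t) \<in> V}" by simp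
qed (use assms solutionD[OF assms(1)] in blast)+

lemma solution_shift:
  assumes c: "solution I c"
  shows "solution {t. t - s \<in> I} (\<lambda>t. c (t - s))"
  unfolding solution_iff
proof (intro conjI allI impI ballI)
  show "is_interval {t. t - s \<in> I}"
    unfolding is_interval_1
  proof (intro ballI allI impI)
    fix x y u assume "x \<in> {t. t - s \<in> I}" "y \<in> {t. t - s \<in> I}" "x \<le> u \<and> u \<le> y"
    then have "x - s \<in> I" "y - s \<in> I" "x - s \<le> u - s" "u - s \<le> y - s" by auto
    then show "u \<in> {t. t - s \<in> I}" using solutionD(1)[OF c] unfolding is_interval_1 by blast
  qed
  have op: "open {t. t - s \<in> U}" if "open U" for U :: "real set"
    using open_vimage[OF that, of "\<lambda>t. t - s"] by (simp add: vimage_def continuous_intros)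
  show "open {t. t - s \<in> I}" by (rule op[OF solutionD(2)[OF c]])
  show "open {t \<in> {t. t - s \<in> I}. base (c (t - s)) \<in> V}" if "openin X V" for V
    using op[OF solutionD(4)[OF c that]] by simp
  show "(\<lambda>t. c (t - s)) ` {t. t - s \<in> I} \<subseteq> tangent_bundle A" using solutionD(3)[OF c] by blast
  fix t a assume t: "t \<in> {t. t - s \<in> I}" and a: "a \<in> A" "base (c (t - s)) \<in> dom_chart a"
  have "((\<lambda>t. t - s) has_vector_derivative 1) (at t)"
    by (auto intro!: derivative_eq_intros)
  moreover have "((\<lambda>u. coords (tchart A a) (c u)) has_vector_derivative rhs a (coords (tchart A a) (c (t - s)))) (at (t - s))"
    using solutionD(5)[OF c _ a] t by simp
  ultimately show "((\<lambda>u. coords (tchart A a) (c (u - s))) has_vector_derivative rhs a (coords (tchart A a) (c (t - s)))) (at t)"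
    using vector_diff_chain_at[of "\<lambda>t. t - s" 1 t "\<lambda>u. coords (tchart A a) (c u)"] by (simp add: o_def)
qed

lemma solution_union:
  assumes c: "solution I c" and d: "solution J d" and s: "s \<in> I" "s \<in> J" "c s = d s"
  obtains e where "solution (I \<union> J) e" "\<And>t. t \<in> I \<Longrightarrow> e t = c t" "\<And>t. t \<in> J \<Longrightarrow> e t = d t"
proof -
  define e where "e t = (if t \<in> I then c t else d t)" for t
  have IJ: "is_interval (I \<inter> J)" "open (I \<inter> J)"
    using solutionD(1,2)[OF c] solutionD(1,2)[OF d] is_interval_Int by auto
  have agree: "c t = d t" if "t \<in> I" "t \<in> J" for t
    using solution_unique[OF solution_subset[OF c IJ] solution_subset[OF d IJ], of s t] s that by blast
  have eI: "e t = c t" if "t \<in> I" for t unfolding e_def using that by simp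
  have eJ: "e t = d t" if "t \<in> J" for t unfolding e_def using that agree by simp
  have "solution (I \<union> J) e"
    unfolding solution_iff
  proof (intro conjI allI impI ballI)
    show "is_interval (I \<union> J)"
      unfolding is_interval_connected_1
      using solutionD(1)[OF c] solutionD(1)[OF d] s by (intro connected_Un) (auto simp: is_interval_connected_1)
    show "open (I \<union> J)" using solutionD(2)[OF c] solutionD(2)[OF d] by blast
    show "e ` (I \<union> J) \<subseteq> tangent_bundle A"
      using solutionD(3)[OF c] solutionD(3)[OF d] eI eJ by auto
    show "open {t \<in> I \<union> J. base (e t) \<in> V}" if V: "openin X V" for V
    proof -
      have "{t \<in> I \<union> J. base (e t) \<in> V} = {t \<in> I. base (c t) \<in> V} \<union> {t \<in> J. base (d t) \<in> V}"
        using eI eJ by auto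
      then show ?thesis using solutionD(4)[OF c V] solutionD(4)[OF d V] by (simp add: open_Un)
    qed
    fix t a assume t: "t \<in> I \<union> J" and a: "a \<in> A" "base (e t) \<in> dom_chart a"
    have "((\<lambda>s. coords (tchart A a) (e s)) has_vector_derivative rhs a (coords (tchart A a) (e t))) (at t)"
      if f: "solution K f" "t \<in> K" and ef: "\<And>u. u \<in> K \<Longrightarrow> e u = f u" for K f
    proof -
      have "((\<lambda>s. coords (tchart A a) (f s)) has_vector_derivative rhs a (coords (tchart A a) (f t))) (at t)"
        using solutionD(5)[OF f a(1)] a(2) ef[OF f(2)] by simp
      then show ?thesis
        unfolding ef[OF f(2)]
        by (rule has_vector_derivative_transform_within_open[OF _ solutionD(2)[OF f(1)] f(2)]) (simp add: ef)
    qed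
    then show "((\<lambda>s. coords (tchart A a) (e s)) has_vector_derivative rhs a (coords (tchart A a) (e t))) (at t)"
      using t c d eI eJ by blast
  qed
  with eI eJ that show thesis by blast
qed

text \<open>The solution with initial vector \<open>v\<close> exists at least up to time \<open>t\<close>, which may be negative.\<close>

definition reaches :: "('p, 'n) tvec \<Rightarrow> real \<Rightarrow> bool" where
  "reaches v t \<longleftrightarrow> (\<exists>I c. 0 \<in> I \<and> t \<in> I \<and> solution I c \<and> c 0 = v)"

text \<open>The velocity at time \<open>t\<close> of the geodesic with initial velocity \<open>v\<close>. Unlike geodesics, the flow can
  be composed, and its Lipschitz continuity can be propagated in time.\<close>

definition flow :: "('p, 'n) tvec \<Rightarrow> real \<Rightarrow> ('p, 'n) tvec" where
  "flow v t = (THE w. \<exists>I c. 0 \<in> I \<and> t \<in> I \<and> solution I c \<and> c 0 = v \<and> w = c t)"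

lemma solutions_agree:
  assumes "solution I c" "solution J d" "s \<in> I" "s \<in> J" "c s = d s" "t \<in> I" "t \<in> J"
  shows "c t = d t"
  using solution_union[OF assms(1-5)] assms(6,7) by metis

lemma flow_eq:
  assumes "solution I c" "0 \<in> I" "t \<in> I" "c 0 = v"
  shows "reaches v t" "flow v t = c t"
proof -
  show "reaches v t" unfolding reaches_def using assms by blast
  show "flow v t = c t"
    unfolding flow_def
  proof (rule the_equality)
    show "\<exists>I d. 0 \<in> I \<and> t \<in> I \<and> solution I d \<and> d 0 = v \<and> c t = d t" using assms by blast
    fix w assume "\<exists>I d. 0 \<in> I \<and> t \<in> I \<and> solution I d \<and> d 0 = v \<and> w = d t"
    then obtain J d where "0 \<in> J" "t \<in> J" "solution J d" "d 0 = v" "w = d t" by blast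
    then show "w = c t" using solutions_agree[of J d I c 0 t] assms by simp
  qed
qed

lemma geodesic_eq:
  assumes "reaches v t"
  shows "geodesic X A H v t = base (flow v t)"
proof -
  obtain I c where c: "0 \<in> I" "t \<in> I" "solution I c" "c 0 = v" using assms unfolding reaches_def by blast
  have "geodesic X A H v t = base (c t)"
    unfolding geodesic_def
  proof (rule the_equality)
    show "\<exists>I d. 0 \<in> I \<and> t \<in> I \<and> solution I d \<and> d 0 = v \<and> base (c t) = base (d t)" using c by blast
    fix q assume "\<exists>I d. 0 \<in> I \<and> t \<in> I \<and> solution I d \<and> d 0 = v \<and> q = base (d t)"
    then obtain J d where "0 \<in> J" "t \<in> J" "solution J d" "d 0 = v" "q = base (d t)" by blast
    then show "q = base (c t)" using solutions_agree[of J d I c 0 t] c by simp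
  qed
  then show ?thesis using flow_eq(2)[OF c(3,1,2,4)] by simp
qed

lemma exp_domain_iff: "v \<in> exp_domain X A H \<longleftrightarrow> v \<in> tangent_bundle A \<and> reaches v 1"
proof -
  have "{0..1} \<subseteq> geodesic_interval X A H v \<longleftrightarrow> reaches v 1"
  proof
    assume "{0..1} \<subseteq> geodesic_interval X A H v"
    then have "1 \<in> geodesic_interval X A H v" by auto
    then show "reaches v 1" unfolding geodesic_interval_def reaches_def by blast
  next
    assume "reaches v 1"
    then obtain I c where c: "0 \<in> I" "1 \<in> I" "solution I c" "c 0 = v" unfolding reaches_def by blast
    have "{0..1} \<subseteq> I"
      using solutionD(1)[OF c(3)] c(1,2) unfolding is_interval_1 by (meson atLeastAtMost_iff subsetI)
    then show "{0..1} \<subseteq> geodesic_interval X A H v" unfolding geodesic_interval_def using c by blast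
  qed
  then show ?thesis unfolding exp_domain_def by blast
qed

lemma exp_map_eq: "v \<in> exp_domain X A H \<Longrightarrow> exp_map X A H v = (base v, base (flow v 1))"
  unfolding exp_map_def using geodesic_eq[of v 1] exp_domain_iff by simp

lemma flow_mem: "reaches v t \<Longrightarrow> flow v t \<in> tangent_bundle A"
  unfolding reaches_def using flow_eq(2) solutionD(3) by metis

lemma flow_add:
  assumes "reaches v s" "reaches (flow v s) t"
  shows "reaches v (s + t)" "flow v (s + t) = flow (flow v s) t"
proof -
  obtain I c where c: "0 \<in> I" "s \<in> I" "solution I c" "c 0 = v" using assms(1) unfolding reaches_def by blast
  have fs: "flow v s = c s" by (rule flow_eq(2)[OF c(3,1,2,4)])
  obtain J d where d: "0 \<in> J" "t \<in> J" "solution J d" "d 0 = c s"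
    using assms(2) unfolding reaches_def fs by blast
  obtain e where e: "solution (I \<union> {u. u - s \<in> J}) e" "\<And>u. u \<in> I \<Longrightarrow> e u = c u"
      "\<And>u. u \<in> {u. u - s \<in> J} \<Longrightarrow> e u = d (u - s)"
    by (rule solution_union[OF c(3) solution_shift[OF d(3), of s], of s]) (use c d in auto)
  have e0: "e 0 = v" using e(2)[OF c(1)] c(4) by simp
  have mem: "0 \<in> I \<union> {u. u - s \<in> J}" "s + t \<in> I \<union> {u. u - s \<in> J}" using c(1) d(2) by auto
  show "reaches v (s + t)" by (rule flow_eq(1)[OF e(1) mem e0])
  have "flow v (s + t) = e (s + t)" by (rule flow_eq(2)[OF e(1) mem e0])
  also have "\<dots> = d t" using e(3)[of "s + t"] d(2) by simp
  also have "\<dots> = flow (flow v s) t" unfolding fs by (rule flow_eq(2)[OF d(3,1,2,4), symmetric])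
  finally show "flow v (s + t) = flow (flow v s) t" .
qed

end

section \<open>Lipschitz dependence of geodesics on initial data\<close>

lemma lip_in_Pair:
  assumes a: "inj_on (coords a) (dom_chart a)"
    and f: "lip_in a b W f w" and g: "lip_in a c W g w"
  shows "lip_in a (prod_chart b c) W (\<lambda>u. (f u, g u)) w"
proof -
  let ?P = "{u \<in> dom_chart a \<inter> W. f u \<in> dom_chart b}" and ?Q = "{u \<in> dom_chart a \<inter> W. g u \<in> dom_chart c}"
  have "coords a ` ?P \<inter> coords a ` ?Q = coords a ` (?P \<inter> ?Q)"
    by (rule inj_on_image_Int[OF a, symmetric]) auto
  moreover have "?P \<inter> ?Q = {u \<in> dom_chart a \<inter> W. (f u, g u) \<in> dom_chart (prod_chart b c)}"
    unfolding prod_chart_def by auto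
  moreover have "coords a w \<in> interior (coords a ` ?P \<inter> coords a ` ?Q)"
    unfolding interior_Int using f g unfolding lip_in_def by (intro IntI) (elim conjE, assumption)+
  ultimately have "coords a w \<in> interior (coords a ` {u \<in> dom_chart a \<inter> W. (f u, g u) \<in> dom_chart (prod_chart b c)})"
    by (simp only:)
  moreover have "coord_expr a (prod_chart b c) (\<lambda>u. (f u, g u)) = (\<lambda>y. (coord_expr a b f y, coord_expr a c g y))"
    unfolding coord_expr_def prod_chart_def by simp
  moreover have "lips_at (\<lambda>y. (coord_expr a b f y, coord_expr a c g y)) (coords a w)"
    using f g unfolding lip_in_def by (intro lips_at_Pair) blast+
  moreover have "(f w, g w) \<in> dom_chart (prod_chart b c)"
    using f g unfolding lip_in_def prod_chart_def by simp
  ultimately show ?thesis using f unfolding lip_in_def by (simp only:)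
qed

lemma locally_lipschitz_map_Pair:
  assumes A: "lip_atlas A" and B: "lip_atlas B" and C: "lip_atlas C"
    and f: "locally_lipschitz_map A B W f" and g: "locally_lipschitz_map A C W g"
  shows "locally_lipschitz_map A (prod_charts B C) W (\<lambda>u. (f u, g u))"
proof (rule locally_lipschitz_mapI[OF A lip_atlas_prod[OF B C]])
  fix w assume w: "w \<in> W"
  obtain a b where ab: "a \<in> A" "b \<in> B" "lip_in a b W f w" by (rule locally_lipschitz_mapD[OF f w])
  obtain a' c where ac: "a' \<in> A" "c \<in> C" "lip_in a' c W g w" by (rule locally_lipschitz_mapD[OF g w])
  have "w \<in> dom_chart a" "g w \<in> dom_chart c" using ab ac unfolding lip_in_def by blast+
  then have "lip_in a c W g w" by (rule lip_in_change_charts[OF A C ac(1) ab(1) ac(2) ac(2) ac(3)])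
  from lip_in_Pair[OF lip_atlas_inj[OF A ab(1)] ab(3) this]
  show "\<exists>a\<in>A. \<exists>d\<in>prod_charts B C. lip_in a d W (\<lambda>u. (f u, g u)) w"
    using ab ac unfolding prod_charts_def by blast
qed

lemma lip_in_subset:
  assumes A: "lip_atlas A" "a \<in> A" and f: "lip_in a b V f w"
    and W: "openin (chart_topology A) W" "W \<subseteq> V" "w \<in> W"
  shows "lip_in a b W f w"
proof -
  have op: "open (coords a ` (W \<inter> dom_chart a))"
    using W(1) A(2) unfolding openin_chart_topology[OF A(1)] by blast
  have "coords a ` {u \<in> dom_chart a \<inter> V. f u \<in> dom_chart b} \<inter> coords a ` (W \<inter> dom_chart a)
      = coords a ` ({u \<in> dom_chart a \<inter> V. f u \<in> dom_chart b} \<inter> (W \<inter> dom_chart a))"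
    by (rule inj_on_image_Int[OF lip_atlas_inj[OF A], symmetric]) auto
  also have "\<dots> \<subseteq> coords a ` {u \<in> dom_chart a \<inter> W. f u \<in> dom_chart b}" by blast
  finally have "coords a ` {u \<in> dom_chart a \<inter> V. f u \<in> dom_chart b} \<inter> coords a ` (W \<inter> dom_chart a)
      \<subseteq> coords a ` {u \<in> dom_chart a \<inter> W. f u \<in> dom_chart b}" .
  from interior_mono[OF this]
  have "interior (coords a ` {u \<in> dom_chart a \<inter> V. f u \<in> dom_chart b}) \<inter> coords a ` (W \<inter> dom_chart a)
      \<subseteq> interior (coords a ` {u \<in> dom_chart a \<inter> W. f u \<in> dom_chart b})"
    unfolding interior_Int interior_open[OF op] .
  moreover have "coords a w \<in> coords a ` (W \<inter> dom_chart a)"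
    using f W(3) unfolding lip_in_def by blast
  ultimately have "coords a w \<in> interior (coords a ` {u \<in> dom_chart a \<inter> W. f u \<in> dom_chart b})"
    using f unfolding lip_in_def by (elim conjE) (rule subsetD, assumption, rule IntI)
  then show ?thesis
    using f unfolding lip_in_def by (elim conjE) (intro conjI)
qed

lemma locally_lipschitz_map_subset:
  assumes A: "lip_atlas A" and B: "lip_atlas B" and f: "locally_lipschitz_map A B V f"
    and W: "openin (chart_topology A) W" "W \<subseteq> V"
  shows "locally_lipschitz_map A B W f"
proof (rule locally_lipschitz_mapI[OF A B])
  fix w assume w: "w \<in> W"
  obtain a b where ab: "a \<in> A" "b \<in> B" "lip_in a b V f w"
    using locally_lipschitz_mapD[OF f] W(2) w by blast
  then show "\<exists>a\<in>A. \<exists>b\<in>B. lip_in a b W f w" using lip_in_subset[OF A ab(1,3) W w] by blast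
qed

context manifold_C21
begin

lemma tchart_mem: "a \<in> A \<Longrightarrow> tchart A a \<in> tangent_charts A"
  unfolding tangent_charts_eq by (rule imageI)

lemma topspace_tangent: "topspace (tangent_topology A) = tangent_bundle A"
proof -
  have "\<Union>(dom_chart ` tangent_charts A) = tangent_bundle A"
  proof (intro equalityI subsetI)
    fix v assume "v \<in> \<Union>(dom_chart ` tangent_charts A)"
    then show "v \<in> tangent_bundle A" unfolding tangent_charts_eq using dom_tchart by blast
  next
    fix v assume "v \<in> tangent_bundle A"
    then obtain a where "a \<in> A" "v \<in> dom_chart (tchart A a)" using tangent_bundle_chart by blast
    then show "v \<in> \<Union>(dom_chart ` tangent_charts A)" unfolding tangent_charts_eq by blast
  qed
  then show ?thesis unfolding topspace_chart_topology[OF tangent_atlas] .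
qed

lemma base_lipschitz: "locally_lipschitz_map (tangent_charts A) A (tangent_bundle A) base"
proof (rule locally_lipschitz_mapI[OF tangent_atlas atlas])
  fix v assume "v \<in> tangent_bundle A"
  then obtain a where a: "a \<in> A" "base v \<in> dom_chart a" "v \<in> dom_chart (tchart A a)"
    by (rule tangent_bundle_chart)
  have "{u \<in> dom_chart (tchart A a) \<inter> tangent_bundle A. base u \<in> dom_chart a} = dom_chart (tchart A a)"
    using dom_tchart by blast
  then have "coords (tchart A a) v \<in> interior (coords (tchart A a) `
      {u \<in> dom_chart (tchart A a) \<inter> tangent_bundle A. base u \<in> dom_chart a})"
    using interior_open[OF open_tchart_image[OF a(1)]] a(3) by simp
  moreover have "lips_at (coord_expr (tchart A a) a base) (coords (tchart A a) v)"
  proof (rule lips_at_cong[OF lips_at_fst open_tchart_image[OF a(1)]])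
    show "coords (tchart A a) v \<in> coords (tchart A a) ` dom_chart (tchart A a)" using a(3) by (rule imageI)
    fix y assume "y \<in> coords (tchart A a) ` dom_chart (tchart A a)"
    then obtain u where u: "u \<in> dom_chart (tchart A a)" "y = coords (tchart A a) u" by blast
    show "fst y = coord_expr (tchart A a) a base y"
      unfolding u(2) coord_expr_coords[OF inj_tchart[OF a(1)] u(1)] by (simp add: coords_tchart)
  qed
  ultimately have "lip_in (tchart A a) a (tangent_bundle A) base v"
    unfolding lip_in_def using a by blast
  then show "\<exists>b\<in>tangent_charts A. \<exists>a\<in>A. lip_in b a (tangent_bundle A) base v"
    using a(1) tchart_mem by blast
qed

lemma fibre_inclusion_lipschitz:
  assumes p: "p \<in> topspace X"
  shows "locally_lipschitz_map (fibre_charts A p) (tangent_charts A) (tangent_space A p) (\<lambda>v. v)"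
proof (rule locally_lipschitz_mapI[OF fibre_atlas tangent_atlas])
  fix v assume v: "v \<in> tangent_space A p"
  obtain a where a: "a \<in> A" "p \<in> dom_chart a" using p unfolding topspace_eq by blast
  have dom: "dom_chart (fchart A p a) = tangent_space A p" unfolding fchart_def by simp
  have sub: "u \<in> dom_chart (tchart A a)" if "u \<in> tangent_space A p" for u
    using that a unfolding dom_tchart tangent_space_def by simp
  have "{u \<in> dom_chart (fchart A p a) \<inter> tangent_space A p. u \<in> dom_chart (tchart A a)} = dom_chart (fchart A p a)"
    using sub dom by blast
  then have "coords (fchart A p a) v \<in> interior (coords (fchart A p a) `
      {u \<in> dom_chart (fchart A p a) \<inter> tangent_space A p. u \<in> dom_chart (tchart A a)})"
    using fchart_image[OF a] by simp
  moreover have "lips_at (coord_expr (fchart A p a) (tchart A a) (\<lambda>v. v)) (coords (fchart A p a) v)"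
  proof (rule lips_at_cong[OF lips_at_Pair[OF lips_at_const lips_at_id] open_UNIV UNIV_I])
    fix y
    have "y \<in> coords (fchart A p a) ` dom_chart (fchart A p a)" unfolding fchart_image[OF a] by simp
    then obtain u where u: "u \<in> dom_chart (fchart A p a)" "y = coords (fchart A p a) u" by blast
    have "base u = p" using u(1) unfolding dom tangent_space_def by simp
    then show "(coords a p, y) = coord_expr (fchart A p a) (tchart A a) (\<lambda>v. v) y"
      unfolding u(2) coord_expr_coords[OF inj_fchart[OF a] u(1)] by (simp add: fchart_def coords_tchart)
  qed
  ultimately have "lip_in (fchart A p a) (tchart A a) (tangent_space A p) (\<lambda>v. v) v"
    unfolding lip_in_def using v sub dom by blast
  moreover have "fchart A p a \<in> fibre_charts A p" unfolding fibre_charts_eq using a by blast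
  ultimately show "\<exists>b\<in>fibre_charts A p. \<exists>a\<in>tangent_charts A. lip_in b a (tangent_space A p) (\<lambda>v. v) v"
    using a(1) tchart_mem by blast
qed

end

context spray_manifold
begin

lemma flow_in_chart:
  assumes a: "a \<in> A" and J: "is_interval J" "open J" "0 \<in> J"
    and z: "\<And>t. t \<in> J \<Longrightarrow> z t \<in> coords a ` dom_chart a \<times> UNIV"
    and dz: "\<And>t. t \<in> J \<Longrightarrow> (z has_vector_derivative rhs a (z t)) (at t)"
    and w: "w \<in> dom_chart (tchart A a)" "coords (tchart A a) w = z 0" and t: "t \<in> J"
  shows "reaches w t" "flow w t \<in> dom_chart (tchart A a)" "coords (tchart A a) (flow w t) = z t"
proof -
  have sol: "solution J (\<lambda>t. point_at (tchart A a) (z t))"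
    by (rule solution_from_chart[OF a J(1,2) z dz])
  have w0: "point_at (tchart A a) (z 0) = w"
    unfolding w(2)[symmetric] by (rule point_at_coords[OF inj_tchart[OF a] w(1)])
  show "reaches w t" by (rule flow_eq(1)[OF sol J(3) t w0])
  have "flow w t = point_at (tchart A a) (z t)" by (rule flow_eq(2)[OF sol J(3) t w0])
  then show "flow w t \<in> dom_chart (tchart A a)" "coords (tchart A a) (flow w t) = z t"
    using point_at_tchart[OF a z[OF t]] by simp_all
qed

text \<open>Picard--Lindelof in the chart around \<open>w0\<close>, with Gronwall's inequality for the dependence on the
  initial vector.\<close>

lemma local_flow:
  assumes "w0 \<in> tangent_bundle A"
  obtains Q \<delta> where "openin (tangent_topology A) Q" "w0 \<in> Q" "\<delta> > 0"
    "\<And>w s. w \<in> Q \<Longrightarrow> \<bar>s\<bar> < \<delta> \<Longrightarrow> reaches w s"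
    "\<And>s. \<bar>s\<bar> < \<delta> \<Longrightarrow> locally_lipschitz_map (tangent_charts A) (tangent_charts A) Q (\<lambda>w. flow w s)"
proof -
  obtain a where a: "a \<in> A" "base w0 \<in> dom_chart a" "w0 \<in> dom_chart (tchart A a)"
    using assms by (rule tangent_bundle_chart)
  let ?c = "tchart A a"
  let ?D = "coords a ` dom_chart a \<times> (UNIV :: (real^'n) set)"
  define z0 where "z0 = coords ?c w0"
  have D: "open ?D" "z0 \<in> ?D"
    unfolding z0_def using open_tchart_image[OF a(1)] a(3) unfolding tchart_dom_image[OF a(1), symmetric] by auto
  obtain r \<delta> K \<phi> where r: "r > 0" "\<delta> > 0" "cball z0 r \<subseteq> ?D" "K-lipschitz_on (cball z0 r) (rhs a)"
    and \<phi>: "\<And>z. z \<in> ball z0 (r / 2) \<Longrightarrow> \<phi> z 0 = z"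
      "\<And>z t. z \<in> ball z0 (r / 2) \<Longrightarrow> t \<in> {-\<delta><..<\<delta>} \<Longrightarrow> \<phi> z t \<in> cball z0 r"
      "\<And>z t. z \<in> ball z0 (r / 2) \<Longrightarrow> t \<in> {-\<delta><..<\<delta>} \<Longrightarrow> (\<phi> z has_vector_derivative rhs a (\<phi> z t)) (at t)"
    using picard_lindelof[OF lips_at_rhs[OF a(1) D(2)] D] by blast
  define Q where "Q = {w \<in> dom_chart ?c. coords ?c w \<in> ball z0 (r / 2)}"
  have J: "is_interval {-\<delta><..<\<delta>}" "open {-\<delta><..<\<delta>}" "0 \<in> {-\<delta><..<\<delta>}"
    using r(2) by (auto simp: is_interval_oo)
  have in_chart: "reaches w s" "flow w s \<in> dom_chart ?c" "coords ?c (flow w s) = \<phi> (coords ?c w) s"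
    if w: "w \<in> Q" and s: "s \<in> {-\<delta><..<\<delta>}" for w s
  proof -
    have wb: "w \<in> dom_chart ?c" "coords ?c w \<in> ball z0 (r / 2)" using w unfolding Q_def by blast+
    have zD: "\<phi> (coords ?c w) t \<in> ?D" if "t \<in> {-\<delta><..<\<delta>}" for t
      using \<phi>(2)[OF wb(2) that] r(3) by blast
    note * = flow_in_chart[OF a(1) J zD \<phi>(3)[OF wb(2)] wb(1) \<phi>(1)[OF wb(2), symmetric] s]
    show "reaches w s" "flow w s \<in> dom_chart ?c" "coords ?c (flow w s) = \<phi> (coords ?c w) s"
      using * by blast+
  qed
  have lip: "locally_lipschitz_map (tangent_charts A) (tangent_charts A) Q (\<lambda>w. flow w s)" if s: "s \<in> {-\<delta><..<\<delta>}" for s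
  proof (rule locally_lipschitz_mapI[OF tangent_atlas tangent_atlas])
    fix w assume w: "w \<in> Q"
    have ball: "\<exists>u. u \<in> Q \<and> u \<in> dom_chart ?c \<and> y = coords ?c u" if y: "y \<in> ball z0 (r / 2)" for y
    proof -
      have "ball z0 (r / 2) \<subseteq> cball z0 r" using r(1) by (intro subset_trans[OF ball_subset_cball] cball_subset_cball_iff[THEN iffD2]) auto
      then have "y \<in> ?D" using y r(3) by blast
      from point_at_tchart[OF a(1) this] y show ?thesis unfolding Q_def by (metis (mono_tags, lifting) mem_Collect_eq)
    qed
    have wb: "w \<in> dom_chart ?c" "coords ?c w \<in> ball z0 (r / 2)" using w unfolding Q_def by blast+
    have sub: "ball z0 (r / 2) \<subseteq> coords ?c ` {u \<in> dom_chart ?c \<inter> Q. flow u s \<in> dom_chart ?c}"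
      using ball in_chart(2)[OF _ s] by blast
    have "(exp (K * \<bar>s\<bar>))-lipschitz_on (ball z0 (r / 2)) (coord_expr ?c ?c (\<lambda>w. flow w s))"
    proof (rule lipschitz_onI)
      have eq: "coord_expr ?c ?c (\<lambda>w. flow w s) y = \<phi> y s" if y: "y \<in> ball z0 (r / 2)" for y
      proof -
        obtain u where u: "u \<in> Q" "u \<in> dom_chart ?c" "y = coords ?c u" using ball[OF y] by blast
        show ?thesis
          unfolding u(3) coord_expr_coords[OF inj_tchart[OF a(1)] u(2)] by (rule in_chart(3)[OF u(1) s])
      qed
      fix y1 y2 assume y: "y1 \<in> ball z0 (r / 2)" "y2 \<in> ball z0 (r / 2)"
      have "norm (\<phi> y1 s - \<phi> y2 s) \<le> exp (K * \<bar>s - 0\<bar>) * norm (\<phi> y1 0 - \<phi> y2 0)"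
      proof (rule gronwall[OF J(1) J(3) s \<phi>(3)[OF y(1)] \<phi>(3)[OF y(2)]])
        fix u assume "u \<in> {-\<delta><..<\<delta>}"
        from lipschitz_onD[OF r(4) \<phi>(2)[OF y(1) this] \<phi>(2)[OF y(2) this]]
        show "norm (rhs a (\<phi> y1 u) - rhs a (\<phi> y2 u)) \<le> K * norm (\<phi> y1 u - \<phi> y2 u)" by (simp add: dist_norm)
      qed
      then show "dist (coord_expr ?c ?c (\<lambda>w. flow w s) y1) (coord_expr ?c ?c (\<lambda>w. flow w s) y2)
          \<le> exp (K * \<bar>s\<bar>) * dist y1 y2"
        unfolding eq[OF y(1)] eq[OF y(2)] dist_norm \<phi>(1)[OF y(1)] \<phi>(1)[OF y(2)] by simp
    qed simp
    then have "lips_at (coord_expr ?c ?c (\<lambda>w. flow w s)) (coords ?c w)"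
      using wb(2) by (intro lips_atI[OF open_ball])
    moreover have "coords ?c w \<in> interior (coords ?c ` {u \<in> dom_chart ?c \<inter> Q. flow u s \<in> dom_chart ?c})"
      by (rule interiorI[OF open_ball wb(2) sub])
    ultimately have "lip_in ?c ?c Q (\<lambda>w. flow w s) w"
      unfolding lip_in_def using wb(1) in_chart(2)[OF w s] by blast
    then show "\<exists>b\<in>tangent_charts A. \<exists>c\<in>tangent_charts A. lip_in b c Q (\<lambda>w. flow w s) w"
      using tchart_mem[OF a(1)] by blast
  qed
  show thesis
  proof (rule that[of Q \<delta>])
    show "openin (tangent_topology A) Q"
      unfolding Q_def by (rule openin_chart_preimage[OF tangent_atlas tchart_mem[OF a(1)] open_ball])
    show "w0 \<in> Q" unfolding Q_def using a(3) r(1) z0_def by simp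
    show "\<delta> > 0" by (rule r(2))
    show "reaches w s" if "w \<in> Q" "\<bar>s\<bar> < \<delta>" for w s using in_chart(1)[OF that(1), of s] that(2) by (simp add: abs_less_iff)
    show "locally_lipschitz_map (tangent_charts A) (tangent_charts A) Q (\<lambda>w. flow w s)" if "\<bar>s\<bar> < \<delta>" for s
      using lip[of s] that by (simp add: abs_less_iff)
  qed
qed

lemma solution_continuous:
  assumes c: "solution I c" and t: "t \<in> I" and Q: "openin (tangent_topology A) Q" "c t \<in> Q"
  obtains \<eta> where "\<eta> > 0" "\<And>s. \<bar>s - t\<bar> < \<eta> \<Longrightarrow> s \<in> I \<and> c s \<in> Q"
proof -
  obtain a where a: "a \<in> A" "base (c t) \<in> dom_chart a" "c t \<in> dom_chart (tchart A a)"
    using solutionD(3)[OF c t] by (rule tangent_bundle_chart)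
  let ?c = "tchart A a"
  have "open (coords ?c ` (Q \<inter> dom_chart ?c))"
    using Q(1) tchart_mem[OF a(1)] unfolding openin_chart_topology[OF tangent_atlas] by blast
  from isCont_eventually_mem[OF solution_chart_continuous[OF c t a(1,2)] this]
  have "\<forall>\<^sub>F s in nhds t. coords ?c (c s) \<in> coords ?c ` (Q \<inter> dom_chart ?c)" using Q(2) a(3) by blast
  moreover have "\<forall>\<^sub>F s in nhds t. s \<in> {s \<in> I. base (c s) \<in> dom_chart a}"
    using solutionD(4)[OF c chart(1)[OF a(1)]] t a(2) by (intro eventually_nhds_in_open) auto
  ultimately have "\<forall>\<^sub>F s in nhds t. s \<in> I \<and> c s \<in> Q"
  proof eventually_elim
    case (elim s)
    then have s: "s \<in> I" "c s \<in> dom_chart ?c" using solutionD(3)[OF c] unfolding dom_tchart by auto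
    have "c s \<in> Q \<inter> dom_chart ?c"
      using iffD1[OF inj_on_image_mem_iff[OF inj_tchart[OF a(1)] s(2) Int_lower2] elim(1)] .
    with s show ?case by blast
  qed
  then obtain \<eta> where "\<eta> > 0" "\<forall>s. dist s t < \<eta> \<longrightarrow> s \<in> I \<and> c s \<in> Q"
    unfolding eventually_nhds_metric by blast
  then show thesis using that by (simp add: dist_real_def)
qed

text \<open>Connectedness of the unit interval replaces a subdivision: near each time \<open>t\<close> the property \<open>P\<close> of
  the proof passes between any two times \<open>x\<close> and \<open>y\<close>, since the flow up to \<open>y\<close> is the flow up to \<open>x\<close> followed
  by the local flow around \<open>c t\<close> for the short time \<open>y - x\<close>.\<close>

lemma flow_lipschitz_near:
  assumes v0: "v0 \<in> tangent_bundle A" and reach: "reaches v0 1"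
  obtains Q where "openin (tangent_topology A) Q" "v0 \<in> Q" "\<And>v. v \<in> Q \<Longrightarrow> reaches v 1"
    "locally_lipschitz_map (tangent_charts A) (tangent_charts A) Q (\<lambda>v. flow v 1)"
proof -
  obtain I c where c: "0 \<in> I" "1 \<in> I" "solution I c" "c 0 = v0" using reach unfolding reaches_def by blast
  have I: "t \<in> I" if "t \<in> {0..1}" for t
    using solutionD(1)[OF c(3)] c(1,2) that unfolding is_interval_1 by (meson atLeastAtMost_iff)
  define P where "P t \<longleftrightarrow> (\<exists>Q. openin (tangent_topology A) Q \<and> v0 \<in> Q \<and> (\<forall>v\<in>Q. reaches v t) \<and>
    locally_lipschitz_map (tangent_charts A) (tangent_charts A) Q (\<lambda>v. flow v t))" for t
  have P0: "P 0"
  proof -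
    obtain Q \<delta> where Q: "openin (tangent_topology A) Q" "v0 \<in> Q" "\<delta> > 0"
      "\<And>w s. w \<in> Q \<Longrightarrow> \<bar>s\<bar> < \<delta> \<Longrightarrow> reaches w s"
      "\<And>s. \<bar>s\<bar> < \<delta> \<Longrightarrow> locally_lipschitz_map (tangent_charts A) (tangent_charts A) Q (\<lambda>w. flow w s)"
      using local_flow[OF v0] by blast
    have 0: "\<bar>0\<bar> < \<delta>" using Q(3) by simp
    show ?thesis unfolding P_def using Q(1,2) Q(4)[OF _ 0] Q(5)[OF 0] by blast
  qed
  have "P 1"
  proof (rule connected_induction_simple[of "{0..1}" 0 1 P])
    show "connected {0..1::real}" by (rule connected_Icc)
    show "P 0" by (rule P0)
    fix t :: real assume t: "t \<in> {0..1}"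
    obtain Q' \<delta> where Q': "openin (tangent_topology A) Q'" "c t \<in> Q'" "\<delta> > 0"
      "\<And>w s. w \<in> Q' \<Longrightarrow> \<bar>s\<bar> < \<delta> \<Longrightarrow> reaches w s"
      "\<And>s. \<bar>s\<bar> < \<delta> \<Longrightarrow> locally_lipschitz_map (tangent_charts A) (tangent_charts A) Q' (\<lambda>w. flow w s)"
      using local_flow[OF solutionD(3)[OF c(3) I[OF t]]] by blast
    obtain \<eta> where \<eta>: "\<eta> > 0" "\<And>s. \<bar>s - t\<bar> < \<eta> \<Longrightarrow> s \<in> I \<and> c s \<in> Q'"
      using solution_continuous[OF c(3) I[OF t] Q'(1,2)] by blast
    \<comment> \<open>Two times at distance less than \<open>\<delta> / 2\<close> from \<open>t\<close> differ by less than \<open>\<delta>\<close>, the life span of the local flow.\<close>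
    define e where "e = min \<eta> (\<delta> / 2)"
    have step: "P y" if x: "x \<in> ball t e" and y: "y \<in> ball t e" and Px: "P x" for x y
    proof -
      obtain Q where Q: "openin (tangent_topology A) Q" "v0 \<in> Q" "\<And>v. v \<in> Q \<Longrightarrow> reaches v x"
        "locally_lipschitz_map (tangent_charts A) (tangent_charts A) Q (\<lambda>v. flow v x)"
        using Px unfolding P_def by blast
      have xt: "\<bar>x - t\<bar> < e" "\<bar>y - t\<bar> < e" using x y by (auto simp: dist_real_def)
      then have xy: "\<bar>y - x\<bar> < \<delta>" unfolding e_def by linarith
      have cx: "x \<in> I" "c x \<in> Q'" using \<eta>(2)[of x] xt unfolding e_def by auto
      define R where "R = {v \<in> Q. flow v x \<in> Q'}"
      have R: "v \<in> R \<Longrightarrow> reaches v y" "v \<in> R \<Longrightarrow> flow v y = flow (flow v x) (y - x)" for v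
        using flow_add[of v x "y - x"] Q(3)[of v] Q'(4)[OF _ xy, of "flow v x"] unfolding R_def by auto
      have lip: "locally_lipschitz_map (tangent_charts A) (tangent_charts A) R (\<lambda>v. flow (flow v x) (y - x))"
        unfolding R_def
        by (rule locally_lipschitz_map_compose[OF tangent_atlas tangent_atlas tangent_atlas Q(4) Q'(5)[OF xy]])
      have "locally_lipschitz_map (tangent_charts A) (tangent_charts A) R (\<lambda>v. flow v y)"
        by (rule locally_lipschitz_map_cong[OF tangent_atlas tangent_atlas lip]) (rule R(2)[symmetric])
      moreover have "openin (tangent_topology A) R"
        by (rule locally_lipschitz_map_openin[OF tangent_atlas tangent_atlas lip])
      moreover have "v0 \<in> R"
        unfolding R_def using Q(2) flow_eq(2)[OF c(3,1) cx(1) c(4)] cx(2) by simp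
      ultimately show "P y" unfolding P_def using R(1) by blast
    qed
    show "\<exists>T. openin (top_of_set {0..1}) T \<and> t \<in> T \<and> (\<forall>x\<in>T. \<forall>y\<in>T. P x \<longrightarrow> P y)"
    proof (intro exI conjI ballI impI)
      show "openin (top_of_set {0..1}) ({0..1} \<inter> ball t e)" by (rule openin_open_Int) simp
      show "t \<in> {0..1} \<inter> ball t e" using t \<eta>(1) Q'(3) unfolding e_def by simp
      show "P y" if "x \<in> {0..1} \<inter> ball t e" "y \<in> {0..1} \<inter> ball t e" "P x" for x y
        using step[of x y] that by blast
    qed
  qed auto
  with that show thesis unfolding P_def by blast
qed

lemma
  shows exp_domain_openin: "openin (tangent_topology A) (exp_domain X A H)"
    and flow_lipschitz: "locally_lipschitz_map (tangent_charts A) (tangent_charts A) (exp_domain X A H) (\<lambda>v. flow v 1)"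
proof -
  have sub: "Q \<subseteq> exp_domain X A H" if "openin (tangent_topology A) Q" "\<And>v. v \<in> Q \<Longrightarrow> reaches v 1" for Q
  proof
    fix v assume "v \<in> Q"
    then show "v \<in> exp_domain X A H"
      using openin_subset[OF that(1)] that(2) unfolding exp_domain_iff topspace_tangent by blast
  qed
  show *: "locally_lipschitz_map (tangent_charts A) (tangent_charts A) (exp_domain X A H) (\<lambda>v. flow v 1)"
  proof (rule locally_lipschitz_mapI[OF tangent_atlas tangent_atlas])
    fix v assume "v \<in> exp_domain X A H"
    then have v: "v \<in> tangent_bundle A" "reaches v 1" unfolding exp_domain_iff by blast+
    obtain Q where Q: "openin (tangent_topology A) Q" "v \<in> Q" "\<And>v. v \<in> Q \<Longrightarrow> reaches v 1"
      "locally_lipschitz_map (tangent_charts A) (tangent_charts A) Q (\<lambda>v. flow v 1)"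
      using flow_lipschitz_near[OF v] by blast
    obtain a b where ab: "a \<in> tangent_charts A" "b \<in> tangent_charts A" "lip_in a b Q (\<lambda>v. flow v 1) v"
      by (rule locally_lipschitz_mapD[OF Q(4,2)])
    have "lip_in a b (exp_domain X A H) (\<lambda>v. flow v 1) v"
      by (rule lip_in_cong[OF ab(3) lip_atlas_inj[OF tangent_atlas ab(1)] sub[OF Q(1,3)] refl Q(2)])
    with ab show "\<exists>a\<in>tangent_charts A. \<exists>b\<in>tangent_charts A. lip_in a b (exp_domain X A H) (\<lambda>v. flow v 1) v"
      by blast
  qed
  show "openin (tangent_topology A) (exp_domain X A H)"
    by (rule locally_lipschitz_map_openin[OF tangent_atlas tangent_atlas *])
qed

lemma endpoint_lipschitz:
  "locally_lipschitz_map (tangent_charts A) A (exp_domain X A H) (\<lambda>v. base (flow v 1))"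
proof -
  have "{v \<in> exp_domain X A H. flow v 1 \<in> tangent_bundle A} = exp_domain X A H"
    using flow_mem exp_domain_iff by blast
  then show ?thesis
    using locally_lipschitz_map_compose[OF tangent_atlas tangent_atlas atlas flow_lipschitz base_lipschitz] by simp
qed

lemma exp_domain_subset: "exp_domain X A H \<subseteq> tangent_bundle A"
  using exp_domain_iff by blast

lemma exp_map_lipschitz:
  "locally_lipschitz_map (tangent_charts A) (prod_charts A A) (exp_domain X A H) (exp_map X A H)"
  by (rule locally_lipschitz_map_cong[OF tangent_atlas lip_atlas_prod[OF atlas atlas]
        locally_lipschitz_map_Pair[OF tangent_atlas atlas atlas locally_lipschitz_map_subset[OF tangent_atlas atlas base_lipschitz exp_domain_openin exp_domain_subset]
            endpoint_lipschitz]])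
     (rule exp_map_eq[symmetric])

lemma exp_domain_at_eq: "exp_domain_at X A H p = {v \<in> tangent_space A p. v \<in> exp_domain X A H}"
  unfolding exp_domain_at_def by blast

lemma exp_at_eq: "v \<in> exp_domain X A H \<Longrightarrow> exp_at X A H v = base (flow v 1)"
  unfolding exp_at_def using geodesic_eq[of v 1] exp_domain_iff by blast

lemma exp_at_lipschitz:
  assumes p: "p \<in> topspace X"
  shows "locally_lipschitz_map (fibre_charts A p) A (exp_domain_at X A H p) (exp_at X A H)"
proof (rule locally_lipschitz_map_cong[OF fibre_atlas atlas])
  show "locally_lipschitz_map (fibre_charts A p) A (exp_domain_at X A H p) (\<lambda>v. base (flow v 1))"
    unfolding exp_domain_at_eq
    by (rule locally_lipschitz_map_compose[OF fibre_atlas tangent_atlas atlas fibre_inclusion_lipschitz[OF p] endpoint_lipschitz])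
qed (use exp_at_eq exp_domain_at_eq in auto)

lemma exp_domain_at_openin:
  "p \<in> topspace X \<Longrightarrow> openin (fibre_topology A p) (exp_domain_at X A H p)"
  by (rule locally_lipschitz_map_openin[OF fibre_atlas atlas exp_at_lipschitz])

end

section \<open>The exponential map near the zero section\<close>

lemma norm_snd_proj_le: "norm (snd z) \<le> norm z"
  using norm_snd_le[of "snd z" "fst z"] by simp

lemma norm_scale_snd_le:
  assumes "0 \<le> s" "s \<le> 1"
  shows "s * norm (z :: 'a::real_normed_vector \<times> 'b::real_normed_vector) \<le> norm (fst z, s *\<^sub>R snd z)"
proof -
  have "s * norm z = norm (s *\<^sub>R fst z, s *\<^sub>R snd z)"
    using assms(1) norm_scaleR[of s z] by (simp add: scaleR_prod_def)
  also have "\<dots> \<le> norm (fst z, s *\<^sub>R snd z)"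
    unfolding norm_Pair using assms
    by (intro real_sqrt_le_mono add_mono power_mono) (auto simp: mult_left_le_one_le)
  finally show ?thesis .
qed

lemma has_vector_derivative_rescale:
  fixes s :: real
  assumes "(f has_vector_derivative f') (at (s * t))"
  shows "((\<lambda>t. f (s * t)) has_vector_derivative s *\<^sub>R f') (at t)"
proof -
  have "((\<lambda>t. s * t) has_vector_derivative s) (at t)"
    by (auto intro!: derivative_eq_intros)
  from vector_diff_chain_at[OF this assms] show ?thesis by (simp add: o_def)
qed

text \<open>Quantitative invertibility of the strong differential of the exponential map at a zero vector.\<close>

lemma shear_expansive: "1 / 3 * norm h \<le> norm (fst h, fst h + snd h)"
proof -
  let ?L = "(fst h, fst h + snd h)"
  have "norm h \<le> norm (fst h) + norm (snd h)"
    using norm_Pair_le[of "fst h" "snd h"] by simp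
  moreover have "norm (snd h) \<le> norm (fst h + snd h) + norm (fst h)"
    using norm_triangle_ineq4[of "fst h + snd h" "fst h"] by simp
  moreover have "norm (fst h) \<le> norm ?L" "norm (fst h + snd h) \<le> norm ?L"
    by (rule norm_fst_le, rule norm_snd_le)
  ultimately show ?thesis by simp
qed

context spray_manifold
begin

lemma spray_zero:
  assumes "a \<in> A" "x \<in> coords a ` dom_chart a"
  shows "H a x 0 = 0"
proof -
  have "H a x (2 *\<^sub>R 0) = 2\<^sup>2 *\<^sub>R H a x 0" by (rule spray_homogeneous[OF assms]) simp
  then have "H a x 0 = 4 *\<^sub>R H a x 0" by simp
  then have "3 *\<^sub>R H a x 0 = 0" by (simp add: algebra_simps scaleR_left_diff_distrib[of 4 1, simplified])
  then show ?thesis by simp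
qed

lemma coords_zero_tvec: "coords (tchart A a) (zero_tvec p) = (coords a p, 0)"
  unfolding coords_tchart zero_tvec_def by simp

lemma base_zero_tvec: "base (zero_tvec p) = p"
  unfolding zero_tvec_def by simp

text \<open>The constant curve is a solution because homogeneity with \<open>s = 2\<close> forces \<open>H\<close> to vanish at zero
  velocity.\<close>

lemma flow_zero:
  assumes p: "p \<in> topspace X"
  shows "reaches (zero_tvec p) t" "flow (zero_tvec p) t = zero_tvec p"
proof -
  obtain a where a: "a \<in> A" "p \<in> dom_chart a" using p unfolding topspace_eq by blast
  have z: "zero_tvec p \<in> dom_chart (tchart A a)"
    unfolding dom_tchart base_zero_tvec using zero_tvec_mem[OF p] a by blast
  have rhs: "rhs a (coords a p, 0) = 0"
    unfolding rhs_def using spray_zero[OF a(1)] a(2) by (simp add: zero_prod_def)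
  have mem: "(coords a p, 0) \<in> coords a ` dom_chart a \<times> UNIV" using a(2) by blast
  have der: "((\<lambda>t. (coords a p, 0)) has_vector_derivative rhs a (coords a p, 0)) (at u)" for u :: real
    unfolding rhs by (rule has_vector_derivative_const)
  note * = flow_in_chart[OF a(1) is_interval_univ open_UNIV UNIV_I mem der z coords_zero_tvec UNIV_I]
  show "reaches (zero_tvec p) t" by (rule *(1))
  show "flow (zero_tvec p) t = zero_tvec p"
    by (rule inj_onD[OF inj_tchart[OF a(1)] _ *(2) z]) (simp only: *(3) coords_zero_tvec)
qed

lemma zero_in_exp_domain: "p \<in> topspace X \<Longrightarrow> zero_tvec p \<in> exp_domain X A H"
  unfolding exp_domain_iff using zero_tvec_mem flow_zero by blast

lemma endpoint_zero: "p \<in> topspace X \<Longrightarrow> base (flow (zero_tvec p) 1) = p"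
  by (simp add: flow_zero base_zero_tvec)

text \<open>In these coordinates the exponential map is \<open>z \<mapsto> (fst z, endpoint_coords a z)\<close>.\<close>

definition endpoint_coords :: "('p, real^'n) chart \<Rightarrow> (real^'n) \<times> (real^'n) \<Rightarrow> real^'n" where
  "endpoint_coords a = coord_expr (tchart A a) a (\<lambda>v. base (flow v 1))"

text \<open>A neighborhood of the zero vector at \<open>p\<close> on which the geodesics exist up to time 1, end in the
  domain of \<open>a\<close>, and have end points that differ from \<open>x + v\<close> by an \<open>\<epsilon>\<close>-Lipschitz function.\<close>

definition shear_nbhd :: "('p, real^'n) chart \<Rightarrow> 'p \<Rightarrow> real \<Rightarrow> ((real^'n) \<times> (real^'n)) set \<Rightarrow> bool" where
  "shear_nbhd a p \<epsilon> B \<longleftrightarrow> open B \<and> (coords a p, 0) \<in> B \<and> B \<subseteq> coords a ` dom_chart a \<times> UNIV \<and>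
     (\<forall>v. v \<in> dom_chart (tchart A a) \<longrightarrow> coords (tchart A a) v \<in> B \<longrightarrow>
       reaches v 1 \<and> base (flow v 1) \<in> dom_chart a) \<and>
     (\<forall>y\<in>B. \<forall>z\<in>B. norm (endpoint_coords a y - endpoint_coords a z - (fst (y - z) + snd (y - z)))
       \<le> \<epsilon> * norm (y - z))"

text \<open>Let \<open>\<phi>\<close> be the local solutions near \<open>(x, 0)\<close>, which live up to time \<open>\<delta>\<close>. By homogeneity the rescaled
  curves \<open>\<psi>(t) = (x(s t), s v(s t))\<close> are again solutions; they live up to time \<open>\<delta> / s\<close> and have small
  velocities, and along them \<open>H\<close> is \<open>s K\<close>-Lipschitz: scaling multiplies differences of \<open>H\<close> by \<open>s\<^sup>2\<close> but
  differences of points by \<open>s\<close> at least. So the distance of two of these solutions grows at most by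
  the factor \<open>exp (1 + K)\<close> up to time 1, their velocities change relative to each other by at most
  \<open>s K exp (1 + K)\<close> times the initial distance, and integrating once more gives the bound for the end
  points.\<close>

lemma shear_nbhd_exists:
  assumes a: "a \<in> A" and p: "p \<in> dom_chart a" and \<epsilon>: "\<epsilon> > 0"
  shows "\<exists>B. shear_nbhd a p \<epsilon> B"
proof -
  let ?c = "tchart A a"
  let ?D = "coords a ` dom_chart a \<times> (UNIV :: (real^'n) set)"
  define z0 where "z0 = (coords a p, 0 :: real^'n)"
  have D: "open ?D" "z0 \<in> ?D"
    unfolding z0_def using open_tchart_image[OF a] p unfolding tchart_dom_image[OF a] by auto
  obtain r \<delta> K \<phi> where r: "r > 0" "\<delta> > 0" "cball z0 r \<subseteq> ?D" "K-lipschitz_on (cball z0 r) (rhs a)"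
    and \<phi>: "\<And>z. z \<in> ball z0 (r / 2) \<Longrightarrow> \<phi> z 0 = z"
      "\<And>z t. z \<in> ball z0 (r / 2) \<Longrightarrow> t \<in> {-\<delta><..<\<delta>} \<Longrightarrow> \<phi> z t \<in> cball z0 r"
      "\<And>z t. z \<in> ball z0 (r / 2) \<Longrightarrow> t \<in> {-\<delta><..<\<delta>} \<Longrightarrow> (\<phi> z has_vector_derivative rhs a (\<phi> z t)) (at t)"
    using picard_lindelof[OF lips_at_rhs[OF a D(2)] D] by blast
  have K0: "K \<ge> 0" using r(4) lipschitz_on_nonneg by blast
  define M where "M = K * exp (1 + K)"
  have M0: "M \<ge> 0" unfolding M_def using K0 by simp
  \<comment> \<open>The rescaled solutions live up to time 2, beyond the time 1 that is needed, and the error constant \<open>s M\<close> is at most \<open>\<epsilon>\<close>.\<close>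
  define s where "s = min (min 1 (\<delta> / 2)) (\<epsilon> / (M + 1))"
  have s: "0 < s" unfolding s_def using r(2) \<epsilon> M0 by simp
  have "s \<le> min 1 (\<delta> / 2)" unfolding s_def by (rule min.cobounded1)
  then have s1: "s \<le> 1" "s * 2 \<le> \<delta>" by simp_all
  have "s * M \<le> \<epsilon> / (M + 1) * M" unfolding s_def using M0 by (intro mult_right_mono) auto
  also have "\<dots> \<le> \<epsilon>" using M0 \<epsilon> by (simp add: field_simps)
  finally have sM: "s * M \<le> \<epsilon>" .
  define unscale where "unscale z = (fst z, (1 / s) *\<^sub>R snd z)" for z :: "(real^'n) \<times> (real^'n)"
  define \<psi> where "\<psi> z t = (fst (\<phi> (unscale z) (s * t)), s *\<^sub>R snd (\<phi> (unscale z) (s * t)))" for z t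
  define B where "B = unscale -` ball z0 (r / 2)"
  define J where "J = {-2<..<2::real}"
  have J: "is_interval J" "open J" "0 \<in> J" "1 \<in> J" unfolding J_def by (auto simp: is_interval_oo)
  have sJ: "s * t \<in> {-\<delta><..<\<delta>}" if "t \<in> J" for t
  proof -
    have "\<bar>t\<bar> < 2" using that unfolding J_def by auto
    then have "\<bar>s * t\<bar> < s * 2" unfolding abs_mult using s by simp
    then show ?thesis using s1(2) by (auto simp: abs_less_iff)
  qed
  have Bu: "unscale z \<in> ball z0 (r / 2)" if "z \<in> B" for z using that unfolding B_def by simp
  have opB: "open B"
    unfolding B_def unscale_def[abs_def] by (intro open_vimage open_ball continuous_intros)
  have z0B: "z0 \<in> B" unfolding B_def unscale_def z0_def using r(1) by simp
  have \<psi>0: "\<psi> z 0 = z" if "z \<in> B" for z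
    unfolding \<psi>_def using \<phi>(1)[OF Bu[OF that]] s by (simp add: unscale_def)
  have \<phi>D: "\<phi> (unscale z) (s * t) \<in> cball z0 r" "fst (\<phi> (unscale z) (s * t)) \<in> coords a ` dom_chart a"
    if "z \<in> B" "t \<in> J" for z t
  proof -
    show 1: "\<phi> (unscale z) (s * t) \<in> cball z0 r" by (rule \<phi>(2)[OF Bu[OF that(1)] sJ[OF that(2)]])
    show "fst (\<phi> (unscale z) (s * t)) \<in> coords a ` dom_chart a" using subsetD[OF r(3) 1] by (rule mem_Times_iff[THEN iffD1, THEN conjunct1])
  qed
  have \<psi>D: "\<psi> z t \<in> ?D" if "z \<in> B" "t \<in> J" for z t
    unfolding \<psi>_def using \<phi>D(2)[OF that] by blast
  have H\<psi>: "H a (fst (\<psi> z t)) (snd (\<psi> z t)) = s\<^sup>2 *\<^sub>R snd (rhs a (\<phi> (unscale z) (s * t)))"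
    if "z \<in> B" "t \<in> J" for z t
    unfolding \<psi>_def rhs_def using spray_homogeneous[OF a \<phi>D(2)[OF that] s] by simp
  have d\<psi>: "(\<psi> z has_vector_derivative rhs a (\<psi> z t)) (at t)" if z: "z \<in> B" "t \<in> J" for z t
  proof -
    have "((\<lambda>t. \<phi> (unscale z) (s * t)) has_vector_derivative s *\<^sub>R rhs a (\<phi> (unscale z) (s * t))) (at t)"
      by (rule has_vector_derivative_rescale[OF \<phi>(3)[OF Bu[OF z(1)] sJ[OF z(2)]]])
    note d = bounded_linear.has_vector_derivative[OF bounded_linear_fst this]
      bounded_linear.has_vector_derivative[OF bounded_linear_snd this]
    \<comment> \<open>One factor \<open>s\<close> comes from the velocity and one from the rescaled time; together they are the factor of homogeneity.\<close>
    have "((\<lambda>t. s *\<^sub>R snd (\<phi> (unscale z) (s * t))) has_vector_derivative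
        s *\<^sub>R (s *\<^sub>R snd (rhs a (\<phi> (unscale z) (s * t))))) (at t)"
      using bounded_linear.has_vector_derivative[OF bounded_linear_scaleR_right d(2)] by simp
    with d(1) have "(\<psi> z has_vector_derivative (s *\<^sub>R fst (rhs a (\<phi> (unscale z) (s * t))),
        s *\<^sub>R (s *\<^sub>R snd (rhs a (\<phi> (unscale z) (s * t)))))) (at t)"
      unfolding \<psi>_def[abs_def] has_vector_derivative_Pair_iff by simp
    moreover have "rhs a (\<psi> z t) = (s *\<^sub>R fst (rhs a (\<phi> (unscale z) (s * t))),
        s *\<^sub>R (s *\<^sub>R snd (rhs a (\<phi> (unscale z) (s * t)))))"
      unfolding rhs_def[of a "\<psi> z t"] H\<psi>[OF z] by (simp add: \<psi>_def rhs_def power2_eq_square)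
    ultimately show ?thesis by simp
  qed
  have H_lip: "norm (H a (fst (\<psi> y t)) (snd (\<psi> y t)) - H a (fst (\<psi> z t)) (snd (\<psi> z t)))
      \<le> s * K * norm (\<psi> y t - \<psi> z t)" if y: "y \<in> B" and z: "z \<in> B" and t: "t \<in> J" for y z t
  proof -
    let ?y = "\<phi> (unscale y) (s * t)" and ?z = "\<phi> (unscale z) (s * t)"
    have "norm (H a (fst (\<psi> y t)) (snd (\<psi> y t)) - H a (fst (\<psi> z t)) (snd (\<psi> z t)))
        = s\<^sup>2 * norm (snd (rhs a ?y - rhs a ?z))"
      unfolding H\<psi>[OF y t] H\<psi>[OF z t] by (simp flip: scaleR_diff_right)
    also have "\<dots> \<le> s\<^sup>2 * norm (rhs a ?y - rhs a ?z)"
      by (intro mult_left_mono norm_snd_proj_le) simp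
    also have "\<dots> \<le> s\<^sup>2 * (K * norm (?y - ?z))"
      using lipschitz_onD[OF r(4) \<phi>D(1)[OF y t] \<phi>D(1)[OF z t]]
      by (intro mult_left_mono) (auto simp: dist_norm)
    also have "\<dots> = s * K * (s * norm (?y - ?z))" by (simp add: power2_eq_square)
    also have "\<dots> \<le> s * K * norm (fst (?y - ?z), s *\<^sub>R snd (?y - ?z))"
      using s s1(1) K0 by (intro mult_left_mono norm_scale_snd_le) auto
    also have "(fst (?y - ?z), s *\<^sub>R snd (?y - ?z)) = \<psi> y t - \<psi> z t"
      unfolding \<psi>_def by (simp add: scaleR_diff_right)
    finally show ?thesis .
  qed
  have close: "norm (\<psi> y t - \<psi> z t) \<le> exp (1 + K) * norm (y - z)"
    if y: "y \<in> B" and z: "z \<in> B" and t: "t \<in> {0..1}" for y z t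
  proof -
    have tJ: "t \<in> J" using t unfolding J_def by auto
    have "norm (\<psi> y t - \<psi> z t) \<le> exp ((1 + K) * \<bar>t - 0\<bar>) * norm (\<psi> y 0 - \<psi> z 0)"
    proof (rule gronwall[OF J(1,3) tJ d\<psi>[OF y] d\<psi>[OF z]])
      fix u assume u: "u \<in> J"
      have "norm (rhs a (\<psi> y u) - rhs a (\<psi> z u)) \<le> norm (snd (\<psi> y u - \<psi> z u)) +
          norm (H a (fst (\<psi> y u)) (snd (\<psi> y u)) - H a (fst (\<psi> z u)) (snd (\<psi> z u)))"
        unfolding rhs_def by (simp add: norm_Pair_le)
      also have "\<dots> \<le> norm (\<psi> y u - \<psi> z u) + s * K * norm (\<psi> y u - \<psi> z u)"
        by (intro add_mono norm_snd_proj_le H_lip[OF y z u])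
      also have "\<dots> \<le> (1 + K) * norm (\<psi> y u - \<psi> z u)"
        using mult_right_mono[OF mult_left_le_one_le[OF K0 less_imp_le[OF s] s1(1)], of "norm (\<psi> y u - \<psi> z u)"]
        by (simp add: algebra_simps)
      finally show "norm (rhs a (\<psi> y u) - rhs a (\<psi> z u)) \<le> (1 + K) * norm (\<psi> y u - \<psi> z u)" .
    qed
    also have "\<dots> \<le> exp (1 + K) * norm (y - z)"
    proof (rule mult_mono)
      have "(1 + K) * \<bar>t - 0\<bar> \<le> 1 + K" using t K0 by (intro mult_right_le_one_le) auto
      then show "exp ((1 + K) * \<bar>t - 0\<bar>) \<le> exp (1 + K)" by simp
    qed (simp_all add: \<psi>0[OF y] \<psi>0[OF z])
    finally show ?thesis .
  qed
  have est: "norm (fst (\<psi> y 1) - fst (\<psi> z 1) - (fst (y - z) + snd (y - z))) \<le> s * M * norm (y - z)"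
    if y: "y \<in> B" and z: "z \<in> B" for y z
  proof -
    have sub: "t \<in> J" if "t \<in> {0..1}" for t using that unfolding J_def by auto
    have dd: "((\<lambda>t. \<psi> y t - \<psi> z t) has_vector_derivative rhs a (\<psi> y t) - rhs a (\<psi> z t)) (at t within {0..1})"
      if "t \<in> {0..1}" for t
      using has_vector_derivative_diff[OF d\<psi>[OF y sub[OF that]] d\<psi>[OF z sub[OF that]]]
      by (rule has_vector_derivative_at_within)
    have dv: "norm (snd (\<psi> y t - \<psi> z t) - snd (\<psi> y 0 - \<psi> z 0)) \<le> s * M * norm (y - z)" if t: "t \<in> {0..1}" for t
    proof -
      have "norm (snd (\<psi> y t - \<psi> z t) - snd (\<psi> y 0 - \<psi> z 0)) \<le> (s * M * norm (y - z)) * \<bar>t - 0\<bar>"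
      proof (rule vector_mean_value_bound[where I = "{0..1}" and f = "\<lambda>t. snd (\<psi> y t - \<psi> z t)", OF is_interval_cc])
        fix u :: real assume u: "u \<in> {0..1}"
        show "((\<lambda>t. snd (\<psi> y t - \<psi> z t)) has_vector_derivative snd (rhs a (\<psi> y u) - rhs a (\<psi> z u))) (at u within {0..1})"
          by (rule bounded_linear.has_vector_derivative[OF bounded_linear_snd dd[OF u]])
        have "norm (snd (rhs a (\<psi> y u) - rhs a (\<psi> z u))) \<le> s * K * norm (\<psi> y u - \<psi> z u)"
          unfolding rhs_def using H_lip[OF y z sub[OF u]] by simp
        also have "\<dots> \<le> s * K * (exp (1 + K) * norm (y - z))"
          using s K0 by (intro mult_left_mono close[OF y z u]) auto
        also have "\<dots> = s * M * norm (y - z)" unfolding M_def by simp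
        finally show "norm (snd (rhs a (\<psi> y u) - rhs a (\<psi> z u))) \<le> s * M * norm (y - z)" .
      qed (use t in auto)
      also have "\<dots> \<le> s * M * norm (y - z)"
        using t s M0 by (intro mult_right_le_one_le) auto
      finally show ?thesis .
    qed
    \<comment> \<open>Subtracting the uniform motion leaves a curve whose velocity is the deviation estimated in \<open>dv\<close>.\<close>
    let ?w = "\<lambda>t. fst (\<psi> y t - \<psi> z t) - t *\<^sub>R snd (\<psi> y 0 - \<psi> z 0)"
    have w: "norm (?w 1 - ?w 0) \<le> (s * M * norm (y - z)) * \<bar>1 - 0\<bar>"
    proof (rule vector_mean_value_bound[where I = "{0..1}", OF is_interval_cc])
      fix u :: real assume u: "u \<in> {0..1}"
      have "((\<lambda>t. fst (\<psi> y t - \<psi> z t)) has_vector_derivative fst (rhs a (\<psi> y u) - rhs a (\<psi> z u))) (at u within {0..1})"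
        by (rule bounded_linear.has_vector_derivative[OF bounded_linear_fst dd[OF u]])
      moreover have "fst (rhs a (\<psi> y u) - rhs a (\<psi> z u)) = snd (\<psi> y u - \<psi> z u)" unfolding rhs_def by simp
      moreover have "((\<lambda>t. t *\<^sub>R snd (\<psi> y 0 - \<psi> z 0)) has_vector_derivative snd (\<psi> y 0 - \<psi> z 0)) (at u within {0..1})"
        using bounded_linear.has_vector_derivative[OF bounded_linear_scaleR_left has_vector_derivative_id] by simp
      ultimately show "(?w has_vector_derivative snd (\<psi> y u - \<psi> z u) - snd (\<psi> y 0 - \<psi> z 0)) (at u within {0..1})"
        using has_vector_derivative_diff by simp
      show "norm (snd (\<psi> y u - \<psi> z u) - snd (\<psi> y 0 - \<psi> z 0)) \<le> s * M * norm (y - z)" by (rule dv[OF u])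
    qed auto
    have eq: "?w 1 - ?w 0 = fst (\<psi> y 1) - fst (\<psi> z 1) - (fst (y - z) + snd (y - z))"
      by (simp add: \<psi>0[OF y] \<psi>0[OF z])
    show ?thesis using w unfolding eq by simp
  qed
  have BD: "B \<subseteq> ?D" using \<psi>D[OF _ J(3)] \<psi>0 by auto
  have flow: "reaches v 1" "flow v 1 \<in> dom_chart ?c" "coords ?c (flow v 1) = \<psi> (coords ?c v) 1"
    if v: "v \<in> dom_chart ?c" "coords ?c v \<in> B" for v
    using flow_in_chart[OF a J(1-3) \<psi>D[OF v(2)] d\<psi>[OF v(2)] v(1) \<psi>0[OF v(2), symmetric] J(4)] by blast+
  have E: "endpoint_coords a z = fst (\<psi> z 1)" if z: "z \<in> B" for z
  proof -
    obtain v where v: "v \<in> dom_chart ?c" "coords ?c v = z"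
      using point_at_tchart[OF a, of z] BD z by blast
    have "endpoint_coords a z = coords a (base (flow v 1))"
      unfolding endpoint_coords_def v(2)[symmetric] by (rule coord_expr_coords[OF inj_tchart[OF a] v(1)])
    also have "\<dots> = fst (coords ?c (flow v 1))" by (simp add: coords_tchart)
    also have "\<dots> = fst (\<psi> z 1)" using flow(3)[OF v(1)] v(2) z by simp
    finally show ?thesis .
  qed
  show ?thesis
    unfolding shear_nbhd_def
  proof (intro exI conjI allI impI ballI)
    show "open B" by (rule opB)
    show "(coords a p, 0) \<in> B" using z0B unfolding z0_def .
    show "B \<subseteq> ?D" by (rule BD)
    show "reaches v 1" "base (flow v 1) \<in> dom_chart a" if "v \<in> dom_chart ?c" "coords ?c v \<in> B" for v
      using flow[OF that] unfolding dom_tchart by blast+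
    show "norm (endpoint_coords a y - endpoint_coords a z - (fst (y - z) + snd (y - z))) \<le> \<epsilon> * norm (y - z)"
      if "y \<in> B" "z \<in> B" for y z
      using order_trans[OF est[OF that] mult_right_mono[OF sM norm_ge_zero]] unfolding E[OF that(1)] E[OF that(2)] .
  qed
qed

lemma endpoint_coords_strong_at:
  assumes a: "a \<in> A" and p: "p \<in> dom_chart a"
  shows "strong_at (endpoint_coords a) (\<lambda>h. fst h + snd h) (coords a p, 0)"
  unfolding strong_at_def
proof (intro conjI allI impI)
  show "bounded_linear (\<lambda>h :: (real^'n) \<times> (real^'n). fst h + snd h)"
    by (intro bounded_linear_add bounded_linear_fst bounded_linear_snd)
  fix \<epsilon> :: real assume e: "\<epsilon> > 0"
  obtain B where B: "open B" "(coords a p, 0) \<in> B"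
    "\<And>y z. y \<in> B \<Longrightarrow> z \<in> B \<Longrightarrow> norm (endpoint_coords a y - endpoint_coords a z - (fst (y - z) + snd (y - z)))
        \<le> \<epsilon> * norm (y - z)"
    using shear_nbhd_exists[OF a p e] unfolding shear_nbhd_def by blast
  obtain \<delta> where \<delta>: "\<delta> > 0" "ball (coords a p, 0 :: real^'n) \<delta> \<subseteq> B" using B(1,2) open_contains_ball by blast
  show "\<exists>\<delta>>0. \<forall>y\<in>ball (coords a p, 0 :: real^'n) \<delta>. \<forall>z\<in>ball (coords a p, 0 :: real^'n) \<delta>.
      norm (endpoint_coords a y - endpoint_coords a z - (fst (y - z) + snd (y - z))) \<le> \<epsilon> * norm (y - z)"
  proof (intro exI conjI ballI)
    fix y z assume "y \<in> ball (coords a p, 0 :: real^'n) \<delta>" "z \<in> ball (coords a p, 0 :: real^'n) \<delta>"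
    then have "y \<in> B" "z \<in> B" using \<delta>(2) by blast+
    then show "norm (endpoint_coords a y - endpoint_coords a z - (fst (y - z) + snd (y - z))) \<le> \<epsilon> * norm (y - z)"
      by (rule B(3))
  qed (rule \<delta>(1))
qed

lemma exp_domain_near_zero:
  assumes a: "a \<in> A" and p: "p \<in> dom_chart a"
  obtains B where "open B" "(coords a p, 0) \<in> B" "B \<subseteq> coords a ` dom_chart a \<times> UNIV"
    "\<And>v. v \<in> dom_chart (tchart A a) \<Longrightarrow> coords (tchart A a) v \<in> B \<Longrightarrow>
        v \<in> exp_domain X A H \<and> base (flow v 1) \<in> dom_chart a"
proof -
  obtain B where B: "open B" "(coords a p, 0) \<in> B" "B \<subseteq> coords a ` dom_chart a \<times> UNIV"
    "\<And>v. v \<in> dom_chart (tchart A a) \<Longrightarrow> coords (tchart A a) v \<in> B \<Longrightarrow> reaches v 1 \<and> base (flow v 1) \<in> dom_chart a"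
    using shear_nbhd_exists[OF a p zero_less_one] unfolding shear_nbhd_def by blast
  show thesis
  proof (rule that[OF B(1-3)])
    fix v assume v: "v \<in> dom_chart (tchart A a)" "coords (tchart A a) v \<in> B"
    have "v \<in> tangent_bundle A" using v(1) unfolding dom_tchart by (rule conjunct1)
    then show "v \<in> exp_domain X A H \<and> base (flow v 1) \<in> dom_chart a"
      unfolding exp_domain_iff using B(4)[OF v] by blast
  qed
qed

lemma endpoint_coords_zero:
  assumes a: "a \<in> A" and p: "p \<in> dom_chart a"
  shows "endpoint_coords a (coords a p, 0) = coords a p"
proof -
  have pX: "p \<in> topspace X" unfolding topspace_eq using assms by blast
  have z: "zero_tvec p \<in> dom_chart (tchart A a)"
    unfolding dom_tchart base_zero_tvec using zero_tvec_mem[OF pX] p by blast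
  show ?thesis
    unfolding endpoint_coords_def coords_zero_tvec[symmetric] coord_expr_coords[OF inj_tchart[OF a] z]
    by (simp add: endpoint_zero[OF pX])
qed

lemma strong_at_transition_endpoint:
  assumes a: "a \<in> A" "p \<in> dom_chart a" and b: "b \<in> A" "p \<in> dom_chart b"
  shows "\<exists>L. strong_at (\<lambda>z. transition a b (endpoint_coords a z)) L (coords a p, 0)"
proof -
  have "strong_at (transition a b) (frechet_derivative (transition a b) (at (coords a p))) (endpoint_coords a (coords a p, 0))"
    unfolding endpoint_coords_zero[OF a] by (rule transition_strong_at[OF a(1) b(1)]) (use a b in blast)
  from strong_at_compose[OF endpoint_coords_strong_at[OF a] this] show ?thesis by blast
qed

text \<open>In the chart \<open>a\<close> for source and target this is \<open>endpoint_coords_strong_at\<close>; other target charts \<open>b\<close>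
  and \<open>c\<close> are reached by composing with transition maps, which are strongly differentiable. The
  identity of the coordinate expressions holds on the whole set \<open>B\<close>, where the end points lie in the
  domain of \<open>a\<close>.\<close>

lemma exp_strongly_differentiable:
  assumes p: "p \<in> topspace X"
  shows "strongly_differentiable_map (tangent_charts A) (prod_charts A A)
    (exp_domain X A H) (exp_map X A H) (zero_tvec p)"
  unfolding strongly_differentiable_map_def
proof (intro conjI ballI impI)
  show zD: "zero_tvec p \<in> exp_domain X A H" by (rule zero_in_exp_domain[OF p])
  show "zero_tvec p \<in> \<Union>(dom_chart ` tangent_charts A)" "exp_map X A H (zero_tvec p) \<in> \<Union>(dom_chart ` prod_charts A A)"
    using exp_map_lipschitz zD unfolding locally_lipschitz_map_def by blast+
  fix a' b' assume a': "a' \<in> tangent_charts A" "zero_tvec p \<in> dom_chart a'"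
    and b': "b' \<in> prod_charts A A" "exp_map X A H (zero_tvec p) \<in> dom_chart b'"
  have int: "coords a' (zero_tvec p) \<in> interior (coords a' ` {u \<in> dom_chart a' \<inter> exp_domain X A H. exp_map X A H u \<in> dom_chart b'})"
    using exp_map_lipschitz zD a' b' unfolding locally_lipschitz_map_iff lip_in_def by blast
  obtain a where a: "a \<in> A" "a' = tchart A a" using a'(1) unfolding tangent_charts_eq by blast
  have pa: "p \<in> dom_chart a" using a'(2) unfolding a(2) dom_tchart base_zero_tvec by blast
  obtain b c where bc: "b \<in> A" "c \<in> A" "b' = prod_chart b c" using b'(1) unfolding prod_charts_def by blast
  have pbc: "p \<in> dom_chart b" "p \<in> dom_chart c"
    using b'(2) unfolding bc(3) prod_chart_def exp_map_eq[OF zD] endpoint_zero[OF p] base_zero_tvec by auto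
  obtain B where B: "open B" "(coords a p, 0) \<in> B" "B \<subseteq> coords a ` dom_chart a \<times> UNIV"
    "\<And>v. v \<in> dom_chart (tchart A a) \<Longrightarrow> coords (tchart A a) v \<in> B \<Longrightarrow>
        v \<in> exp_domain X A H \<and> base (flow v 1) \<in> dom_chart a"
    using exp_domain_near_zero[OF a(1) pa] by blast
  obtain L2 where L2: "strong_at (\<lambda>z. transition a c (endpoint_coords a z)) L2 (coords a p, 0)"
    using strong_at_transition_endpoint[OF a(1) pa bc(2) pbc(2)] by blast
  have "strong_at (transition a b) (frechet_derivative (transition a b) (at (coords a p))) (fst (coords a p, 0 :: real^'n))"
    using transition_strong_at[OF a(1) bc(1)] pa pbc by simp
  from strong_at_compose[OF strong_at_bounded_linear[OF bounded_linear_fst] this]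
  obtain L1 where L1: "strong_at (\<lambda>z :: (real^'n) \<times> (real^'n). transition a b (fst z)) L1 (coords a p, 0)" by blast
  have "strong_at (coord_expr a' b' (exp_map X A H)) (\<lambda>h. (L1 h, L2 h)) (coords a p, 0)"
  proof (rule strong_at_cong[OF strong_at_Pair[OF L1 L2] B(1,2)])
    fix z assume z: "z \<in> B"
    obtain v where v: "v \<in> dom_chart (tchart A a)" "coords (tchart A a) v = z"
      using point_at_tchart[OF a(1), of z] B(3) z by blast
    have vB: "v \<in> exp_domain X A H" "base (flow v 1) \<in> dom_chart a" using B(4)[OF v(1)] v(2) z by blast+
    have va: "base v \<in> dom_chart a" using v(1) unfolding dom_tchart by blast
    have E: "endpoint_coords a z = coords a (base (flow v 1))"
      unfolding endpoint_coords_def v(2)[symmetric] by (rule coord_expr_coords[OF inj_tchart[OF a(1)] v(1)])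
    have "coord_expr a' b' (exp_map X A H) z = coords b' (exp_map X A H v)"
      unfolding v(2)[symmetric] a(2) by (rule coord_expr_coords[OF inj_tchart[OF a(1)] v(1)])
    also have "\<dots> = (coords b (base v), coords c (base (flow v 1)))"
      unfolding exp_map_eq[OF vB(1)] bc(3) prod_chart_def by simp
    also have "\<dots> = (transition a b (fst z), transition a c (endpoint_coords a z))"
      unfolding E transition_coords[OF inj_coords[OF a(1)] vB(2)]
      using transition_coords[OF inj_coords[OF a(1)] va, of b] unfolding v(2)[symmetric] coords_tchart by simp
    finally show "(transition a b (fst z), transition a c (endpoint_coords a z)) = coord_expr a' b' (exp_map X A H) z"
      by (rule sym)
  qed
  then have "strong_at (coord_expr a' b' (exp_map X A H)) (\<lambda>h. (L1 h, L2 h)) (coords a' (zero_tvec p))"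
    unfolding a(2) coords_zero_tvec .
  then show "\<exists>S L. S \<subseteq> coords a' ` {u \<in> dom_chart a' \<inter> exp_domain X A H. exp_map X A H u \<in> dom_chart b'} \<and>
      has_strong_derivative (coord_expr a' b' (exp_map X A H)) L S (coords a' (zero_tvec p))"
    using int by (rule strong_at_imp_has_strong_derivative)
qed

lemma exp_at_strongly_differentiable:
  assumes p: "p \<in> topspace X"
  shows "strongly_differentiable_map (fibre_charts A p) A
    (exp_domain_at X A H p) (exp_at X A H) (zero_tvec p)"
  unfolding strongly_differentiable_map_def
proof (intro conjI ballI impI)
  have zD: "zero_tvec p \<in> exp_domain X A H" by (rule zero_in_exp_domain[OF p])
  show zDp: "zero_tvec p \<in> exp_domain_at X A H p"
    unfolding exp_domain_at_eq tangent_space_def using zD zero_tvec_mem[OF p] by (simp add: base_zero_tvec)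
  show "zero_tvec p \<in> \<Union>(dom_chart ` fibre_charts A p)" "exp_at X A H (zero_tvec p) \<in> \<Union>(dom_chart ` A)"
    using exp_at_lipschitz[OF p] zDp unfolding locally_lipschitz_map_def by blast+
  fix a' b assume a': "a' \<in> fibre_charts A p" "zero_tvec p \<in> dom_chart a'"
    and b: "b \<in> A" "exp_at X A H (zero_tvec p) \<in> dom_chart b"
  have int: "coords a' (zero_tvec p) \<in> interior (coords a' ` {u \<in> dom_chart a' \<inter> exp_domain_at X A H p. exp_at X A H u \<in> dom_chart b})"
    using exp_at_lipschitz[OF p] zDp a' b unfolding locally_lipschitz_map_iff lip_in_def by blast
  obtain a where a: "a \<in> A" "p \<in> dom_chart a" "a' = fchart A p a" using a'(1) unfolding fibre_charts_eq by blast
  have pb: "p \<in> dom_chart b" using b(2) unfolding exp_at_eq[OF zD] endpoint_zero[OF p] .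
  obtain B where B: "open B" "(coords a p, 0) \<in> B" "B \<subseteq> coords a ` dom_chart a \<times> UNIV"
    "\<And>v. v \<in> dom_chart (tchart A a) \<Longrightarrow> coords (tchart A a) v \<in> B \<Longrightarrow>
        v \<in> exp_domain X A H \<and> base (flow v 1) \<in> dom_chart a"
    using exp_domain_near_zero[OF a(1,2)] by blast
  obtain L where "strong_at (\<lambda>z. transition a b (endpoint_coords a z)) L (coords a p, 0)"
    using strong_at_transition_endpoint[OF a(1,2) b(1) pb] by blast
  from strong_at_compose[OF strong_at_Pair[OF strong_at_const strong_at_bounded_linear[OF bounded_linear_ident]] this]
  have L: "strong_at (\<lambda>w. transition a b (endpoint_coords a (coords a p, w))) (\<lambda>h. L (0, h)) 0" .
  have "strong_at (coord_expr a' b (exp_at X A H)) (\<lambda>h. L (0, h)) 0"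
  proof (rule strong_at_cong[OF L])
    show "open ((\<lambda>w. (coords a p, w)) -` B)" by (intro open_vimage B(1) continuous_intros)
    show "0 \<in> (\<lambda>w. (coords a p, w)) -` B" using B(2) by simp
    fix w assume "w \<in> (\<lambda>w. (coords a p, w)) -` B"
    then have w: "(coords a p, w) \<in> B" by simp
    have dom: "dom_chart (fchart A p a) = tangent_space A p" unfolding fchart_def by simp
    have "w \<in> coords (fchart A p a) ` dom_chart (fchart A p a)" unfolding fchart_image[OF a(1,2)] by simp
    then obtain v where v: "v \<in> dom_chart (fchart A p a)" "w = coords (fchart A p a) v" by blast
    have vp: "v \<in> tangent_bundle A" "base v = p" using v(1) unfolding dom tangent_space_def by auto
    have vt: "v \<in> dom_chart (tchart A a)" "coords (tchart A a) v = (coords a p, w)"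
      unfolding dom_tchart coords_tchart vp(2) v(2) using vp(1) a(2) by (auto simp: fchart_def)
    have vB: "v \<in> exp_domain X A H" "base (flow v 1) \<in> dom_chart a" using B(4)[OF vt(1)] vt(2) w by auto
    have E: "endpoint_coords a (coords a p, w) = coords a (base (flow v 1))"
      unfolding endpoint_coords_def vt(2)[symmetric] by (rule coord_expr_coords[OF inj_tchart[OF a(1)] vt(1)])
    have "coord_expr a' b (exp_at X A H) w = coords b (exp_at X A H v)"
      unfolding v(2) a(3) by (rule coord_expr_coords[OF inj_fchart[OF a(1,2)] v(1)])
    then show "transition a b (endpoint_coords a (coords a p, w)) = coord_expr a' b (exp_at X A H) w"
      unfolding E transition_coords[OF inj_coords[OF a(1)] vB(2)] exp_at_eq[OF vB(1)] by simp
  qed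
  moreover have "coords a' (zero_tvec p) = 0" unfolding a(3) fchart_def zero_tvec_def by simp
  ultimately have "strong_at (coord_expr a' b (exp_at X A H)) (\<lambda>h. L (0, h)) (coords a' (zero_tvec p))" by simp
  then show "\<exists>S L. S \<subseteq> coords a' ` {u \<in> dom_chart a' \<inter> exp_domain_at X A H p. exp_at X A H u \<in> dom_chart b} \<and>
      has_strong_derivative (coord_expr a' b (exp_at X A H)) L S (coords a' (zero_tvec p))"
    using int by (rule strong_at_imp_has_strong_derivative)
qed

end

section \<open>The exponential map as a Lipeomorphism\<close>

context spray_manifold
begin

definition box_nbhd :: "('p, real^'n) chart \<Rightarrow> 'p \<Rightarrow> real \<Rightarrow> ((real^'n) \<times> (real^'n)) set" where
  "box_nbhd a p \<rho> = ball (coords a p) \<rho> \<times> ball 0 \<rho>"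

definition tvec_nbhd :: "('p, real^'n) chart \<Rightarrow> 'p \<Rightarrow> real \<Rightarrow> ('p, 'n) tvec set" where
  "tvec_nbhd a p \<rho> = {v \<in> dom_chart (tchart A a). coords (tchart A a) v \<in> box_nbhd a p \<rho>}"

text \<open>The box of size \<open>\<rho>\<close> in the tangent chart is a star-shaped neighborhood of the zero vector at \<open>p\<close> on
  which the exponential map is expansive. The constant 6 is \<open>2 / (1 / 3)\<close>, from \<open>strong_at_expansive\<close>
  and \<open>shear_expansive\<close>.\<close>

definition adapted :: "('p, real^'n) chart \<Rightarrow> 'p \<Rightarrow> real \<Rightarrow> bool" where
  "adapted a p \<rho> \<longleftrightarrow> a \<in> A \<and> p \<in> dom_chart a \<and> \<rho> > 0 \<and> ball (coords a p) \<rho> \<subseteq> coords a ` dom_chart a \<and>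
     (\<forall>v\<in>tvec_nbhd a p \<rho>. v \<in> exp_domain X A H \<and> base (flow v 1) \<in> dom_chart a) \<and>
     (\<forall>y\<in>box_nbhd a p \<rho>. \<forall>z\<in>box_nbhd a p \<rho>.
        dist y z \<le> 6 * dist (fst y, endpoint_coords a y) (fst z, endpoint_coords a z))"

lemma adapted_exists:
  assumes a: "a \<in> A" and p: "p \<in> dom_chart a"
  shows "\<exists>\<rho>. adapted a p \<rho>"
proof -
  let ?G = "\<lambda>z. (fst z, endpoint_coords a z)"
  let ?z0 = "(coords a p, 0 :: real^'n)"
  have G: "strong_at ?G (\<lambda>h. (fst h, fst h + snd h)) ?z0"
    by (rule strong_at_Pair[OF strong_at_bounded_linear[OF bounded_linear_fst] endpoint_coords_strong_at[OF a p]])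
  have "(1 / 3 :: real) > 0" by simp
  then obtain r where r: "r > 0" "\<And>y z. y \<in> ball ?z0 r \<Longrightarrow> z \<in> ball ?z0 r \<Longrightarrow>
      dist y z \<le> 2 / (1 / 3) * dist (?G y) (?G z)"
    using strong_at_expansive[OF G _ shear_expansive] by blast
  obtain B where B: "open B" "?z0 \<in> B" "B \<subseteq> coords a ` dom_chart a \<times> UNIV"
    "\<And>v. v \<in> dom_chart (tchart A a) \<Longrightarrow> coords (tchart A a) v \<in> B \<Longrightarrow>
        v \<in> exp_domain X A H \<and> base (flow v 1) \<in> dom_chart a"
    using exp_domain_near_zero[OF a p] by blast
  have "open (B \<inter> ball ?z0 r)" "?z0 \<in> B \<inter> ball ?z0 r" using B r(1) by auto
  then obtain e where e: "e > 0" "ball ?z0 e \<subseteq> B \<inter> ball ?z0 r" using open_contains_ball by blast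
  \<comment> \<open>The box of half-size \<open>e / 2\<close> fits into the ball of radius \<open>e\<close> of the product, by the triangle inequality.\<close>
  define \<rho> where "\<rho> = e / 2"
  have \<rho>: "\<rho> > 0" unfolding \<rho>_def using e(1) by simp
  have box: "box_nbhd a p \<rho> \<subseteq> ball ?z0 e"
  proof
    fix z assume "z \<in> box_nbhd a p \<rho>"
    then have "norm (coords a p - fst z) < \<rho>" "norm (0 - snd z) < \<rho>"
      unfolding box_nbhd_def by (auto simp: dist_norm)
    then have "norm (coords a p - fst z, 0 - snd z) < \<rho> + \<rho>"
      using norm_Pair_le[of "coords a p - fst z" "0 - snd z"] by linarith
    then show "z \<in> ball ?z0 e" unfolding \<rho>_def by (cases z) (simp add: dist_norm)
  qed
  have "ball (coords a p) \<rho> \<subseteq> coords a ` dom_chart a"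
  proof
    fix x assume "x \<in> ball (coords a p) \<rho>"
    then have "(x, 0) \<in> box_nbhd a p \<rho>" unfolding box_nbhd_def using \<rho> by simp
    then have "(x, 0) \<in> coords a ` dom_chart a \<times> (UNIV :: (real^'n) set)" using box e(2) B(3) by blast
    then show "x \<in> coords a ` dom_chart a" by simp
  qed
  moreover have "v \<in> exp_domain X A H \<and> base (flow v 1) \<in> dom_chart a" if "v \<in> tvec_nbhd a p \<rho>" for v
    using that box e(2) B(4)[of v] unfolding tvec_nbhd_def by blast
  moreover have "dist y z \<le> 6 * dist (?G y) (?G z)" if "y \<in> box_nbhd a p \<rho>" "z \<in> box_nbhd a p \<rho>" for y z
  proof -
    have "y \<in> ball ?z0 r" "z \<in> ball ?z0 r" using that box e(2) by blast+
    from r(2)[OF this] show ?thesis by simp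
  qed
  ultimately show ?thesis unfolding adapted_def using a p \<rho> by blast
qed

lemma adaptedD:
  assumes "adapted a p \<rho>"
  shows "a \<in> A" "p \<in> dom_chart a" "\<rho> > 0" "ball (coords a p) \<rho> \<subseteq> coords a ` dom_chart a"
    "v \<in> tvec_nbhd a p \<rho> \<Longrightarrow> v \<in> exp_domain X A H" "v \<in> tvec_nbhd a p \<rho> \<Longrightarrow> base (flow v 1) \<in> dom_chart a"
    "y \<in> box_nbhd a p \<rho> \<Longrightarrow> z \<in> box_nbhd a p \<rho> \<Longrightarrow>
      dist y z \<le> 6 * dist (fst y, endpoint_coords a y) (fst z, endpoint_coords a z)"
  using assms unfolding adapted_def by blast+

lemma tvec_nbhd_iff:
  "v \<in> tvec_nbhd a p \<rho> \<longleftrightarrow> v \<in> tangent_bundle A \<and> base v \<in> dom_chart a \<and>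
    coords a (base v) \<in> ball (coords a p) \<rho> \<and> components v a \<in> ball 0 \<rho>"
  unfolding tvec_nbhd_def box_nbhd_def dom_tchart coords_tchart by blast

lemma endpoint_coords_eq:
  "a \<in> A \<Longrightarrow> v \<in> dom_chart (tchart A a) \<Longrightarrow>
    endpoint_coords a (coords (tchart A a) v) = coords a (base (flow v 1))"
  unfolding endpoint_coords_def by (rule coord_expr_coords[OF inj_tchart])

lemma tvec_nbhd_openin: "a \<in> A \<Longrightarrow> openin (tangent_topology A) (tvec_nbhd a p \<rho>)"
  unfolding tvec_nbhd_def box_nbhd_def
  by (intro openin_chart_preimage[OF tangent_atlas tchart_mem] open_Times open_ball)

lemma exp_inj_on_tvec_nbhd:
  assumes ad: "adapted a p \<rho>" and v: "v \<in> tvec_nbhd a p \<rho>" and w: "w \<in> tvec_nbhd a p \<rho>"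
    and eq: "base v = base w" "base (flow v 1) = base (flow w 1)"
  shows "v = w"
proof -
  note a = adaptedD(1)[OF ad]
  let ?y = "coords (tchart A a) v" and ?z = "coords (tchart A a) w"
  have d: "v \<in> dom_chart (tchart A a)" "w \<in> dom_chart (tchart A a)" "?y \<in> box_nbhd a p \<rho>" "?z \<in> box_nbhd a p \<rho>"
    using v w unfolding tvec_nbhd_def by blast+
  have "dist ?y ?z \<le> 6 * dist (fst ?y, endpoint_coords a ?y) (fst ?z, endpoint_coords a ?z)"
    by (rule adaptedD(7)[OF ad d(3,4)])
  also have "\<dots> = 0"
    unfolding endpoint_coords_eq[OF a d(1)] endpoint_coords_eq[OF a d(2)] using eq by (simp add: coords_tchart)
  finally show ?thesis using inj_onD[OF inj_tchart[OF a] _ d(1,2)] by simp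
qed

text \<open>The exponential map has the base point as its first component, so that its injectivity is a question
  about each fibre separately. This is why it suffices that any two vectors of \<open>N\<close> over the same point
  lie in a common adapted neighborhood, although different points may need different ones.\<close>

lemma lipeomorphism_exp_map:
  assumes N: "openin (tangent_topology A) N"
    and cover: "\<And>v. v \<in> N \<Longrightarrow> \<exists>a p \<rho>. adapted a p \<rho> \<and> v \<in> tvec_nbhd a p \<rho>"
    and common: "\<And>v w. v \<in> N \<Longrightarrow> w \<in> N \<Longrightarrow> base v = base w \<Longrightarrow>
      \<exists>a p \<rho>. adapted a p \<rho> \<and> v \<in> tvec_nbhd a p \<rho> \<and> w \<in> tvec_nbhd a p \<rho>"
  shows "openin (prod_topology X X) (exp_map X A H ` N)"
    and "lipeomorphism (tangent_topology A) (prod_topology X X) (tangent_charts A) (prod_charts A A)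
      N (exp_map X A H ` N) (exp_map X A H)"
proof -
  have sub: "N \<subseteq> exp_domain X A H"
  proof
    fix v assume "v \<in> N"
    then obtain a p \<rho> where "adapted a p \<rho>" "v \<in> tvec_nbhd a p \<rho>" using cover by blast
    then show "v \<in> exp_domain X A H" by (rule adaptedD(5))
  qed
  have inj: "inj_on (exp_map X A H) N"
  proof (rule inj_onI)
    fix v w assume v: "v \<in> N" and w: "w \<in> N" and eq: "exp_map X A H v = exp_map X A H w"
    then have eq': "base v = base w" "base (flow v 1) = base (flow w 1)"
      unfolding exp_map_eq[OF subsetD[OF sub v]] exp_map_eq[OF subsetD[OF sub w]] prod.inject by simp_all
    obtain a p \<rho> where "adapted a p \<rho>" "v \<in> tvec_nbhd a p \<rho>" "w \<in> tvec_nbhd a p \<rho>"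
      using common[OF v w eq'(1)] by blast
    then show "v = w" using eq' by (rule exp_inj_on_tvec_nbhd)
  qed
  have local: "\<exists>b\<in>tangent_charts A. \<exists>c\<in>prod_charts A A. lip_in b c N (exp_map X A H) v \<and>
      (\<exists>S m. open S \<and> coords b v \<in> S \<and>
        (\<forall>y\<in>S. \<forall>z\<in>S. dist y z \<le> m * dist (coord_expr b c (exp_map X A H) y) (coord_expr b c (exp_map X A H) z)))"
    if v: "v \<in> N" for v
  proof -
    obtain a p \<rho> where ad: "adapted a p \<rho>" and va: "v \<in> tvec_nbhd a p \<rho>" using cover[OF v] by blast
    note a = adaptedD(1)[OF ad]
    let ?b = "tchart A a" and ?c = "prod_chart a a"
    have bc: "?b \<in> tangent_charts A" "?c \<in> prod_charts A A"
      using a tchart_mem unfolding prod_charts_def by blast+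
    have vd: "v \<in> dom_chart ?b" "coords ?b v \<in> box_nbhd a p \<rho>" using va unfolding tvec_nbhd_def by blast+
    have "exp_map X A H v \<in> dom_chart ?c"
      unfolding exp_map_eq[OF adaptedD(5)[OF ad va]] prod_chart_def
      using adaptedD(6)[OF ad va] vd(1) unfolding dom_tchart by simp
    then have "lip_in ?b ?c (exp_domain X A H) (exp_map X A H) v"
      using exp_map_lipschitz subsetD[OF sub v] bc vd(1) unfolding locally_lipschitz_map_iff by blast
    then have lip: "lip_in ?b ?c N (exp_map X A H) v"
      by (rule lip_in_subset[OF tangent_atlas bc(1) _ N sub v])
    have expr: "coord_expr ?b ?c (exp_map X A H) y = (fst y, endpoint_coords a y)" if y: "y \<in> box_nbhd a p \<rho>" for y
    proof -
      have "y \<in> coords a ` dom_chart a \<times> UNIV"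
        using y adaptedD(4)[OF ad] unfolding box_nbhd_def by auto
      from point_at_tchart[OF a this] obtain u where u: "u \<in> dom_chart ?b" "y = coords ?b u" by metis
      then have "u \<in> exp_domain X A H"
        using adaptedD(5)[OF ad, of u] y unfolding tvec_nbhd_def by blast
      then show ?thesis
        unfolding u(2) coord_expr_coords[OF inj_tchart[OF a] u(1)] endpoint_coords_eq[OF a u(1)] prod_chart_def
        by (simp add: exp_map_eq coords_tchart)
    qed
    have "open (box_nbhd a p \<rho>)" unfolding box_nbhd_def by (intro open_Times open_ball)
    moreover have "dist y z \<le> 6 * dist (coord_expr ?b ?c (exp_map X A H) y) (coord_expr ?b ?c (exp_map X A H) z)"
      if "y \<in> box_nbhd a p \<rho>" "z \<in> box_nbhd a p \<rho>" for y z
      unfolding expr[OF that(1)] expr[OF that(2)] by (rule adaptedD(7)[OF ad that])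
    ultimately show ?thesis using bc lip vd(2) by blast
  qed
  note * = lipeomorphismI[OF tangent_atlas lip_atlas_prod[OF atlas atlas] inj local]
  show "openin (prod_topology X X) (exp_map X A H ` N)"
    using *(1) unfolding chart_topology_prod_charts[OF atlas atlas] chart_topology_eq .
  show "lipeomorphism (tangent_topology A) (prod_topology X X) (tangent_charts A) (prod_charts A A)
      N (exp_map X A H ` N) (exp_map X A H)"
    using *(2) unfolding chart_topology_prod_charts[OF atlas atlas] chart_topology_eq .
qed

text \<open>The preimage of a compact ball contained in the image of the chart is compact, hence closed in the
  Hausdorff space \<open>X\<close>. Without this, points could enter its closure from outside the chart.\<close>

lemma closedin_chart_cball:
  assumes ad: "adapted a p \<rho>"
  shows "closedin X {q \<in> dom_chart a. coords a q \<in> cball (coords a p) (\<rho> / 2)}" (is "closedin X ?C")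
proof -
  note a = adaptedD(1)[OF ad]
  have sub: "?C \<subseteq> dom_chart a" by blast
  have "cball (coords a p) (\<rho> / 2) \<subseteq> ball (coords a p) \<rho>" using adaptedD(3)[OF ad] by auto
  then have cb: "cball (coords a p) (\<rho> / 2) \<subseteq> coords a ` dom_chart a" using adaptedD(4)[OF ad] by blast
  then have im: "coords a ` ?C = cball (coords a p) (\<rho> / 2)" by auto
  have "compactin (top_of_set (coords a ` dom_chart a)) (coords a ` ?C)"
    unfolding im compactin_subtopology using cb compact_cball by simp
  then have "compactin (subtopology X (dom_chart a)) ?C"
    using homeomorphic_map_compactness[OF chart(3)[OF a], of ?C] unfolding topspace_chart[OF a] using sub by blast
  then have "compactin X ?C" unfolding compactin_subtopology by blast
  moreover have "Hausdorff_space X"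
    using manifold unfolding C21_manifold_def paracompact_space_def by blast
  ultimately show ?thesis by (rule compactin_imp_closedin[rotated])
qed

text \<open>Refining the cover by the preimages of balls of half the adapted radius keeps the closures of the
  members inside the balls of full radius.\<close>

lemma locally_finite_adapted_cover:
  obtains \<V> :: "'p set set" and a p \<rho> where "locally_finite_in X \<V>" "\<Union>\<V> = topspace X"
    "\<And>V. V \<in> \<V> \<Longrightarrow> adapted (a V) (p V) (\<rho> V)"
    "\<And>V q. V \<in> \<V> \<Longrightarrow> q \<in> X closure_of V \<Longrightarrow> q \<in> dom_chart (a V) \<and> coords (a V) q \<in> ball (coords (a V) (p V)) (\<rho> V)"
proof -
  define W :: "('p, real^'n) chart \<times> 'p \<times> real \<Rightarrow> 'p set" where "W = (\<lambda>(a, p, \<rho>). {q \<in> dom_chart a. coords a q \<in> ball (coords a p) (\<rho> / 2)})"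
  define \<U> where "\<U> = W ` {(a, p, \<rho>). adapted a p \<rho>}"
  have "openin X U" if "U \<in> \<U>" for U
  proof -
    obtain a p \<rho> where ap: "adapted a p \<rho>" "U = W (a, p, \<rho>)" using \<open>U \<in> \<U>\<close> unfolding \<U>_def by blast
    show ?thesis
      using openin_chart_preimage[OF atlas adaptedD(1)[OF ap(1)] open_ball[of "coords a p" "\<rho> / 2"]]
      unfolding ap(2) W_def chart_topology_eq case_prod_conv .
  qed
  moreover have "\<Union>\<U> = topspace X"
  proof
    show "\<Union>\<U> \<subseteq> topspace X" using calculation openin_subset by blast
    show "topspace X \<subseteq> \<Union>\<U>"
    proof
      fix p assume "p \<in> topspace X"
      then obtain a where a: "a \<in> A" "p \<in> dom_chart a" unfolding topspace_eq by blast
      then obtain \<rho> where ad: "adapted a p \<rho>" using adapted_exists by blast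
      then have "p \<in> W (a, p, \<rho>)" unfolding W_def using a adaptedD(3)[OF ad] by simp
      with ad show "p \<in> \<Union>\<U>" unfolding \<U>_def by blast
    qed
  qed
  ultimately obtain \<V> where \<V>: "\<forall>V\<in>\<V>. openin X V \<and> (\<exists>U\<in>\<U>. V \<subseteq> U)" "\<Union>\<V> = topspace X" "locally_finite_in X \<V>"
    using manifold unfolding C21_manifold_def paracompact_space_def by meson
  have "\<forall>V\<in>\<V>. \<exists>t. (case t of (a, p, \<rho>) \<Rightarrow> adapted a p \<rho>) \<and> V \<subseteq> W t"
    using \<V>(1) unfolding \<U>_def by blast
  from bchoice[OF this] obtain t where t: "\<forall>V\<in>\<V>. (case t V of (a, p, \<rho>) \<Rightarrow> adapted a p \<rho>) \<and> V \<subseteq> W (t V)" by blast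
  define a where "a V = fst (t V)" for V
  define p where "p V = fst (snd (t V))" for V
  define \<rho> where "\<rho> V = snd (snd (t V))" for V
  have t_eq: "t V = (a V, p V, \<rho> V)" for V unfolding a_def p_def \<rho>_def by simp
  have ad: "adapted (a V) (p V) (\<rho> V)" and VW: "V \<subseteq> W (a V, p V, \<rho> V)" if "V \<in> \<V>" for V
    using t that unfolding t_eq by auto
  have cl: "q \<in> dom_chart (a V) \<and> coords (a V) q \<in> ball (coords (a V) (p V)) (\<rho> V)"
    if V: "V \<in> \<V>" and q: "q \<in> X closure_of V" for V q
  proof -
    let ?C = "{q \<in> dom_chart (a V). coords (a V) q \<in> cball (coords (a V) (p V)) (\<rho> V / 2)}"
    have "V \<subseteq> ?C" using VW[OF V] unfolding W_def by auto
    then have "X closure_of V \<subseteq> ?C" by (rule closure_of_minimal[OF _ closedin_chart_cball[OF ad[OF V]]])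
    moreover have "\<rho> V > 0" by (rule adaptedD(3)[OF ad[OF V]])
    ultimately show ?thesis using q by auto
  qed
  show thesis by (rule that[OF \<V>(3,2) ad cl])
qed

text \<open>The set \<open>N\<close> consists of the vectors that lie in the adapted neighborhood of \<open>V\<close> for every member \<open>V\<close> of
  the cover whose closure contains their base point. Asking this for the closure, and not only for
  \<open>V\<close> itself, makes \<open>N\<close> open: by local finiteness finitely many \<open>V\<close> matter near a point, and those whose
  closure does not contain it are avoided in a neighborhood. Vectors over the same point satisfy the
  same conditions, and there is at least one, so they share an adapted neighborhood.\<close>

lemma exp_lipeomorphism:
  "\<exists>N W. openin (tangent_topology A) N \<and> N \<subseteq> exp_domain X A H \<and> star_shaped N \<and>
     zero_tvec ` topspace X \<subseteq> N \<and>
     openin (prod_topology X X) W \<and> (\<lambda>p. (p, p)) ` topspace X \<subseteq> W \<and>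
     lipeomorphism (tangent_topology A) (prod_topology X X)
       (tangent_charts A) (prod_charts A A) N W (exp_map X A H)"
proof -
  obtain \<V> :: "'p set set" and a p \<rho> where \<V>: "locally_finite_in X \<V>" "\<Union>\<V> = topspace X" and
    ad: "\<And>V. V \<in> \<V> \<Longrightarrow> adapted (a V) (p V) (\<rho> V)" and
    cl: "\<And>V q. V \<in> \<V> \<Longrightarrow> q \<in> X closure_of V \<Longrightarrow>
      q \<in> dom_chart (a V) \<and> coords (a V) q \<in> ball (coords (a V) (p V)) (\<rho> V)"
    by (rule locally_finite_adapted_cover) (rule that)
  define T where "T V = tvec_nbhd (a V) (p V) (\<rho> V)" for V
  define N where "N = {v \<in> tangent_bundle A. \<forall>V\<in>\<V>. base v \<in> X closure_of V \<longrightarrow> v \<in> T V}"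
  have in_cl: "\<exists>V\<in>\<V>. q \<in> X closure_of V" if q: "q \<in> topspace X" for q
  proof -
    obtain V where V: "V \<in> \<V>" "q \<in> V" using q \<V>(2) by blast
    have "V \<subseteq> topspace X" using V(1) \<V>(2) by blast
    then have "V \<subseteq> X closure_of V" by (rule closure_of_subset)
    with V show ?thesis by blast
  qed
  have common: "\<exists>a p \<rho>. adapted a p \<rho> \<and> v \<in> tvec_nbhd a p \<rho> \<and> w \<in> tvec_nbhd a p \<rho>"
    if v: "v \<in> N" and w: "w \<in> N" and eq: "base v = base w" for v w
  proof -
    have "v \<in> tangent_bundle A" using v unfolding N_def by blast
    then obtain V where V: "V \<in> \<V>" "base v \<in> X closure_of V" using in_cl tangent_bundle_base by blast
    have "v \<in> T V" "w \<in> T V" using v w V eq unfolding N_def by auto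
    with ad[OF V(1)] show ?thesis unfolding T_def by blast
  qed
  have open_base: "openin (tangent_topology A) {v \<in> tangent_bundle A. base v \<in> U}" if "openin X U" for U
    by (rule locally_lipschitz_map_preimage_openin[OF tangent_atlas atlas base_lipschitz]) (simp add: chart_topology_eq that)
  have N_open: "openin (tangent_topology A) N"
  proof (subst openin_subopen, intro ballI)
    fix v assume v: "v \<in> N"
    then have vT: "v \<in> tangent_bundle A" unfolding N_def by blast
    obtain U where U: "openin X U" "base v \<in> U" "finite {V \<in> \<V>. V \<inter> U \<noteq> {}}"
      using \<V>(1) tangent_bundle_base[OF vT] unfolding locally_finite_in_def by blast
    let ?F = "{V \<in> \<V>. V \<inter> U \<noteq> {}}"
    define G where "G V = (if base v \<in> X closure_of V then T V
        else {u \<in> tangent_bundle A. base u \<in> topspace X - X closure_of V})" for V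
    let ?O = "{u \<in> tangent_bundle A. base u \<in> U} \<inter> \<Inter>(insert (tangent_bundle A) (G ` ?F))"
    have G: "openin (tangent_topology A) (G V)" if "V \<in> ?F" for V
    proof (cases "base v \<in> X closure_of V")
      case True
      then show ?thesis unfolding G_def T_def using tvec_nbhd_openin adaptedD(1)[OF ad] that by simp
    next
      case False
      have "openin X (topspace X - X closure_of V)" by (intro openin_diff openin_topspace closedin_closure_of)
      from open_base[OF this] show ?thesis unfolding G_def using False by (simp only: if_False)
    qed
    have TM: "openin (tangent_topology A) (tangent_bundle A)"
      unfolding topspace_tangent[symmetric] by (rule openin_topspace)
    have "openin (tangent_topology A) (\<Inter>(insert (tangent_bundle A) (G ` ?F)))"
      by (rule openin_Inter) (use U(3) G TM in auto)
    then have "openin (tangent_topology A) ?O" by (rule openin_Int[OF open_base[OF U(1)]])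
    moreover have "v \<in> ?O"
    proof -
      have "v \<in> G V" if "V \<in> ?F" for V
        using v vT that tangent_bundle_base[OF vT] unfolding G_def N_def by auto
      then show ?thesis using vT U(2) by blast
    qed
    moreover have "?O \<subseteq> N"
    proof
      fix u assume u: "u \<in> ?O"
      then have uT: "u \<in> tangent_bundle A" "base u \<in> U" by blast+
      have "u \<in> T V" if V: "V \<in> \<V>" "base u \<in> X closure_of V" for V
      proof -
        have "V \<inter> U \<noteq> {}"
        proof
          assume "V \<inter> U = {}"
          then have "U \<inter> X closure_of V = {}"
            using openin_Int_closure_of_eq_empty[OF U(1), of V] by (simp add: Int_commute)
          then show False using V(2) uT(2) by blast
        qed
        then have "u \<in> G V" using u V(1) by blast
        then show ?thesis unfolding G_def using V(2) by (auto split: if_splits)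
      qed
      with uT show "u \<in> N" unfolding N_def by blast
    qed
    ultimately show "\<exists>T. openin (tangent_topology A) T \<and> v \<in> T \<and> T \<subseteq> N" by blast
  qed
  have cover: "\<exists>a p \<rho>. adapted a p \<rho> \<and> v \<in> tvec_nbhd a p \<rho>" if "v \<in> N" for v
    using common[OF that that refl] by blast
  have N_exp: "N \<subseteq> exp_domain X A H" using cover adaptedD(5) by blast
  have star: "star_shaped N"
    unfolding star_shaped_def
  proof (intro ballI)
    fix v and s :: real assume v: "v \<in> N" and s: "s \<in> {0..1}"
    have "scale_tvec s v \<in> T V" if V: "V \<in> \<V>" "base (scale_tvec s v) \<in> X closure_of V" for V
    proof -
      have "v \<in> T V" using v V unfolding N_def scale_tvec_def by simp
      then have vT: "v \<in> tangent_bundle A" "base v \<in> dom_chart (a V)"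
          "coords (a V) (base v) \<in> ball (coords (a V) (p V)) (\<rho> V)" "norm (components v (a V)) < \<rho> V"
        unfolding T_def tvec_nbhd_iff by auto
      have "norm (s *\<^sub>R components v (a V)) \<le> norm (components v (a V))"
        using s by (simp add: mult_left_le_one_le)
      then have "s *\<^sub>R components v (a V) \<in> ball 0 (\<rho> V)" using vT(4) by simp
      then show ?thesis
        unfolding T_def tvec_nbhd_iff using scale_tvec_mem[OF vT(1)] vT(2,3) by (simp add: scale_tvec_def)
    qed
    moreover have "v \<in> tangent_bundle A" using v unfolding N_def by blast
    ultimately show "scale_tvec s v \<in> N" unfolding N_def using scale_tvec_mem by blast
  qed
  have zero: "zero_tvec q \<in> N" if q: "q \<in> topspace X" for q
  proof -
    have "zero_tvec q \<in> T V" if V: "V \<in> \<V>" "q \<in> X closure_of V" for V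
    proof -
      have "components (zero_tvec q) (a V) \<in> ball 0 (\<rho> V)"
        using adaptedD(3)[OF ad[OF V(1)]] by (simp add: zero_tvec_def)
      then show ?thesis
        unfolding T_def tvec_nbhd_iff base_zero_tvec
        using cl[OF V] zero_tvec_mem[OF q] by (elim conjE) (intro conjI)
    qed
    then show ?thesis unfolding N_def mem_Collect_eq base_zero_tvec using zero_tvec_mem[OF q] by blast
  qed
  have diag: "(q, q) \<in> exp_map X A H ` N" if q: "q \<in> topspace X" for q
  proof (rule image_eqI[OF _ zero[OF q]])
    show "(q, q) = exp_map X A H (zero_tvec q)"
      unfolding exp_map_eq[OF zero_in_exp_domain[OF q]] endpoint_zero[OF q] base_zero_tvec by (rule refl)
  qed
  have W_open: "openin (prod_topology X X) (exp_map X A H ` N)"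
    by (rule lipeomorphism_exp_map(1)[OF N_open cover common])
  have lip: "lipeomorphism (tangent_topology A) (prod_topology X X) (tangent_charts A) (prod_charts A A)
      N (exp_map X A H ` N) (exp_map X A H)"
    by (rule lipeomorphism_exp_map(2)[OF N_open cover common])
  show ?thesis
  proof (intro exI conjI)
    show "zero_tvec ` topspace X \<subseteq> N" using zero by blast
    show "(\<lambda>p. (p, p)) ` topspace X \<subseteq> exp_map X A H ` N" using diag by blast
  qed (rule N_open N_exp star W_open lip)+
qed

text \<open>Within a fibre a single adapted neighborhood is enough. The estimate for \<open>exp\<close> restricts to the fibre
  because there the first components of the images coincide.\<close>

lemma exp_at_lipeomorphism:
  assumes pX: "p \<in> topspace X"
  shows "\<exists>N W. openin (fibre_topology A p) N \<and> N \<subseteq> exp_domain_at X A H p \<and> star_shaped N \<and>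
     openin X W \<and> p \<in> W \<and>
     lipeomorphism (fibre_topology A p) X (fibre_charts A p) A N W (exp_at X A H)"
proof -
  obtain a where a: "a \<in> A" "p \<in> dom_chart a" using pX unfolding topspace_eq by blast
  obtain \<rho> where ad: "adapted a p \<rho>" using adapted_exists[OF a] by blast
  let ?f = "fchart A p a"
  have dom: "dom_chart ?f = tangent_space A p" and co: "coords ?f v = components v a" for v
    unfolding fchart_def by simp_all
  have f: "?f \<in> fibre_charts A p" unfolding fibre_charts_eq using a by blast
  define N where "N = {v \<in> dom_chart ?f. coords ?f v \<in> ball 0 \<rho>}"
  have N_open: "openin (fibre_topology A p) N"
    unfolding N_def by (rule openin_chart_preimage[OF fibre_atlas f open_ball])
  have Np: "v \<in> tangent_bundle A" "base v = p" if "v \<in> N" for v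
    using that unfolding N_def dom tangent_space_def by auto
  have Nt: "v \<in> tvec_nbhd a p \<rho>" if "v \<in> N" for v
    using Np[OF that] that a(2) adaptedD(3)[OF ad] unfolding tvec_nbhd_iff N_def co by simp
  have N_exp: "N \<subseteq> exp_domain_at X A H p"
    using adaptedD(5)[OF ad Nt] unfolding exp_domain_at_eq N_def dom by blast
  have expN: "exp_at X A H v = base (flow v 1)" if "v \<in> N" for v
    by (rule exp_at_eq[OF adaptedD(5)[OF ad Nt[OF that]]])
  have inj: "inj_on (exp_at X A H) N"
  proof (rule inj_onI)
    fix v w assume v: "v \<in> N" and w: "w \<in> N" and "exp_at X A H v = exp_at X A H w"
    then have "base (flow v 1) = base (flow w 1)" unfolding expN[OF v] expN[OF w] by blast
    then show "v = w" using exp_inj_on_tvec_nbhd[OF ad Nt[OF v] Nt[OF w]] Np(2)[OF v] Np(2)[OF w] by simp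
  qed
  have expr: "coord_expr ?f a (exp_at X A H) y = endpoint_coords a (coords a p, y)" if y: "y \<in> ball 0 \<rho>" for y
  proof -
    have "y \<in> coords ?f ` dom_chart ?f" unfolding fchart_image[OF a] by simp
    then obtain v where v: "v \<in> dom_chart ?f" "y = coords ?f v" by blast
    have vN: "v \<in> N" unfolding N_def using v y by blast
    have vt: "v \<in> dom_chart (tchart A a)" "coords (tchart A a) v = (coords a p, y)"
      using Np[OF vN] a(2) v(2) unfolding dom_tchart coords_tchart co by auto
    show ?thesis
      unfolding vt(2)[symmetric] endpoint_coords_eq[OF a(1) vt(1)]
      unfolding v(2) coord_expr_coords[OF inj_fchart[OF a] v(1)] expN[OF vN] by (rule refl)
  qed
  have expansive: "dist y z \<le> 6 * dist (coord_expr ?f a (exp_at X A H) y) (coord_expr ?f a (exp_at X A H) z)"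
    if y: "y \<in> ball 0 \<rho>" and z: "z \<in> ball 0 \<rho>" for y z
  proof -
    have "(coords a p, y) \<in> box_nbhd a p \<rho>" "(coords a p, z) \<in> box_nbhd a p \<rho>"
      unfolding box_nbhd_def using y z adaptedD(3)[OF ad] by simp_all
    from adaptedD(7)[OF ad this] show ?thesis
      unfolding expr[OF y] expr[OF z] by (simp add: dist_Pair_Pair)
  qed
  have local: "\<exists>b\<in>fibre_charts A p. \<exists>c\<in>A. lip_in b c N (exp_at X A H) v \<and>
      (\<exists>S m. open S \<and> coords b v \<in> S \<and>
        (\<forall>y\<in>S. \<forall>z\<in>S. dist y z \<le> m * dist (coord_expr b c (exp_at X A H) y) (coord_expr b c (exp_at X A H) z)))"
    if v: "v \<in> N" for v
  proof -
    have vf: "v \<in> dom_chart ?f" "coords ?f v \<in> ball 0 \<rho>" using v unfolding N_def by blast+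
    have "exp_at X A H v \<in> dom_chart a" unfolding expN[OF v] by (rule adaptedD(6)[OF ad Nt[OF v]])
    then have "lip_in ?f a (exp_domain_at X A H p) (exp_at X A H) v"
      using exp_at_lipschitz[OF pX] subsetD[OF N_exp v] f a(1) vf(1) unfolding locally_lipschitz_map_iff by blast
    then have "lip_in ?f a N (exp_at X A H) v"
      by (rule lip_in_subset[OF fibre_atlas f _ N_open N_exp v])
    then show ?thesis using f a(1) vf(2) open_ball expansive by blast
  qed
  note lip = lipeomorphismI[OF fibre_atlas atlas inj local, unfolded chart_topology_eq]
  have star: "star_shaped N"
    unfolding star_shaped_def
  proof (intro ballI)
    fix v and s :: real assume v: "v \<in> N" and s: "s \<in> {0..1}"
    have "norm (components v a) < \<rho>" using v unfolding N_def co by simp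
    moreover have "norm (s *\<^sub>R components v a) \<le> norm (components v a)"
      using s by (simp add: mult_left_le_one_le)
    ultimately have "s *\<^sub>R components v a \<in> ball 0 \<rho>" by simp
    then show "scale_tvec s v \<in> N"
      using scale_tvec_mem[OF Np(1)[OF v], of s] Np(2)[OF v]
      unfolding N_def dom co tangent_space_def by (simp add: scale_tvec_def)
  qed
  have z: "zero_tvec p \<in> N"
    unfolding N_def dom co tangent_space_def
    using zero_tvec_mem[OF pX] adaptedD(3)[OF ad] by (simp add: zero_tvec_def)
  have "p \<in> exp_at X A H ` N"
    using expN[OF z] endpoint_zero[OF pX] z by (metis imageI)
  then show ?thesis using N_open N_exp star lip by blast
qed

end

theorem theorem3:
  fixes X :: "'p topology" and A :: "('p, real^'n) chart set" and H :: "('p, 'n) spray"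
  assumes "C21_manifold X A"
    and "locally_lipschitz_spray A H"
  shows
    "(openin (tangent_topology A) (exp_domain X A H) \<and>
      locally_lipschitz_map (tangent_charts A) (prod_charts A A)
        (exp_domain X A H) (exp_map X A H) \<and>
      (\<forall>p\<in>topspace X. strongly_differentiable_map (tangent_charts A) (prod_charts A A)
        (exp_domain X A H) (exp_map X A H) (zero_tvec p)) \<and>
      (\<exists>N W. openin (tangent_topology A) N \<and> N \<subseteq> exp_domain X A H \<and> star_shaped N \<and>
         zero_tvec ` topspace X \<subseteq> N \<and>
         openin (prod_topology X X) W \<and> (\<lambda>p. (p, p)) ` topspace X \<subseteq> W \<and>
         lipeomorphism (tangent_topology A) (prod_topology X X)
           (tangent_charts A) (prod_charts A A) N W (exp_map X A H))) \<and>
     (\<forall>p\<in>topspace X.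
      openin (fibre_topology A p) (exp_domain_at X A H p) \<and>
      locally_lipschitz_map (fibre_charts A p) A (exp_domain_at X A H p) (exp_at X A H) \<and>
      strongly_differentiable_map (fibre_charts A p) A
        (exp_domain_at X A H p) (exp_at X A H) (zero_tvec p) \<and>
      (\<exists>N W. openin (fibre_topology A p) N \<and> N \<subseteq> exp_domain_at X A H p \<and> star_shaped N \<and>
         openin X W \<and> p \<in> W \<and>
         lipeomorphism (fibre_topology A p) X (fibre_charts A p) A N W (exp_at X A H)))"
proof -
  interpret spray_manifold X A H
    using assms by unfold_locales
  show ?thesis
    by (intro conjI ballI exp_domain_openin exp_map_lipschitz exp_strongly_differentiable exp_lipeomorphism
        exp_domain_at_openin exp_at_lipschitz exp_at_strongly_differentiable exp_at_lipeomorphism)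
qed

end
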